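(* Let $\mathfrak g$ be a Leibniz algebra over a field $\mathbb K$ of characteristic $0$, let $\mathfrak g_{Lie}=\mathfrak g/I$ and let $F_{Lie}\,\mathfrak g[1]$ be the free graded Lie algebra on $\mathfrak g[1]$. Then the total space $\mathcal{DR}\,\mathfrak g[1]=\mathfrak g_{Lie}\oplus F_{Lie}\,\mathfrak g[1]$, with the bracket $(\cdot,\cdot)$ and the differential $\mathbf d$ described in the context, is a differential graded Lie algebra, and the odd Leibniz bracket of the Lie-Leibniz algebra $F_{Lie}\,\mathfrak g[1]$ is its derived bracket: $[\alpha,\beta]=(\mathbf d\alpha,\beta)$ for all $\alpha,\beta\in F_{Lie}\,\mathfrak g[1]$. Therefore the inclusion $\iota:\mathfrak g[1]\to\mathfrak g_{Lie}\oplus F_{Lie}\,\mathfrak g[1]$ is a derived bracket representation of $\mathfrak g$. This representation is universal: for every dg Lie algebra $(\mathfrak h,(\cdot,\cdot),D)$ and every derived bracket representation $f:\mathfrak g[1]\to\mathfrak h$ there is a unique morphism of dg Lie algebras $\psi:\mathcal{DR}\,\mathfrak g[1]\to\mathfrak h$ with $f=\psi\circ\iota$. Equivalently, $\psi\mapsto\psi\circ\iota$ is a bijection, natural in $\mathfrak h$, $$\mathrm{Hom}_{dgLie}(\mathcal{DR}\,\mathfrak g[1],\mathfrak h)\cong \mathrm{Hom}_{Leib}(\mathfrak g[1],(\mathfrak h,(D\cdot,\cdot))).$$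
   Context: A (left) Leibniz algebra is a vector space $\mathfrak g$ (in degree $0$) with a bilinear bracket satisfying $[x_1,[x_2,x_3]]=[[x_1,x_2],x_3]+[x_2,[x_1,x_3]]$. $I\subset\mathfrak g$ is the span of all $[x_1,x_2]+[x_2,x_1]$; it is an ideal with $[I,\mathfrak g]=0$, and $\mathfrak g_{Lie}:=\mathfrak g/I$ is a Lie algebra; $\bar x$ denotes the class of $x$. $\mathfrak g[1]$ is $\mathfrak g$ placed in degree $-1$, with the same bracket $[x,y]$, now of degree $+1$. An odd Leibniz algebra is a graded space with a bracket of degree $+1$ satisfying $[x,[y,z]]=(-1)^{|x|+1}[[x,y],z]+(-1)^{(|x|+1)(|y|+1)}[y,[x,z]]$ (on $\mathfrak g[1]$ this is the Leibniz identity of $\mathfrak g$). A dg Lie algebra $(\mathfrak h,(\cdot,\cdot),D)$ has a graded Lie bracket of degree $0$ and a derivation $D$ of degree $+1$ with $D^2=0$. Its derived bracket $[x,y]:=(Dx,y)$ is an odd Leibniz bracket on $\mathfrak h$. A derived bracket representation of $\mathfrak g$ is a degree-preserving morphism of odd Leibniz algebras $f:\mathfrak g[1]\to(\mathfrak h,(D\cdot,\cdot))$, i.e. $f([x,y])=(Df(x),f(y))$. $F_{Lie}\,\mathfrak g[1]=\bigoplus_{n\ge1}F^n_{Lie}\,\mathfrak g[1]$ is the free graded Lie algebra on $\mathfrak g[1]$ (Koszul signs; elements of $\mathfrak g[1]$ are odd), where $n$ is the bracket length; $F^n_{Lie}\,\mathfrak g[1]$ has degree $-n$. Write $\{x_1,\dots,x_n\}:=(x_1,(x_2,(\dots,x_n)))$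 for right-normed brackets of elements of $\mathfrak g[1]$. Lie bracket on $\mathfrak g_{Lie}\oplus F_{Lie}\,\mathfrak g[1]$ ($\mathfrak g_{Lie}$ in degree $0$): the Lie algebra $\mathfrak g_{Lie}$ acts on $\mathfrak g[1]$ by $(\bar x_1,x_2):=[x_1,x_2]$; this is extended to $F_{Lie}\,\mathfrak g[1]$ by derivations of the free Lie algebra, and $$(\bar x_1\oplus\alpha_1,\bar x_2\oplus\alpha_2):=(\bar x_1,\bar x_2)\oplus\big((\bar x_1,\alpha_2)-(\bar x_2,\alpha_1)+(\alpha_1,\alpha_2)\big).$$ Differential $\mathbf d$ on $\mathfrak g_{Lie}\oplus F_{Lie}\,\mathfrak g[1]$: $\mathbf d\bar x=0$; $\mathbf d x=\bar x$ for $x\in\mathfrak g[1]$; and for $n\ge1$, $\mathbf d:F^{n+1}_{Lie}\,\mathfrak g[1]\to F^{n}_{Lie}\,\mathfrak g[1]$ is the (well-defined) linear map with $$\mathbf d\{x_1,\dots,x_{n+1}\}=\sum_{i<j,\ i\le n}(-1)^{i-1}\{x_1,\dots,\widehat{x_i},\dots,[x_i,x_j],x_{j+1},\dots,x_{n+1}\}+(-1)^{n-1}\{x_1,\dots,x_{n-1},[x_{n+1},x_n]\},$$ where $\widehat{x_i}$ means omission and $[x_i,x_j]$ replaces $x_j$. A Lie-Leibniz algebra is a graded space with a graded Lie bracket $(\cdot,\cdot)$ of degree $0$ and an odd Leibniz bracket $[\cdot,\cdot]$ of degree $+1$ with $[x,(y,z)]=([x,y],z)+(-1)^{(|x|+1)|y|}(y,[x,z])$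 and $[(x,y),z]=([x,y]-(-1)^{|x||y|}[y,x],z)$. It is known that $F_{Lie}\,\mathfrak g[1]$ with its free Lie bracket is a Lie-Leibniz algebra for a unique odd Leibniz bracket extending that of $\mathfrak g[1]$; this is the odd Leibniz bracket on $F_{Lie}\,\mathfrak g[1]$ meant in the claim. *)

theory Defs
  imports "HOL-Algebra.Module" "HOL-Algebra.AbelCoset" "HOL.Hull"
begin

text \<open>
  Vector spaces are modules, in the sense of \<^locale>\<open>module\<close>, over a field of characteristic
  \<open>0\<close>. The fields \<^const>\<open>mult\<close> and \<^const>\<open>one\<close>
  of a module record play no role there; all brackets are passed as separate arguments, since the
  same space carries several of them.
\<close>

locale char0_vector_space = field K + module K V
  for K (structure) and V (structure) +
  assumes char0: "0 < n \<Longrightarrow> add_pow K (n::nat) \<one>\<^bsub>K\<^esub> \<noteq> \<zero>\<^bsub>K\<^esub>"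

definition linear_map ::
  "('k, 'c) ring_scheme \<Rightarrow> ('k, 'v, 'a) module_scheme \<Rightarrow> ('k, 'w, 'b) module_scheme \<Rightarrow> ('v \<Rightarrow> 'w) \<Rightarrow> bool"
  where "linear_map K V W f \<longleftrightarrow>
    f \<in> carrier V \<rightarrow> carrier W \<and>
    (\<forall>x\<in>carrier V. \<forall>y\<in>carrier V. f (x \<oplus>\<^bsub>V\<^esub> y) = f x \<oplus>\<^bsub>W\<^esub> f y) \<and>
    (\<forall>a\<in>carrier K. \<forall>x\<in>carrier V. f (a \<odot>\<^bsub>V\<^esub> x) = a \<odot>\<^bsub>W\<^esub> f x)"

definition bilinear_op ::
  "('k, 'c) ring_scheme \<Rightarrow> ('k, 'v, 'a) module_scheme \<Rightarrow> ('v \<Rightarrow> 'v \<Rightarrow> 'v) \<Rightarrow> bool"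
  where "bilinear_op K V b \<longleftrightarrow>
    (\<forall>x\<in>carrier V. linear_map K V V (\<lambda>y. b x y)) \<and>
    (\<forall>y\<in>carrier V. linear_map K V V (\<lambda>x. b x y))"

text \<open>Multiplication of a vector by \<open>(-1)\<close> to the power \<open>n\<close>.\<close>

definition sgnv :: "('k, 'v, 'a) module_scheme \<Rightarrow> int \<Rightarrow> 'v \<Rightarrow> 'v"
  where "sgnv V n v = (if even n then v else \<ominus>\<^bsub>V\<^esub> v)"


section \<open>Graded algebras\<close>

locale graded_space = char0_vector_space K V
  for K (structure) and V (structure) +
  fixes gr :: "int \<Rightarrow> 'c set"
  assumes gr_submodule: "submodule (gr n) K V"
    and direct_sum: "v \<in> carrier V \<Longrightarrow>
      \<exists>!c. (\<forall>n. c n \<in> gr n) \<and> finite {n. c n \<noteq> \<zero>\<^bsub>V\<^esub>} \<and>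
           v = finsum V c {n. c n \<noteq> \<zero>\<^bsub>V\<^esub>}"

locale graded_lie_algebra = graded_space K V gr
  for K (structure) and V (structure) and gr +
  fixes lie :: "'c \<Rightarrow> 'c \<Rightarrow> 'c"
  assumes lie_bilinear: "bilinear_op K V lie"
    and lie_degree: "\<lbrakk>x \<in> gr i; y \<in> gr j\<rbrakk> \<Longrightarrow> lie x y \<in> gr (i + j)"
    and lie_antisym: "\<lbrakk>x \<in> gr i; y \<in> gr j\<rbrakk> \<Longrightarrow> lie x y = \<ominus>\<^bsub>V\<^esub> sgnv V (i * j) (lie y x)"
    and lie_jacobi: "\<lbrakk>x \<in> gr i; y \<in> gr j; z \<in> gr k\<rbrakk> \<Longrightarrow>
      lie x (lie y z) = lie (lie x y) z \<oplus>\<^bsub>V\<^esub> sgnv V (i * j) (lie y (lie x z))"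

locale dg_lie_algebra = graded_lie_algebra K V gr lie
  for K (structure) and V (structure) and gr and lie +
  fixes D :: "'c \<Rightarrow> 'c"
  assumes D_linear: "linear_map K V V D"
    and D_degree: "x \<in> gr i \<Longrightarrow> D x \<in> gr (i + 1)"
    and D_derivation: "\<lbrakk>x \<in> gr i; y \<in> gr j\<rbrakk> \<Longrightarrow>
      D (lie x y) = lie (D x) y \<oplus>\<^bsub>V\<^esub> sgnv V i (lie x (D y))"
    and D_square: "x \<in> carrier V \<Longrightarrow> D (D x) = \<zero>\<^bsub>V\<^esub>"

locale odd_leibniz_algebra = graded_space K V gr
  for K (structure) and V (structure) and gr +
  fixes leib :: "'c \<Rightarrow> 'c \<Rightarrow> 'c"
  assumes leib_bilinear: "bilinear_op K V leib"
    and leib_degree: "\<lbrakk>x \<in> gr i; y \<in> gr j\<rbrakk> \<Longrightarrow> leib x y \<in> gr (i + j + 1)"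
    and odd_leibniz: "\<lbrakk>x \<in> gr i; y \<in> gr j; z \<in> gr k\<rbrakk> \<Longrightarrow>
      leib x (leib y z) =
        sgnv V (i + 1) (leib (leib x y) z) \<oplus>\<^bsub>V\<^esub> sgnv V ((i + 1) * (j + 1)) (leib y (leib x z))"

locale lie_leibniz_algebra =
  graded_lie_algebra K V gr lie + odd_leibniz_algebra K V gr leib
  for K (structure) and V (structure) and gr and lie and leib +
  assumes leib_lie: "\<lbrakk>x \<in> gr i; y \<in> gr j; z \<in> gr k\<rbrakk> \<Longrightarrow>
      leib x (lie y z) = lie (leib x y) z \<oplus>\<^bsub>V\<^esub> sgnv V ((i + 1) * j) (lie y (leib x z))"
    and lie_leib: "\<lbrakk>x \<in> gr i; y \<in> gr j; z \<in> gr k\<rbrakk> \<Longrightarrow>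
      leib (lie x y) z = lie (leib x y \<ominus>\<^bsub>V\<^esub> sgnv V (i * j) (leib y x)) z"

text \<open>Morphisms are extensional functions, so that equality in a hom-set is equality on the
  carrier of the source.\<close>

definition dg_lie_homs ::
  "('k, 'c) ring_scheme \<Rightarrow>
   ('k, 'v, 'a) module_scheme \<Rightarrow> (int \<Rightarrow> 'v set) \<Rightarrow> ('v \<Rightarrow> 'v \<Rightarrow> 'v) \<Rightarrow> ('v \<Rightarrow> 'v) \<Rightarrow>
   ('k, 'w, 'b) module_scheme \<Rightarrow> (int \<Rightarrow> 'w set) \<Rightarrow> ('w \<Rightarrow> 'w \<Rightarrow> 'w) \<Rightarrow> ('w \<Rightarrow> 'w) \<Rightarrow> ('v \<Rightarrow> 'w) set"
  where "dg_lie_homs K V grV lieV DV W grW lieW DW =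
    {f \<in> extensional (carrier V).
       linear_map K V W f \<and>
       (\<forall>n. \<forall>x\<in>grV n. f x \<in> grW n) \<and>
       (\<forall>x\<in>carrier V. \<forall>y\<in>carrier V. f (lieV x y) = lieW (f x) (f y)) \<and>
       (\<forall>x\<in>carrier V. f (DV x) = DW (f x))}"

definition odd_leibniz_homs ::
  "('k, 'c) ring_scheme \<Rightarrow>
   ('k, 'v, 'a) module_scheme \<Rightarrow> (int \<Rightarrow> 'v set) \<Rightarrow> ('v \<Rightarrow> 'v \<Rightarrow> 'v) \<Rightarrow>
   ('k, 'w, 'b) module_scheme \<Rightarrow> (int \<Rightarrow> 'w set) \<Rightarrow> ('w \<Rightarrow> 'w \<Rightarrow> 'w) \<Rightarrow> ('v \<Rightarrow> 'w) set"
  where "odd_leibniz_homs K V grV leibV W grW leibW =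
    {f \<in> extensional (carrier V).
       linear_map K V W f \<and>
       (\<forall>n. \<forall>x\<in>grV n. f x \<in> grW n) \<and>
       (\<forall>x\<in>carrier V. \<forall>y\<in>carrier V. f (leibV x y) = leibW (f x) (f y))}"

definition derived_bracket :: "('v \<Rightarrow> 'v \<Rightarrow> 'v) \<Rightarrow> ('v \<Rightarrow> 'v) \<Rightarrow> 'v \<Rightarrow> 'v \<Rightarrow> 'v"
  where "derived_bracket lie D x y = lie (D x) y"


section \<open>Leibniz algebras and the quotient Lie algebra\<close>

locale leibniz_algebra = char0_vector_space K V
  for K (structure) and V (structure) +
  fixes br :: "'c \<Rightarrow> 'c \<Rightarrow> 'c"
  assumes br_bilinear: "bilinear_op K V br"
    and leibniz: "\<lbrakk>x \<in> carrier V; y \<in> carrier V; z \<in> carrier V\<rbrakk> \<Longrightarrow>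
      br x (br y z) = br (br x y) z \<oplus>\<^bsub>V\<^esub> br y (br x z)"

definition shift_grading :: "('k, 'v, 'a) module_scheme \<Rightarrow> int \<Rightarrow> 'v set"
  where "shift_grading V n = (if n = -1 then carrier V else {\<zero>\<^bsub>V\<^esub>})"

definition derived_bracket_reps ::
  "('k, 'c) ring_scheme \<Rightarrow> ('k, 'v, 'a) module_scheme \<Rightarrow> ('v \<Rightarrow> 'v \<Rightarrow> 'v) \<Rightarrow>
   ('k, 'w, 'b) module_scheme \<Rightarrow> (int \<Rightarrow> 'w set) \<Rightarrow> ('w \<Rightarrow> 'w \<Rightarrow> 'w) \<Rightarrow> ('w \<Rightarrow> 'w) \<Rightarrow> ('v \<Rightarrow> 'w) set"
  where "derived_bracket_reps K V br W grW lieW DW =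
    odd_leibniz_homs K V (shift_grading V) br W grW (derived_bracket lieW DW)"

definition leib_kernel ::
  "('k, 'c) ring_scheme \<Rightarrow> ('k, 'v, 'a) module_scheme \<Rightarrow> ('v \<Rightarrow> 'v \<Rightarrow> 'v) \<Rightarrow> 'v set"
  where "leib_kernel K V br =
    (\<lambda>N. submodule N K V) hull {br x y \<oplus>\<^bsub>V\<^esub> br y x |x y. x \<in> carrier V \<and> y \<in> carrier V}"

definition quot_class ::
  "('k, 'c) ring_scheme \<Rightarrow> ('k, 'v, 'a) module_scheme \<Rightarrow> ('v \<Rightarrow> 'v \<Rightarrow> 'v) \<Rightarrow> 'v \<Rightarrow> 'v set"
  where "quot_class K V br x = leib_kernel K V br +>\<^bsub>V\<^esub> x"

text \<open>Operations on quotients are defined as the union of the classes of the results over all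
  representatives.\<close>

definition quot_lie ::
  "('k, 'c) ring_scheme \<Rightarrow> ('k, 'v, 'a) module_scheme \<Rightarrow> ('v \<Rightarrow> 'v \<Rightarrow> 'v) \<Rightarrow> ('k, 'v set) module"
  where "quot_lie K V br =
    \<lparr>carrier = quot_class K V br ` carrier V,
     mult = undefined, one = undefined,
     zero = quot_class K V br \<zero>\<^bsub>V\<^esub>,
     add = (\<lambda>X Y. \<Union>x\<in>X. \<Union>y\<in>Y. quot_class K V br (x \<oplus>\<^bsub>V\<^esub> y)),
     smult = (\<lambda>a X. \<Union>x\<in>X. quot_class K V br (a \<odot>\<^bsub>V\<^esub> x))\<rparr>"

definition quot_bracket ::
  "('k, 'c) ring_scheme \<Rightarrow> ('k, 'v, 'a) module_scheme \<Rightarrow> ('v \<Rightarrow> 'v \<Rightarrow> 'v) \<Rightarrow>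
   'v set \<Rightarrow> 'v set \<Rightarrow> 'v set"
  where "quot_bracket K V br X Y = (\<Union>x\<in>X. \<Union>y\<in>Y. quot_class K V br (br x y))"


section \<open>The free graded Lie algebra on \<open>V[1]\<close>\<close>

text \<open>
  The free graded Lie algebra is presented by generators and relations: its elements are terms in
  the operations of a graded Lie algebra with generators in \<open>V\<close>, modulo the least
  congruence making the quotient a \<open>K\<close>-vector space with a bilinear graded Lie bracket
  for which the insertion of generators is linear.
\<close>

datatype ('k, 'v) lie_term =
    Gen 'v
  | TZero
  | TAdd "('k, 'v) lie_term" "('k, 'v) lie_term"
  | TSmult 'k "('k, 'v) lie_term"
  | TBr "('k, 'v) lie_term" "('k, 'v) lie_term"

inductive_set lie_terms ::
  "('k, 'c) ring_scheme \<Rightarrow> ('k, 'v, 'a) module_scheme \<Rightarrow> ('k, 'v) lie_term set"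
  for K and V
  where
    "x \<in> carrier V \<Longrightarrow> Gen x \<in> lie_terms K V"
  | "TZero \<in> lie_terms K V"
  | "\<lbrakk>s \<in> lie_terms K V; t \<in> lie_terms K V\<rbrakk> \<Longrightarrow> TAdd s t \<in> lie_terms K V"
  | "\<lbrakk>a \<in> carrier K; t \<in> lie_terms K V\<rbrakk> \<Longrightarrow> TSmult a t \<in> lie_terms K V"
  | "\<lbrakk>s \<in> lie_terms K V; t \<in> lie_terms K V\<rbrakk> \<Longrightarrow> TBr s t \<in> lie_terms K V"

text \<open>Terms homogeneous of bracket length \<open>n\<close>; these have degree \<open>-n\<close>.\<close>

inductive has_length :: "nat \<Rightarrow> ('k, 'v) lie_term \<Rightarrow> bool"
  where
    "has_length 1 (Gen x)"
  | "has_length n TZero"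
  | "\<lbrakk>has_length n s; has_length n t\<rbrakk> \<Longrightarrow> has_length n (TAdd s t)"
  | "has_length n t \<Longrightarrow> has_length n (TSmult a t)"
  | "\<lbrakk>has_length m s; has_length n t\<rbrakk> \<Longrightarrow> has_length (m + n) (TBr s t)"

definition sgnt :: "('k, 'c) ring_scheme \<Rightarrow> nat \<Rightarrow> ('k, 'v) lie_term \<Rightarrow> ('k, 'v) lie_term"
  where "sgnt K n t = TSmult ((\<ominus>\<^bsub>K\<^esub> \<one>\<^bsub>K\<^esub>) [^]\<^bsub>K\<^esub> n) t"

inductive_set lie_rel ::
  "('k, 'c) ring_scheme \<Rightarrow> ('k, 'v, 'a) module_scheme \<Rightarrow> (('k, 'v) lie_term \<times> ('k, 'v) lie_term) set"
  for K and V
  where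
    refl: "t \<in> lie_terms K V \<Longrightarrow> (t, t) \<in> lie_rel K V"
  | sym: "(s, t) \<in> lie_rel K V \<Longrightarrow> (t, s) \<in> lie_rel K V"
  | trans: "\<lbrakk>(s, t) \<in> lie_rel K V; (t, u) \<in> lie_rel K V\<rbrakk> \<Longrightarrow> (s, u) \<in> lie_rel K V"
  | cong_add: "\<lbrakk>(s, s') \<in> lie_rel K V; (t, t') \<in> lie_rel K V\<rbrakk> \<Longrightarrow>
      (TAdd s t, TAdd s' t') \<in> lie_rel K V"
  | cong_smult: "\<lbrakk>a \<in> carrier K; (t, t') \<in> lie_rel K V\<rbrakk> \<Longrightarrow>
      (TSmult a t, TSmult a t') \<in> lie_rel K V"
  | cong_br: "\<lbrakk>(s, s') \<in> lie_rel K V; (t, t') \<in> lie_rel K V\<rbrakk> \<Longrightarrow>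
      (TBr s t, TBr s' t') \<in> lie_rel K V"
  | add_assoc: "\<lbrakk>s \<in> lie_terms K V; t \<in> lie_terms K V; u \<in> lie_terms K V\<rbrakk> \<Longrightarrow>
      (TAdd (TAdd s t) u, TAdd s (TAdd t u)) \<in> lie_rel K V"
  | add_comm: "\<lbrakk>s \<in> lie_terms K V; t \<in> lie_terms K V\<rbrakk> \<Longrightarrow>
      (TAdd s t, TAdd t s) \<in> lie_rel K V"
  | add_zero: "t \<in> lie_terms K V \<Longrightarrow> (TAdd TZero t, t) \<in> lie_rel K V"
  | add_neg: "t \<in> lie_terms K V \<Longrightarrow>
      (TAdd (TSmult (\<ominus>\<^bsub>K\<^esub> \<one>\<^bsub>K\<^esub>) t) t, TZero) \<in> lie_rel K V"
  | smult_add_left: "\<lbrakk>a \<in> carrier K; b \<in> carrier K; t \<in> lie_terms K V\<rbrakk> \<Longrightarrow>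
      (TSmult (a \<oplus>\<^bsub>K\<^esub> b) t, TAdd (TSmult a t) (TSmult b t)) \<in> lie_rel K V"
  | smult_add_right: "\<lbrakk>a \<in> carrier K; s \<in> lie_terms K V; t \<in> lie_terms K V\<rbrakk> \<Longrightarrow>
      (TSmult a (TAdd s t), TAdd (TSmult a s) (TSmult a t)) \<in> lie_rel K V"
  | smult_assoc: "\<lbrakk>a \<in> carrier K; b \<in> carrier K; t \<in> lie_terms K V\<rbrakk> \<Longrightarrow>
      (TSmult (a \<otimes>\<^bsub>K\<^esub> b) t, TSmult a (TSmult b t)) \<in> lie_rel K V"
  | smult_one: "t \<in> lie_terms K V \<Longrightarrow> (TSmult \<one>\<^bsub>K\<^esub> t, t) \<in> lie_rel K V"
  | gen_add: "\<lbrakk>x \<in> carrier V; y \<in> carrier V\<rbrakk> \<Longrightarrow>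
      (Gen (x \<oplus>\<^bsub>V\<^esub> y), TAdd (Gen x) (Gen y)) \<in> lie_rel K V"
  | gen_smult: "\<lbrakk>a \<in> carrier K; x \<in> carrier V\<rbrakk> \<Longrightarrow>
      (Gen (a \<odot>\<^bsub>V\<^esub> x), TSmult a (Gen x)) \<in> lie_rel K V"
  | br_add_left: "\<lbrakk>s \<in> lie_terms K V; t \<in> lie_terms K V; u \<in> lie_terms K V\<rbrakk> \<Longrightarrow>
      (TBr (TAdd s t) u, TAdd (TBr s u) (TBr t u)) \<in> lie_rel K V"
  | br_add_right: "\<lbrakk>s \<in> lie_terms K V; t \<in> lie_terms K V; u \<in> lie_terms K V\<rbrakk> \<Longrightarrow>
      (TBr s (TAdd t u), TAdd (TBr s t) (TBr s u)) \<in> lie_rel K V"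
  | br_smult_left: "\<lbrakk>a \<in> carrier K; s \<in> lie_terms K V; t \<in> lie_terms K V\<rbrakk> \<Longrightarrow>
      (TBr (TSmult a s) t, TSmult a (TBr s t)) \<in> lie_rel K V"
  | br_smult_right: "\<lbrakk>a \<in> carrier K; s \<in> lie_terms K V; t \<in> lie_terms K V\<rbrakk> \<Longrightarrow>
      (TBr s (TSmult a t), TSmult a (TBr s t)) \<in> lie_rel K V"
  | antisym: "\<lbrakk>s \<in> lie_terms K V; t \<in> lie_terms K V; has_length m s; has_length n t\<rbrakk> \<Longrightarrow>
      (TBr s t, sgnt K (m * n + 1) (TBr t s)) \<in> lie_rel K V"
  | jacobi: "\<lbrakk>s \<in> lie_terms K V; t \<in> lie_terms K V; u \<in> lie_terms K V;
        has_length m s; has_length n t\<rbrakk> \<Longrightarrow>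
      (TBr s (TBr t u), TAdd (TBr (TBr s t) u) (sgnt K (m * n) (TBr t (TBr s u)))) \<in> lie_rel K V"

definition lie_class ::
  "('k, 'c) ring_scheme \<Rightarrow> ('k, 'v, 'a) module_scheme \<Rightarrow> ('k, 'v) lie_term \<Rightarrow> ('k, 'v) lie_term set"
  where "lie_class K V t = lie_rel K V `` {t}"

definition free_lie ::
  "('k, 'c) ring_scheme \<Rightarrow> ('k, 'v, 'a) module_scheme \<Rightarrow> ('k, ('k, 'v) lie_term set) module"
  where "free_lie K V =
    \<lparr>carrier = lie_terms K V // lie_rel K V,
     mult = undefined, one = undefined,
     zero = lie_class K V TZero,
     add = (\<lambda>A B. \<Union>s\<in>A. \<Union>t\<in>B. lie_class K V (TAdd s t)),
     smult = (\<lambda>a A. \<Union>t\<in>A. lie_class K V (TSmult a t))\<rparr>"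

definition free_bracket ::
  "('k, 'c) ring_scheme \<Rightarrow> ('k, 'v, 'a) module_scheme \<Rightarrow>
   ('k, 'v) lie_term set \<Rightarrow> ('k, 'v) lie_term set \<Rightarrow> ('k, 'v) lie_term set"
  where "free_bracket K V A B = (\<Union>s\<in>A. \<Union>t\<in>B. lie_class K V (TBr s t))"

definition free_part ::
  "('k, 'c) ring_scheme \<Rightarrow> ('k, 'v, 'a) module_scheme \<Rightarrow> nat \<Rightarrow> ('k, 'v) lie_term set set"
  where "free_part K V n = lie_class K V ` {t \<in> lie_terms K V. has_length n t}"

definition free_grading ::
  "('k, 'c) ring_scheme \<Rightarrow> ('k, 'v, 'a) module_scheme \<Rightarrow> int \<Rightarrow> ('k, 'v) lie_term set set"
  where "free_grading K V n =
    (if n < 0 then free_part K V (nat (- n)) else {\<zero>\<^bsub>free_lie K V\<^esub>})"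

text \<open>The right-normed bracket \<open>{x\<^sub>1, \<dots>, x\<^sub>n}\<close> (junk for the empty list).\<close>

fun right_normed ::
  "('k, 'c) ring_scheme \<Rightarrow> ('k, 'v, 'a) module_scheme \<Rightarrow> 'v list \<Rightarrow> ('k, 'v) lie_term set"
  where
    "right_normed K V [] = lie_class K V TZero"
  | "right_normed K V [x] = lie_class K V (Gen x)"
  | "right_normed K V (x # y # xs) =
       free_bracket K V (lie_class K V (Gen x)) (right_normed K V (y # xs))"

definition is_free_leibniz_bracket ::
  "('k, 'c) ring_scheme \<Rightarrow> ('k, 'v, 'a) module_scheme \<Rightarrow> ('v \<Rightarrow> 'v \<Rightarrow> 'v) \<Rightarrow>
   (('k, 'v) lie_term set \<Rightarrow> ('k, 'v) lie_term set \<Rightarrow> ('k, 'v) lie_term set) \<Rightarrow> bool"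
  where "is_free_leibniz_bracket K V br leib \<longleftrightarrow>
    (\<forall>A B. \<not> (A \<in> carrier (free_lie K V) \<and> B \<in> carrier (free_lie K V)) \<longrightarrow> leib A B = undefined) \<and>
    lie_leibniz_algebra K (free_lie K V) (free_grading K V) (free_bracket K V) leib \<and>
    (\<forall>x\<in>carrier V. \<forall>y\<in>carrier V.
       leib (lie_class K V (Gen x)) (lie_class K V (Gen y)) = lie_class K V (Gen (br x y)))"

definition free_leibniz_bracket ::
  "('k, 'c) ring_scheme \<Rightarrow> ('k, 'v, 'a) module_scheme \<Rightarrow> ('v \<Rightarrow> 'v \<Rightarrow> 'v) \<Rightarrow>
   ('k, 'v) lie_term set \<Rightarrow> ('k, 'v) lie_term set \<Rightarrow> ('k, 'v) lie_term set"
  where "free_leibniz_bracket K V br = (THE leib. is_free_leibniz_bracket K V br leib)"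


section \<open>The dg Lie algebra \<open>DR\<close>\<close>

text \<open>The extension of \<open>y \<mapsto> [x, y]\<close> from generators to terms as a derivation.\<close>

primrec term_act :: "('v \<Rightarrow> 'v \<Rightarrow> 'v) \<Rightarrow> 'v \<Rightarrow> ('k, 'v) lie_term \<Rightarrow> ('k, 'v) lie_term"
  where
    "term_act br x (Gen y) = Gen (br x y)"
  | "term_act br x TZero = TZero"
  | "term_act br x (TAdd s t) = TAdd (term_act br x s) (term_act br x t)"
  | "term_act br x (TSmult a t) = TSmult a (term_act br x t)"
  | "term_act br x (TBr s t) = TAdd (TBr (term_act br x s) t) (TBr s (term_act br x t))"

definition free_act ::
  "('k, 'c) ring_scheme \<Rightarrow> ('k, 'v, 'a) module_scheme \<Rightarrow> ('v \<Rightarrow> 'v \<Rightarrow> 'v) \<Rightarrow>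
   'v set \<Rightarrow> ('k, 'v) lie_term set \<Rightarrow> ('k, 'v) lie_term set"
  where "free_act K V br X A = (\<Union>x\<in>X. \<Union>t\<in>A. lie_class K V (term_act br x t))"

definition DR ::
  "('k, 'c) ring_scheme \<Rightarrow> ('k, 'v, 'a) module_scheme \<Rightarrow> ('v \<Rightarrow> 'v \<Rightarrow> 'v) \<Rightarrow>
   ('k, 'v set \<times> ('k, 'v) lie_term set) module"
  where "DR K V br =
    \<lparr>carrier = carrier (quot_lie K V br) \<times> carrier (free_lie K V),
     mult = undefined, one = undefined,
     zero = (\<zero>\<^bsub>quot_lie K V br\<^esub>, \<zero>\<^bsub>free_lie K V\<^esub>),
     add = (\<lambda>(X, A) (Y, B). (X \<oplus>\<^bsub>quot_lie K V br\<^esub> Y, A \<oplus>\<^bsub>free_lie K V\<^esub> B)),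
     smult = (\<lambda>a (X, A). (a \<odot>\<^bsub>quot_lie K V br\<^esub> X, a \<odot>\<^bsub>free_lie K V\<^esub> A))\<rparr>"

definition DR_grading ::
  "('k, 'c) ring_scheme \<Rightarrow> ('k, 'v, 'a) module_scheme \<Rightarrow> ('v \<Rightarrow> 'v \<Rightarrow> 'v) \<Rightarrow>
   int \<Rightarrow> ('v set \<times> ('k, 'v) lie_term set) set"
  where "DR_grading K V br n =
    (if n = 0 then carrier (quot_lie K V br) else {\<zero>\<^bsub>quot_lie K V br\<^esub>}) \<times> free_grading K V n"

definition DR_bracket ::
  "('k, 'c) ring_scheme \<Rightarrow> ('k, 'v, 'a) module_scheme \<Rightarrow> ('v \<Rightarrow> 'v \<Rightarrow> 'v) \<Rightarrow>
   'v set \<times> ('k, 'v) lie_term set \<Rightarrow> 'v set \<times> ('k, 'v) lie_term set \<Rightarrow>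
   'v set \<times> ('k, 'v) lie_term set"
  where "DR_bracket K V br = (\<lambda>(X, A) (Y, B).
    (quot_bracket K V br X Y,
     (free_act K V br X B \<ominus>\<^bsub>free_lie K V\<^esub> free_act K V br Y A)
       \<oplus>\<^bsub>free_lie K V\<^esub> free_bracket K V A B))"

definition emb_free ::
  "('k, 'c) ring_scheme \<Rightarrow> ('k, 'v, 'a) module_scheme \<Rightarrow> ('v \<Rightarrow> 'v \<Rightarrow> 'v) \<Rightarrow>
   ('k, 'v) lie_term set \<Rightarrow> 'v set \<times> ('k, 'v) lie_term set"
  where "emb_free K V br A = (\<zero>\<^bsub>quot_lie K V br\<^esub>, A)"

definition DR_incl ::
  "('k, 'c) ring_scheme \<Rightarrow> ('k, 'v, 'a) module_scheme \<Rightarrow> ('v \<Rightarrow> 'v \<Rightarrow> 'v) \<Rightarrow>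
   'v \<Rightarrow> 'v set \<times> ('k, 'v) lie_term set"
  where "DR_incl K V br = (\<lambda>x\<in>carrier V. emb_free K V br (lie_class K V (Gen x)))"

text \<open>
  The value of the differential on \<open>{x\<^sub>1, \<dots>, x\<^sub>n\<^sub>+\<^sub>1}\<close>, where \<open>xs\<close> lists
  these \<open>n + 1\<close> elements. List positions start from \<open>0\<close>, so the signs
  \<open>(-1)\<^sup>i\<^sup>-\<^sup>1\<close> become \<open>(-1)\<^sup>i\<close>.
\<close>

definition bracket_into :: "('v \<Rightarrow> 'v \<Rightarrow> 'v) \<Rightarrow> 'v list \<Rightarrow> nat \<Rightarrow> nat \<Rightarrow> 'v list"
  where "bracket_into br xs i j =
    (let ys = xs[j := br (xs ! i) (xs ! j)] in take i ys @ drop (Suc i) ys)"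

definition diff_right_normed ::
  "('k, 'c) ring_scheme \<Rightarrow> ('k, 'v, 'a) module_scheme \<Rightarrow> ('v \<Rightarrow> 'v \<Rightarrow> 'v) \<Rightarrow>
   'v list \<Rightarrow> ('k, 'v) lie_term set"
  where "diff_right_normed K V br xs =
    (let n = length xs - 1 in
      finsum (free_lie K V)
        (\<lambda>(i, j). sgnv (free_lie K V) (int i) (right_normed K V (bracket_into br xs i j)))
        {(i, j). i < j \<and> j \<le> n}
      \<oplus>\<^bsub>free_lie K V\<^esub>
      sgnv (free_lie K V) (int (n - 1))
        (right_normed K V (take (n - 1) xs @ [br (xs ! n) (xs ! (n - 1))])))"

definition is_DR_differential ::
  "('k, 'c) ring_scheme \<Rightarrow> ('k, 'v, 'a) module_scheme \<Rightarrow> ('v \<Rightarrow> 'v \<Rightarrow> 'v) \<Rightarrow>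
   ('v set \<times> ('k, 'v) lie_term set \<Rightarrow> 'v set \<times> ('k, 'v) lie_term set) \<Rightarrow> bool"
  where "is_DR_differential K V br d \<longleftrightarrow>
    d \<in> extensional (carrier (DR K V br)) \<and>
    linear_map K (DR K V br) (DR K V br) d \<and>
    (\<forall>X\<in>carrier (quot_lie K V br). d (X, \<zero>\<^bsub>free_lie K V\<^esub>) = \<zero>\<^bsub>DR K V br\<^esub>) \<and>
    (\<forall>x\<in>carrier V.
       d (emb_free K V br (lie_class K V (Gen x))) = (quot_class K V br x, \<zero>\<^bsub>free_lie K V\<^esub>)) \<and>
    (\<forall>xs. set xs \<subseteq> carrier V \<and> 2 \<le> length xs \<longrightarrow>
       d (emb_free K V br (right_normed K V xs)) = emb_free K V br (diff_right_normed K V br xs))"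

definition DR_diff ::
  "('k, 'c) ring_scheme \<Rightarrow> ('k, 'v, 'a) module_scheme \<Rightarrow> ('v \<Rightarrow> 'v \<Rightarrow> 'v) \<Rightarrow>
   'v set \<times> ('k, 'v) lie_term set \<Rightarrow> 'v set \<times> ('k, 'v) lie_term set"
  where "DR_diff K V br = (THE d. is_DR_differential K V br d)"

end

theory Submission
  imports Defs
begin

text \<open>
  An operator on Lie terms that obeys a graded Leibniz rule along a Lie morphism respects the
  defining relations of the free Lie algebra, because the Koszul signs match those of
  antisymmetry and the Jacobi identity. This yields three operators on \<open>F\<close>, the free Lie
  algebra. The action of the quotient Lie algebra, of degree \<open>0\<close>, makes \<open>DR\<close> a graded Lie
  algebra. The derivation of degree \<open>1\<close> with values in \<open>DR\<close> that sends \<open>x\<close> to its class is the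
  differential; unfolding \<open>(x\<^sub>1, (x\<^sub>2, \<dots>))\<close> with the Leibniz rule gives its formula on right-normed
  brackets. The derivation that fixes the generators multiplies brackets of length \<open>n\<close> by \<open>n\<close>,
  so that in characteristic \<open>0\<close> the components of different lengths are independent.

  The derived bracket of any dg Lie algebra satisfies the Lie-Leibniz identities, and these
  determine it from its values on generators. A derived bracket representation \<open>f\<close> with values in
  \<open>H\<close> extends to \<open>DR\<close> by the Lie morphism on \<open>F\<close> that it induces and by sending the class of \<open>x\<close>
  to \<open>D (f x)\<close>: antisymmetry of the bracket of \<open>H\<close> in degree \<open>0\<close> makes \<open>D (f x)\<close> vanish on the Leibniz
  kernel. As the class of \<open>x\<close> is the differential of \<open>x\<close>, no other extension is possible.
\<close>

section \<open>Linear maps, signs and gradings\<close>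

text \<open>Terms identified by \<open>lie_rel\<close> need not be homogeneous, and length is only a
  relation: \<open>TZero\<close> has every length, other terms have none. A Koszul sign can
  therefore not be read off a term by recursion. The derivations obtain it by evaluating the left
  factor with generators multiplied by \<open>(-1)^p\<close>, which makes sense on all terms and
  gives the right sign on homogeneous ones.

  Right-normed brackets span \<open>F\<close> but are in general dependent, so the formula for the
  differential does not by itself define a map; the map comes from the derivation, and the formula
  serves to pin it down uniquely. As the differential of a generator lies outside \<open>F\<close>,
  the derivation takes its values in \<open>DR\<close>, whose Jacobi identity has to be available
  beforehand. Likewise the independence of the lengths is deduced from a derivation of
  \<open>F\<close>, so it cannot belong to the structure on which derivations are built. The derived
  bracket of \<open>DR\<close> is pulled back to \<open>F\<close> along the injective
  \<open>emb\<close>, so the existence of the odd Leibniz bracket is a by-product and not an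
  assumption.\<close>

lemma (in abelian_group) eq_if_diff_zero:
  assumes "x \<ominus> y = \<zero>" "x \<in> carrier G" "y \<in> carrier G"
  shows "x = y"
proof -
  have "x = x \<ominus> y \<oplus> y" using assms(2,3) by (simp add: a_minus_def a_assoc l_neg)
  with assms show ?thesis by simp
qed

lemma sgnv_0: "sgnv V 0 x = x"
  by (simp add: sgnv_def)

context module
begin

lemma sgnv_closed [simp, intro]: "x \<in> carrier M \<Longrightarrow> sgnv M n x \<in> carrier M"
  by (simp add: sgnv_def)

lemma sgnv_zero [simp]: "sgnv M n \<zero>\<^bsub>M\<^esub> = \<zero>\<^bsub>M\<^esub>"
  by (simp add: sgnv_def)

lemma sgnv_add:
  "x \<in> carrier M \<Longrightarrow> y \<in> carrier M \<Longrightarrow> sgnv M n (x \<oplus>\<^bsub>M\<^esub> y) = sgnv M n x \<oplus>\<^bsub>M\<^esub> sgnv M n y"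
  by (simp add: sgnv_def M.minus_add)

lemma sgnv_minus: "x \<in> carrier M \<Longrightarrow> sgnv M n (\<ominus>\<^bsub>M\<^esub> x) = \<ominus>\<^bsub>M\<^esub> sgnv M n x"
  by (simp add: sgnv_def)

lemma sgnv_sgnv: "x \<in> carrier M \<Longrightarrow> sgnv M m (sgnv M n x) = sgnv M (m + n) x"
  by (simp add: sgnv_def)

lemma minus_sgnv: "x \<in> carrier M \<Longrightarrow> \<ominus>\<^bsub>M\<^esub> sgnv M n x = sgnv M (n + 1) x"
  by (simp add: sgnv_def)

lemma sgnv_smult:
  "a \<in> carrier R \<Longrightarrow> x \<in> carrier M \<Longrightarrow> sgnv M n (a \<odot>\<^bsub>M\<^esub> x) = a \<odot>\<^bsub>M\<^esub> sgnv M n x"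
  by (simp add: sgnv_def smult_r_minus)

lemma sgnv_cong_parity: "even (m - n) \<Longrightarrow> sgnv M m x = sgnv M n x"
  by (auto simp: sgnv_def)

text \<open>\<open>sgnt\<close> multiplies a term by a power of \<open>-1\<close> in the field,
  \<open>sgnv\<close> negates a vector; this translates between the two.\<close>

lemma power_minus_one_smult:
  assumes "x \<in> carrier M"
  shows "(\<ominus> \<one>) [^] n \<odot>\<^bsub>M\<^esub> x = sgnv M (int n) x"
proof (induction n)
  case 0
  with assms show ?case by (simp add: sgnv_def)
next
  case (Suc n)
  have "(\<ominus> \<one>) [^] Suc n \<odot>\<^bsub>M\<^esub> x = (\<ominus> \<one>) [^] n \<odot>\<^bsub>M\<^esub> (\<ominus>\<^bsub>M\<^esub> x)"
    using assms by (simp add: smult_assoc1 smult_l_minus)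
  also have "\<dots> = \<ominus>\<^bsub>M\<^esub> sgnv M (int n) x"
    using assms Suc by (simp add: smult_r_minus)
  also have "\<dots> = sgnv M (int (Suc n)) x"
    using assms by (simp add: minus_sgnv add.commute)
  finally show ?case .
qed

lemma submodule_sgnv: "submodule N R M \<Longrightarrow> x \<in> N \<Longrightarrow> sgnv M n x \<in> N"
  using submoduleE(3) by (auto simp: sgnv_def)

lemma submodule_zero: "submodule N R M \<Longrightarrow> \<zero>\<^bsub>M\<^esub> \<in> N"
  by (metis submodule.axioms(1) subgroup.one_closed monoid.select_convs(2))

lemma submodule_zero_space: "submodule {\<zero>\<^bsub>M\<^esub>} R M"
  by (rule submoduleI) auto

end

lemma linear_mapI:
  assumes "\<And>x. x \<in> carrier V \<Longrightarrow> f x \<in> carrier W"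
    and "\<And>x y. x \<in> carrier V \<Longrightarrow> y \<in> carrier V \<Longrightarrow> f (x \<oplus>\<^bsub>V\<^esub> y) = f x \<oplus>\<^bsub>W\<^esub> f y"
    and "\<And>a x. a \<in> carrier K \<Longrightarrow> x \<in> carrier V \<Longrightarrow> f (a \<odot>\<^bsub>V\<^esub> x) = a \<odot>\<^bsub>W\<^esub> f x"
  shows "linear_map K V W f"
  using assms by (auto simp: linear_map_def)

lemma
  assumes "linear_map K V W f"
  shows linear_map_closed: "x \<in> carrier V \<Longrightarrow> f x \<in> carrier W"
    and linear_map_add: "x \<in> carrier V \<Longrightarrow> y \<in> carrier V \<Longrightarrow> f (x \<oplus>\<^bsub>V\<^esub> y) = f x \<oplus>\<^bsub>W\<^esub> f y"
    and linear_map_smult: "a \<in> carrier K \<Longrightarrow> x \<in> carrier V \<Longrightarrow> f (a \<odot>\<^bsub>V\<^esub> x) = a \<odot>\<^bsub>W\<^esub> f x"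
  using assms by (auto simp: linear_map_def)

lemma linear_map_compose:
  "linear_map K V W f \<Longrightarrow> linear_map K W U h \<Longrightarrow> linear_map K V U (\<lambda>x. h (f x))"
  by (simp add: linear_map_def Pi_def)

lemma linear_map_cong:
  assumes "linear_map K V W f" "module K V" "\<And>x. x \<in> carrier V \<Longrightarrow> h x = f x"
  shows "linear_map K V W h"
proof -
  interpret module K V by fact
  show ?thesis using assms by (auto simp: linear_map_def)
qed

locale two_modules = V: module K V + W: module K W
  for K (structure) and V (structure) and W (structure)
begin

lemma linear_zero: "linear_map K V W f \<Longrightarrow> f \<zero>\<^bsub>V\<^esub> = \<zero>\<^bsub>W\<^esub>"
  using linear_map_smult[of K V W f "\<zero>\<^bsub>K\<^esub>" "\<zero>\<^bsub>V\<^esub>"] linear_map_closed[of K V W f "\<zero>\<^bsub>V\<^esub>"] by simp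

lemma linear_minus:
  assumes "linear_map K V W f" "x \<in> carrier V"
  shows "f (\<ominus>\<^bsub>V\<^esub> x) = \<ominus>\<^bsub>W\<^esub> f x"
  using linear_map_smult[OF assms(1), of "\<ominus>\<^bsub>K\<^esub> \<one>\<^bsub>K\<^esub>" x] linear_map_closed[OF assms] assms(2)
  by (simp add: V.smult_l_minus W.smult_l_minus)

lemma linear_sgnv: "linear_map K V W f \<Longrightarrow> x \<in> carrier V \<Longrightarrow> f (sgnv V n x) = sgnv W n (f x)"
  by (simp add: sgnv_def linear_minus)

lemma linear_finsum:
  assumes "linear_map K V W f" "finite S" "c \<in> S \<rightarrow> carrier V"
  shows "f (finsum V c S) = finsum W (\<lambda>n. f (c n)) S"
  using assms(2,3)
proof induction
  case empty
  show ?case using linear_zero[OF assms(1)] by simp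
next
  case (insert n S)
  then have "(\<lambda>n. f (c n)) \<in> S \<rightarrow> carrier W" "f (c n) \<in> carrier W"
    using linear_map_closed[OF assms(1)] by auto
  with insert show ?case
    by (simp add: linear_map_add[OF assms(1)] Pi_def)
qed

lemma linear_map_sum:
  assumes "linear_map K V W f" "linear_map K V W h"
  shows "linear_map K V W (\<lambda>x. f x \<oplus>\<^bsub>W\<^esub> h x)"
  using linear_map_closed[OF assms(1)] linear_map_closed[OF assms(2)]
  by (auto intro!: linear_mapI simp: linear_map_add[OF assms(1)] linear_map_add[OF assms(2)]
      linear_map_smult[OF assms(1)] linear_map_smult[OF assms(2)] W.smult_r_distr W.a_ac)

lemma linear_map_sgnv:
  assumes "linear_map K V W f"
  shows "linear_map K V W (\<lambda>x. sgnv W n (f x))"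
  using linear_map_closed[OF assms]
  by (auto intro!: linear_mapI simp: linear_map_add[OF assms] linear_map_smult[OF assms]
      W.sgnv_add W.sgnv_smult)

end

section \<open>Direct sum decompositions and independence of eigenvectors\<close>

context char0_vector_space
begin

text \<open>The existence half of \<open>direct_sum\<close>. It is separated from uniqueness because
  for the free Lie algebra existence follows from a spanning set and uniqueness from an eigenvalue
  argument.\<close>

definition decomposes :: "(int \<Rightarrow> 'c set) \<Rightarrow> 'c \<Rightarrow> bool"
  where "decomposes gr v \<longleftrightarrow>
    (\<exists>c. (\<forall>n. c n \<in> gr n) \<and> finite {n. c n \<noteq> \<zero>\<^bsub>V\<^esub>} \<and> v = finsum V c {n. c n \<noteq> \<zero>\<^bsub>V\<^esub>})"

text \<open>Families with different supports are compared and added over a common finite index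
  set.\<close>

lemma finsum_support:
  assumes "finite S" "\<And>n. c n \<in> carrier V" "{n. c n \<noteq> \<zero>\<^bsub>V\<^esub>} \<subseteq> S"
  shows "finsum V c {n. c n \<noteq> \<zero>\<^bsub>V\<^esub>} = finsum V c S"
  using assms by (intro M.add.finprod_mono_neutral_cong_left) auto

lemma decomposes_homogeneous:
  assumes "\<And>n. submodule (gr n) K V" "x \<in> gr n"
  shows "decomposes gr x"
proof -
  define c where "c m = (if m = n then x else \<zero>\<^bsub>V\<^esub>)" for m
  have x: "x \<in> carrier V" using assms submoduleE(1) by blast
  have "finsum V c {m. c m \<noteq> \<zero>\<^bsub>V\<^esub>} = finsum V c {n}"
    using x by (intro finsum_support) (auto simp: c_def)
  then have "x = finsum V c {m. c m \<noteq> \<zero>\<^bsub>V\<^esub>}"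
    using x by (simp add: c_def)
  moreover have "finite {m. c m \<noteq> \<zero>\<^bsub>V\<^esub>}"
    by (rule finite_subset[of _ "{n}"]) (auto simp: c_def)
  moreover have "\<forall>m. c m \<in> gr m"
    using assms submodule_zero by (auto simp: c_def)
  ultimately show ?thesis unfolding decomposes_def by blast
qed

lemma decomposes_add:
  assumes sub: "\<And>n. submodule (gr n) K V" and "decomposes gr v" "decomposes gr w"
  shows "decomposes gr (v \<oplus>\<^bsub>V\<^esub> w)"
proof -
  let ?supp = "\<lambda>c. {n. c n \<noteq> \<zero>\<^bsub>V\<^esub>}"
  obtain b where b: "\<And>n. b n \<in> gr n" "finite (?supp b)" "v = finsum V b (?supp b)"
    using assms(2) unfolding decomposes_def by blast
  obtain c where c: "\<And>n. c n \<in> gr n" "finite (?supp c)" "w = finsum V c (?supp c)"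
    using assms(3) unfolding decomposes_def by blast
  have carr: "b n \<in> carrier V" "c n \<in> carrier V" for n
    using b(1) c(1) submoduleE(1)[OF sub] by blast+
  let ?S = "?supp b \<union> ?supp c"
  let ?e = "\<lambda>n. b n \<oplus>\<^bsub>V\<^esub> c n"
  have S: "?supp ?e \<subseteq> ?S" by auto
  have fin: "finite ?S" using b c by simp
  have "v = finsum V b ?S" "w = finsum V c ?S"
    using b c fin carr by (auto intro!: finsum_support)
  then have "v \<oplus>\<^bsub>V\<^esub> w = finsum V ?e ?S"
    using carr by (simp add: M.finsum_addf)
  also have "\<dots> = finsum V ?e (?supp ?e)"
    using finsum_support[OF fin _ S] carr by simp
  finally have "v \<oplus>\<^bsub>V\<^esub> w = finsum V ?e (?supp ?e)" .
  moreover have "finite (?supp ?e)" using S fin finite_subset by blast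
  moreover have "\<forall>n. ?e n \<in> gr n" using b(1) c(1) submoduleE(5)[OF sub] by blast
  ultimately show ?thesis unfolding decomposes_def by (intro exI[of _ ?e] conjI)
qed

text \<open>If two families decompose the same vector, their difference sums to zero, so uniqueness
  reduces to the independence of the components.\<close>

lemma graded_spaceI:
  assumes sub: "\<And>n. submodule (gr n) K V"
    and span: "\<And>v. v \<in> carrier V \<Longrightarrow> decomposes gr v"
    and indep: "\<And>c S n. finite S \<Longrightarrow> (\<And>n. c n \<in> gr n) \<Longrightarrow> finsum V c S = \<zero>\<^bsub>V\<^esub> \<Longrightarrow> n \<in> S
      \<Longrightarrow> c n = \<zero>\<^bsub>V\<^esub>"
  shows "graded_space K V gr"
proof (intro graded_space.intro graded_space_axioms.intro)
  show "char0_vector_space K V" ..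
next
  fix n show "submodule (gr n) K V" by (rule sub)
next
  fix v assume v: "v \<in> carrier V"
  let ?supp = "\<lambda>c. {n. c n \<noteq> \<zero>\<^bsub>V\<^esub>}"
  have "b = c" if b: "\<forall>n. b n \<in> gr n" "finite (?supp b)" "v = finsum V b (?supp b)"
    and c: "\<forall>n. c n \<in> gr n" "finite (?supp c)" "v = finsum V c (?supp c)" for b c
  proof
    fix n
    have carr: "b n \<in> carrier V" "c n \<in> carrier V" for n
      using b(1) c(1) submoduleE(1)[OF sub] by blast+
    \<comment> \<open>\<open>n\<close> is adjoined because \<open>indep\<close> speaks only of
      indices inside the set, while \<open>b\<close> and \<open>c\<close> have to agree at every
      index.\<close>
    let ?S = "insert n (?supp b \<union> ?supp c)"
    let ?e = "\<lambda>n. b n \<oplus>\<^bsub>V\<^esub> (\<ominus>\<^bsub>V\<^esub> c n)"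
    have fin: "finite ?S" using b c by simp
    have "v = finsum V b ?S" using b(3) finsum_support[OF fin, of b] carr(1) by blast
    moreover have "v = finsum V c ?S" using c(3) finsum_support[OF fin, of c] carr(2) by blast
    moreover have "finsum V ?e ?S \<oplus>\<^bsub>V\<^esub> finsum V c ?S = finsum V (\<lambda>n. ?e n \<oplus>\<^bsub>V\<^esub> c n) ?S"
      using carr by (subst M.finsum_addf) auto
    moreover have "(\<lambda>n. ?e n \<oplus>\<^bsub>V\<^esub> c n) = b"
      using carr by (simp add: M.a_assoc M.l_neg)
    ultimately have "finsum V ?e ?S \<oplus>\<^bsub>V\<^esub> v = v" by simp
    then have "finsum V ?e ?S = \<zero>\<^bsub>V\<^esub>"
      using v carr M.add.r_cancel_one[of v "finsum V ?e ?S"] by (auto simp: Pi_def)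
    moreover have "?e m \<in> gr m" for m using b(1) c(1) submoduleE(3,5)[OF sub] by simp
    ultimately have "?e n = \<zero>\<^bsub>V\<^esub>" using indep[OF fin, of ?e n] by blast
    then show "b n = c n" using carr by (metis M.add.inv_comm M.minus_equality M.minus_minus M.a_inv_closed)
  qed
  with span[OF v] show "\<exists>!c. (\<forall>n. c n \<in> gr n) \<and> finite (?supp c) \<and> v = finsum V c (?supp c)"
    unfolding decomposes_def by blast
qed

text \<open>Applying \<open>T - l m\<close> to the sum removes the term of index \<open>m\<close>
  and multiplies every other term by \<open>l k - l m\<close>, which is invertible because
  \<open>l\<close> is injective and \<open>K\<close> is a field. The induction hypothesis kills
  these terms, and the sum then kills the one that is left.\<close>

lemma eigenvectors_independent:
  assumes lin: "linear_map K V V T" and "finite S"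
    and "\<And>n. n \<in> S \<Longrightarrow> c n \<in> carrier V" "\<And>n. n \<in> S \<Longrightarrow> l n \<in> carrier K"
    and "\<And>n. n \<in> S \<Longrightarrow> T (c n) = l n \<odot>\<^bsub>V\<^esub> c n"
    and "inj_on l S" "finsum V c S = \<zero>\<^bsub>V\<^esub>" "n \<in> S"
  shows "c n = \<zero>\<^bsub>V\<^esub>"
  using assms(2-)
proof (induction S arbitrary: n c)
  case empty
  then show ?case by simp
next
  interpret two_modules K V V ..
  case (insert m S)
  have carr: "c k \<in> carrier V" "l k \<in> carrier K" if "k \<in> insert m S" for k
    using insert.prems that by auto
  have sum: "c m \<oplus>\<^bsub>V\<^esub> finsum V c S = \<zero>\<^bsub>V\<^esub>"
    using insert carr by (simp add: Pi_def)
  define b where "b k = (l k \<ominus>\<^bsub>K\<^esub> l m) \<odot>\<^bsub>V\<^esub> c k" for k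
  have b: "b k \<in> carrier V" if "k \<in> S" for k using that carr by (simp add: b_def)
  have bexp: "b k = T (c k) \<oplus>\<^bsub>V\<^esub> (\<ominus>\<^bsub>K\<^esub> l m) \<odot>\<^bsub>V\<^esub> c k" if "k \<in> S" for k
    using that carr insert.prems by (simp add: b_def a_minus_def smult_l_distr)
  have "finsum V b S = finsum V (\<lambda>k. T (c k) \<oplus>\<^bsub>V\<^esub> (\<ominus>\<^bsub>K\<^esub> l m) \<odot>\<^bsub>V\<^esub> c k) S"
    using bexp carr linear_map_closed[OF lin] by (intro M.finsum_cong') auto
  also have "\<dots> = finsum V (\<lambda>k. T (c k)) S \<oplus>\<^bsub>V\<^esub> finsum V (\<lambda>k. (\<ominus>\<^bsub>K\<^esub> l m) \<odot>\<^bsub>V\<^esub> c k) S"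
    using carr linear_map_closed[OF lin] by (intro M.finsum_addf) auto
  also have "\<dots> = T (finsum V c S) \<oplus>\<^bsub>V\<^esub> (\<ominus>\<^bsub>K\<^esub> l m) \<odot>\<^bsub>V\<^esub> finsum V c S"
    using carr insert.hyps by (simp add: linear_finsum[OF lin] Pi_def finsum_smult_ldistr)
  also have "finsum V c S = \<ominus>\<^bsub>V\<^esub> c m"
  proof -
    have "finsum V c S \<in> carrier V" using carr by (intro M.finsum_closed) auto
    with sum carr show ?thesis by (metis M.a_comm M.minus_equality insertI1)
  qed
  also have "T (\<ominus>\<^bsub>V\<^esub> c m) \<oplus>\<^bsub>V\<^esub> (\<ominus>\<^bsub>K\<^esub> l m) \<odot>\<^bsub>V\<^esub> (\<ominus>\<^bsub>V\<^esub> c m) = \<zero>\<^bsub>V\<^esub>"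
    using carr insert.prems
    by (simp add: linear_minus[OF lin] smult_r_minus smult_l_minus M.l_neg)
  finally have zero: "finsum V b S = \<zero>\<^bsub>V\<^esub>" .
  have cS: "c k = \<zero>\<^bsub>V\<^esub>" if k: "k \<in> S" for k
  proof -
    have "T (b k) = l k \<odot>\<^bsub>V\<^esub> b k" if "k \<in> S" for k
      using that carr insert.prems
      by (simp add: b_def linear_map_smult[OF lin] flip: smult_assoc1) (simp add: m_comm)
    moreover have "inj_on l S" using insert.prems by (simp add: inj_on_def)
    ultimately have "b k = \<zero>\<^bsub>V\<^esub>"
      using insert.IH[of b k] b carr zero k by simp
    then have bk: "(l k \<ominus>\<^bsub>K\<^esub> l m) \<odot>\<^bsub>V\<^esub> c k = \<zero>\<^bsub>V\<^esub>" by (simp add: b_def)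
    have ne: "l k \<ominus>\<^bsub>K\<^esub> l m \<noteq> \<zero>\<^bsub>K\<^esub>"
    proof
      assume "l k \<ominus>\<^bsub>K\<^esub> l m = \<zero>\<^bsub>K\<^esub>"
      moreover have "abelian_group K" ..
      ultimately have "l k = l m"
        using k carr abelian_group.eq_if_diff_zero[of K "l k" "l m"] by simp
      with insert.prems insert.hyps k show False by (auto simp: inj_on_def)
    qed
    have unit: "l k \<ominus>\<^bsub>K\<^esub> l m \<in> Units K" using ne k carr by (simp add: field_Units)
    then have "inv (l k \<ominus>\<^bsub>K\<^esub> l m) \<odot>\<^bsub>V\<^esub> ((l k \<ominus>\<^bsub>K\<^esub> l m) \<odot>\<^bsub>V\<^esub> c k) = \<zero>\<^bsub>V\<^esub>"
      by (simp add: bk Units_inv_closed)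
    moreover have "inv (l k \<ominus>\<^bsub>K\<^esub> l m) \<odot>\<^bsub>V\<^esub> ((l k \<ominus>\<^bsub>K\<^esub> l m) \<odot>\<^bsub>V\<^esub> c k)
        = (inv (l k \<ominus>\<^bsub>K\<^esub> l m) \<otimes>\<^bsub>K\<^esub> (l k \<ominus>\<^bsub>K\<^esub> l m)) \<odot>\<^bsub>V\<^esub> c k"
      using unit k carr by (intro smult_assoc1[symmetric]) (auto intro: Units_closed Units_inv_closed)
    ultimately show ?thesis
      using unit k carr by (simp add: Units_l_inv)
  qed
  moreover have "c m = \<zero>\<^bsub>V\<^esub>"
  proof -
    have "finsum V c S = \<zero>\<^bsub>V\<^esub>" using cS by (simp add: M.add.finprod_one_eqI)
    with sum carr show ?thesis by simp
  qed
  ultimately show ?case using insert.prems by blast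
qed

end

lemma (in graded_space) graded_induct [consumes 1, case_names homogeneous add]:
  assumes "v \<in> carrier V"
    and hom: "\<And>n x. x \<in> gr n \<Longrightarrow> P x"
    and add: "\<And>x y. x \<in> carrier V \<Longrightarrow> y \<in> carrier V \<Longrightarrow> P x \<Longrightarrow> P y \<Longrightarrow> P (x \<oplus>\<^bsub>V\<^esub> y)"
  shows "P v"
proof -
  obtain c where c: "\<And>n. c n \<in> gr n" "finite {n. c n \<noteq> \<zero>\<^bsub>V\<^esub>}"
    and v: "v = finsum V c {n. c n \<noteq> \<zero>\<^bsub>V\<^esub>}"
    using direct_sum[OF assms(1)] by blast
  have carr: "c n \<in> carrier V" for n using c(1) submoduleE(1)[OF gr_submodule] by blast
  have "P (finsum V c S)" if "finite S" for S
    using that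
  proof induction
    case empty
    show ?case using hom[OF submodule_zero[OF gr_submodule]] by simp
  next
    case (insert n S)
    then have "P (c n \<oplus>\<^bsub>V\<^esub> finsum V c S)"
      using carr c(1) hom by (intro add M.finsum_closed) auto
    with insert.hyps carr show ?case by simp
  qed
  with c v show ?thesis by blast
qed

section \<open>Evaluation of Lie terms\<close>

text \<open>Working with terms requires the Jacobi identity for a third argument that need not be
  homogeneous, but no direct sum decomposition.\<close>

locale pregraded_lie_algebra = module K H
  for K (structure) and H (structure) +
  fixes gr :: "int \<Rightarrow> 'c set" and lie :: "'c \<Rightarrow> 'c \<Rightarrow> 'c"
  assumes homogeneous_submodule: "submodule (gr n) K H"
    and bilinear: "bilinear_op K H lie"
    and degree: "\<lbrakk>x \<in> gr i; y \<in> gr j\<rbrakk> \<Longrightarrow> lie x y \<in> gr (i + j)"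
    and antisymmetry: "\<lbrakk>x \<in> gr i; y \<in> gr j\<rbrakk> \<Longrightarrow> lie x y = sgnv H (i * j + 1) (lie y x)"
    and jacobi: "\<lbrakk>x \<in> gr i; y \<in> gr j; z \<in> carrier H\<rbrakk> \<Longrightarrow>
      lie x (lie y z) = lie (lie x y) z \<oplus>\<^bsub>H\<^esub> sgnv H (i * j) (lie y (lie x z))"

lemma bilinear_opI:
  assumes "\<And>x y. x \<in> carrier V \<Longrightarrow> y \<in> carrier V \<Longrightarrow> b x y \<in> carrier V"
    and "\<And>x y z. x \<in> carrier V \<Longrightarrow> y \<in> carrier V \<Longrightarrow> z \<in> carrier V \<Longrightarrow>
      b (x \<oplus>\<^bsub>V\<^esub> y) z = b x z \<oplus>\<^bsub>V\<^esub> b y z"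
    and "\<And>x y z. x \<in> carrier V \<Longrightarrow> y \<in> carrier V \<Longrightarrow> z \<in> carrier V \<Longrightarrow>
      b x (y \<oplus>\<^bsub>V\<^esub> z) = b x y \<oplus>\<^bsub>V\<^esub> b x z"
    and "\<And>a x y. a \<in> carrier K \<Longrightarrow> x \<in> carrier V \<Longrightarrow> y \<in> carrier V \<Longrightarrow>
      b (a \<odot>\<^bsub>V\<^esub> x) y = a \<odot>\<^bsub>V\<^esub> b x y"
    and "\<And>a x y. a \<in> carrier K \<Longrightarrow> x \<in> carrier V \<Longrightarrow> y \<in> carrier V \<Longrightarrow>
      b x (a \<odot>\<^bsub>V\<^esub> y) = a \<odot>\<^bsub>V\<^esub> b x y"
  shows "bilinear_op K V b"
  using assms by (auto simp: bilinear_op_def linear_map_def)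

lemma (in module)
  assumes "bilinear_op R M b" "x \<in> carrier M" "y \<in> carrier M"
  shows bilinear_closed: "b x y \<in> carrier M"
    and bilinear_add_left: "z \<in> carrier M \<Longrightarrow> b (x \<oplus>\<^bsub>M\<^esub> z) y = b x y \<oplus>\<^bsub>M\<^esub> b z y"
    and bilinear_add_right: "z \<in> carrier M \<Longrightarrow> b x (y \<oplus>\<^bsub>M\<^esub> z) = b x y \<oplus>\<^bsub>M\<^esub> b x z"
    and bilinear_smult_left: "a \<in> carrier R \<Longrightarrow> b (a \<odot>\<^bsub>M\<^esub> x) y = a \<odot>\<^bsub>M\<^esub> b x y"
    and bilinear_smult_right: "a \<in> carrier R \<Longrightarrow> b x (a \<odot>\<^bsub>M\<^esub> y) = a \<odot>\<^bsub>M\<^esub> b x y"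
    and bilinear_minus_left: "b (\<ominus>\<^bsub>M\<^esub> x) y = \<ominus>\<^bsub>M\<^esub> b x y"
    and bilinear_minus_right: "b x (\<ominus>\<^bsub>M\<^esub> y) = \<ominus>\<^bsub>M\<^esub> b x y"
    and bilinear_sgnv_left: "b (sgnv M n x) y = sgnv M n (b x y)"
    and bilinear_sgnv_right: "b x (sgnv M n y) = sgnv M n (b x y)"
proof -
  interpret two_modules R M M ..
  have l: "linear_map R M M (\<lambda>x. b x y)" and r: "linear_map R M M (\<lambda>y. b x y)"
    using assms by (auto simp: bilinear_op_def)
  show "b x y \<in> carrier M"
    "b (\<ominus>\<^bsub>M\<^esub> x) y = \<ominus>\<^bsub>M\<^esub> b x y" "b x (\<ominus>\<^bsub>M\<^esub> y) = \<ominus>\<^bsub>M\<^esub> b x y"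
    "b (sgnv M n x) y = sgnv M n (b x y)" "b x (sgnv M n y) = sgnv M n (b x y)"
    using linear_map_closed[OF l] linear_minus[OF l]
      linear_minus[OF r] linear_sgnv[OF l] linear_sgnv[OF r] assms by auto
  show "b (x \<oplus>\<^bsub>M\<^esub> z) y = b x y \<oplus>\<^bsub>M\<^esub> b z y" "b x (y \<oplus>\<^bsub>M\<^esub> z) = b x y \<oplus>\<^bsub>M\<^esub> b x z" if "z \<in> carrier M"
    using that assms linear_map_add[OF l] linear_map_add[OF r] by auto
  show "b (a \<odot>\<^bsub>M\<^esub> x) y = a \<odot>\<^bsub>M\<^esub> b x y" "b x (a \<odot>\<^bsub>M\<^esub> y) = a \<odot>\<^bsub>M\<^esub> b x y" if "a \<in> carrier R"
    using that assms linear_map_smult[OF l] linear_map_smult[OF r] by auto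
qed

lemma (in module)
  assumes "bilinear_op R M b" "x \<in> carrier M"
  shows bilinear_zero_left: "b \<zero>\<^bsub>M\<^esub> x = \<zero>\<^bsub>M\<^esub>"
    and bilinear_zero_right: "b x \<zero>\<^bsub>M\<^esub> = \<zero>\<^bsub>M\<^esub>"
proof -
  interpret two_modules R M M ..
  show "b \<zero>\<^bsub>M\<^esub> x = \<zero>\<^bsub>M\<^esub>" "b x \<zero>\<^bsub>M\<^esub> = \<zero>\<^bsub>M\<^esub>"
    using assms by (auto simp: bilinear_op_def dest!: bspec[OF _ assms(2)] linear_zero)
qed

text \<open>\<open>p\<close> and \<open>q\<close> stand for the degree of a derivation times the
  degrees of the first two arguments, \<open>r\<close> for the product of these two degrees. Each
  side is the derivative of one side of the Jacobi relation; on the left the Jacobi identity has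
  been applied to each of the three terms in which one argument is differentiated. Only parities
  matter, which leaves eight cases.\<close>

lemma (in module) sgnv_jacobi_expansion:
  assumes "a \<in> carrier M" "b \<in> carrier M" "c \<in> carrier M" "d \<in> carrier M" "e \<in> carrier M"
    "f \<in> carrier M"
  shows "(a \<oplus>\<^bsub>M\<^esub> sgnv M (r + q) b) \<oplus>\<^bsub>M\<^esub>
      sgnv M p ((c \<oplus>\<^bsub>M\<^esub> sgnv M (r + p) d) \<oplus>\<^bsub>M\<^esub> sgnv M q (e \<oplus>\<^bsub>M\<^esub> sgnv M r f)) =
    ((a \<oplus>\<^bsub>M\<^esub> sgnv M p c) \<oplus>\<^bsub>M\<^esub> sgnv M p (sgnv M q e)) \<oplus>\<^bsub>M\<^esub>
      sgnv M r (d \<oplus>\<^bsub>M\<^esub> sgnv M q (b \<oplus>\<^bsub>M\<^esub> sgnv M p f))"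
  using assms
  by (cases "even p"; cases "even q"; cases "even r") (simp_all add: sgnv_def M.minus_add M.a_ac)

primrec term_eval ::
  "('k, 'h, 'b) module_scheme \<Rightarrow> ('h \<Rightarrow> 'h \<Rightarrow> 'h) \<Rightarrow> ('v \<Rightarrow> 'h) \<Rightarrow> ('k, 'v) lie_term \<Rightarrow> 'h"
  where
    "term_eval H lie f (Gen x) = f x"
  | "term_eval H lie f TZero = \<zero>\<^bsub>H\<^esub>"
  | "term_eval H lie f (TAdd s t) = term_eval H lie f s \<oplus>\<^bsub>H\<^esub> term_eval H lie f t"
  | "term_eval H lie f (TSmult a t) = a \<odot>\<^bsub>H\<^esub> term_eval H lie f t"
  | "term_eval H lie f (TBr s t) = lie (term_eval H lie f s) (term_eval H lie f t)"

text \<open>For \<open>f' = (-1)\<^sup>p f\<close> this is the derivation of degree \<open>p\<close> along the Lie morphism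
  extending \<open>f\<close> whose values on generators are given by \<open>e\<close>: evaluating with \<open>f'\<close> instead of
  \<open>f\<close> produces the Koszul sign, also on terms that are not homogeneous.\<close>

primrec term_der ::
  "('k, 'h, 'b) module_scheme \<Rightarrow> ('h \<Rightarrow> 'h \<Rightarrow> 'h) \<Rightarrow> ('v \<Rightarrow> 'h) \<Rightarrow> ('v \<Rightarrow> 'h) \<Rightarrow> ('v \<Rightarrow> 'h) \<Rightarrow>
   ('k, 'v) lie_term \<Rightarrow> 'h"
  where
    "term_der H lie f f' e (Gen x) = e x"
  | "term_der H lie f f' e TZero = \<zero>\<^bsub>H\<^esub>"
  | "term_der H lie f f' e (TAdd s t) = term_der H lie f f' e s \<oplus>\<^bsub>H\<^esub> term_der H lie f f' e t"
  | "term_der H lie f f' e (TSmult a t) = a \<odot>\<^bsub>H\<^esub> term_der H lie f f' e t"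
  | "term_der H lie f f' e (TBr s t) =
      lie (term_der H lie f f' e s) (term_eval H lie f t) \<oplus>\<^bsub>H\<^esub>
      lie (term_eval H lie f' s) (term_der H lie f f' e t)"

lemma TBr_in_lie_terms [simp]: "TBr s t \<in> lie_terms K V \<longleftrightarrow> s \<in> lie_terms K V \<and> t \<in> lie_terms K V"
  by (auto elim: lie_terms.cases intro: lie_terms.intros)

lemma TAdd_in_lie_terms [simp]: "TAdd s t \<in> lie_terms K V \<longleftrightarrow> s \<in> lie_terms K V \<and> t \<in> lie_terms K V"
  by (auto elim: lie_terms.cases intro: lie_terms.intros)

lemma TSmult_in_lie_terms [simp]: "TSmult a t \<in> lie_terms K V \<longleftrightarrow> a \<in> carrier K \<and> t \<in> lie_terms K V"
  by (auto elim: lie_terms.cases intro: lie_terms.intros)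

lemma Gen_in_lie_terms [simp]: "Gen x \<in> lie_terms K V \<longleftrightarrow> x \<in> carrier V"
  by (auto elim: lie_terms.cases intro: lie_terms.intros)

lemma TZero_in_lie_terms [simp]: "TZero \<in> lie_terms K V"
  by (auto intro: lie_terms.intros)

lemma (in module) lie_rel_lie_terms:
  "(s, t) \<in> lie_rel R M \<Longrightarrow> s \<in> lie_terms R M \<and> t \<in> lie_terms R M"
  by (induction rule: lie_rel.induct) (auto simp: sgnt_def)

locale lie_evaluation = pregraded_lie_algebra K H gr lie + V: module K V
  for K (structure) and H (structure) and gr and lie and V (structure) +
  fixes f
  assumes f_linear: "linear_map K V H f" and f_degree: "x \<in> carrier V \<Longrightarrow> f x \<in> gr (-1)"
begin

lemma homogeneous_closed: "x \<in> gr n \<Longrightarrow> x \<in> carrier H"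
  using submoduleE(1)[OF homogeneous_submodule] by blast

lemmas lie_closed [simp] = bilinear_closed[OF bilinear]
lemmas lie_add_left = bilinear_add_left[OF bilinear]
lemmas lie_add_right = bilinear_add_right[OF bilinear]
lemmas lie_smult_left = bilinear_smult_left[OF bilinear]
lemmas lie_smult_right = bilinear_smult_right[OF bilinear]
lemmas lie_zero_left [simp] = bilinear_zero_left[OF bilinear]
lemmas lie_zero_right [simp] = bilinear_zero_right[OF bilinear]
lemmas lie_sgnv_left = bilinear_sgnv_left[OF bilinear]
lemmas lie_sgnv_right = bilinear_sgnv_right[OF bilinear]

lemma term_eval_closed [simp]:
  "t \<in> lie_terms K V \<Longrightarrow> term_eval H lie f t \<in> carrier H"
  by (induction t) (auto intro: linear_map_closed[OF f_linear])

lemma term_eval_sgnt: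
  "t \<in> lie_terms K V \<Longrightarrow> term_eval H lie f (sgnt K n t) = sgnv H (int n) (term_eval H lie f t)"
  by (simp only: sgnt_def term_eval.simps power_minus_one_smult term_eval_closed)

lemma term_eval_degree:
  "has_length n t \<Longrightarrow> t \<in> lie_terms K V \<Longrightarrow> term_eval H lie f t \<in> gr (- int n)"
proof (induction rule: has_length.induct)
  case (5 m s n t)
  then show ?case using degree[of _ "- int m" _ "- int n"] by simp
qed (use submoduleE[OF homogeneous_submodule] submodule_zero[OF homogeneous_submodule] f_degree in auto)

text \<open>The universal property of the free graded Lie algebra at the level of terms: every
  relation becomes an identity of \<open>H\<close>, and the lengths occurring in antisymmetry and
  Jacobi supply the degrees.\<close>

lemma term_eval_cong:
  "(s, t) \<in> lie_rel K V \<Longrightarrow> term_eval H lie f s = term_eval H lie f t"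
proof (induction rule: lie_rel.induct)
  case (antisym s t m n)
  then show ?case
    using antisymmetry[OF term_eval_degree term_eval_degree, of m s n t]
    by (simp add: term_eval_sgnt add.commute)
next
  case (jacobi s t u m n)
  then show ?case
    using pregraded_lie_algebra.jacobi[OF pregraded_lie_algebra_axioms
        term_eval_degree term_eval_degree, of m s n t "term_eval H lie f u"]
    by (simp add: term_eval_sgnt)
qed (use lie_rel_lie_terms linear_map_add[OF f_linear] linear_map_smult[OF f_linear] in
    \<open>auto simp: M.a_ac M.l_neg M.r_neg smult_l_distr smult_r_distr smult_assoc1 smult_l_minus
      lie_add_left lie_add_right lie_smult_left lie_smult_right\<close>)

end

section \<open>Derivations along an evaluation\<close>

locale lie_derivation = lie_evaluation K H gr lie V f
  for K (structure) and H (structure) and gr and lie and V (structure) and f +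
  fixes p :: int and f' and e
  assumes e_linear: "linear_map K V H e" and e_degree: "x \<in> carrier V \<Longrightarrow> e x \<in> gr (p - 1)"
    and f': "x \<in> carrier V \<Longrightarrow> f' x = sgnv H p (f x)"
begin

text \<open>The second summand of the Leibniz rule evaluates with \<open>f'\<close>. Multiplying
  generators by a sign preserves linearity and degree, so this evaluation respects the relations as
  well.\<close>

lemma twisted_evaluation: "lie_evaluation K H gr lie V f'"
proof
  interpret two_modules K V H ..
  show "linear_map K V H f'"
    using linear_map_cong[OF linear_map_sgnv[OF f_linear, of p] V.module_axioms f'] .
  show "f' x \<in> gr (-1)" if "x \<in> carrier V" for x
    using that f_degree f' submodule_sgnv[OF homogeneous_submodule] by simp
qed

interpretation twisted: lie_evaluation K H gr lie V f' by (rule twisted_evaluation)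

text \<open>Each of the \<open>n\<close> generators in a monomial contributes one factor
  \<open>(-1)^p\<close>. The product is the Koszul sign for moving an operator of degree
  \<open>p\<close> past an element of degree \<open>-n\<close>.\<close>

lemma term_eval_twisted:
  "has_length n t \<Longrightarrow> t \<in> lie_terms K V \<Longrightarrow>
   term_eval H lie f' t = sgnv H (p * int n) (term_eval H lie f t)"
proof (induction rule: has_length.induct)
  case (5 m s n t)
  then show ?case
    by (simp add: lie_sgnv_left lie_sgnv_right sgnv_sgnv distrib_left add.commute)
qed (auto simp: f' sgnv_add sgnv_smult)

abbreviation "ev \<equiv> term_eval H lie f"
abbreviation "ev' \<equiv> term_eval H lie f'"
abbreviation "der \<equiv> term_der H lie f f' e"

lemma term_der_closed [simp]: "t \<in> lie_terms K V \<Longrightarrow> der t \<in> carrier H"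
  by (induction t) (auto intro: linear_map_closed[OF e_linear])

lemma term_der_sgnt: "t \<in> lie_terms K V \<Longrightarrow> der (sgnt K n t) = sgnv H (int n) (der t)"
  by (simp only: sgnt_def term_der.simps power_minus_one_smult term_der_closed)

lemma term_der_degree:
  "has_length n t \<Longrightarrow> t \<in> lie_terms K V \<Longrightarrow> der t \<in> gr (p - int n)"
proof (induction rule: has_length.induct)
  case (5 m s n t)
  then have "lie (der s) (ev t) \<in> gr (p - int m + - int n)"
    "lie (ev' s) (der t) \<in> gr (- int m + (p - int n))"
    by (intro degree term_eval_degree twisted.term_eval_degree; simp)+
  then show ?case
    using submoduleE(5)[OF homogeneous_submodule] by (simp add: algebra_simps)
qed (use submoduleE[OF homogeneous_submodule] submodule_zero[OF homogeneous_submodule] e_degree in auto)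

text \<open>The relations of linear algebra are immediate. Antisymmetry exchanges the two summands
  of the Leibniz rule; for Jacobi the identity of \<open>H\<close> is applied three times, each time
  with a different argument differentiated.\<close>

lemma term_der_cong:
  "(s, t) \<in> lie_rel K V \<Longrightarrow> der s = der t"
proof (induction rule: lie_rel.induct)
  case (antisym s t m n)
  have "lie (der s) (ev t) = sgnv H ((p - int m) * (- int n) + 1) (lie (ev t) (der s))"
    using antisym by (intro antisymmetry term_der_degree term_eval_degree)
  moreover have "lie (ev s) (der t) = sgnv H ((- int m) * (p - int n) + 1) (lie (der t) (ev s))"
    using antisym by (intro antisymmetry term_der_degree term_eval_degree)
  \<comment> \<open>A differentiated factor has degree \<open>p - m\<close> instead of
    \<open>-m\<close>; the exponents that result agree with those of the relation modulo 2.\<close>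
  moreover have "sgnv H ((p - int m) * (- int n) + 1) x = sgnv H (int m * int n + 1 + p * int n) x"
    "sgnv H (p * int m + (1 - int m * (p - int n))) y = sgnv H (int m * int n + 1) y" for x y
    by (auto intro!: sgnv_cong_parity)
  ultimately show ?case using antisym
    by (simp add: term_der_sgnt term_eval_twisted sgnv_add sgnv_sgnv lie_sgnv_left M.a_comm
        add.commute[of 1 "int m * int n"])
next
  case (jacobi s t u m n)
  let ?P = "p * int m" let ?Q = "p * int n" let ?MN = "int m * int n"
  have parity: "sgnv H ((p - int m) * (- int n)) x = sgnv H (?MN + ?Q) x"
    "sgnv H ((- int m) * (p - int n)) x = sgnv H (?MN + ?P) x" for x
    by (rule sgnv_cong_parity, auto)+
  have 1: "lie (der s) (lie (ev t) (ev u)) = lie (lie (der s) (ev t)) (ev u)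
      \<oplus>\<^bsub>H\<^esub> sgnv H (?MN + ?Q) (lie (ev t) (lie (der s) (ev u)))"
    using jacobi pregraded_lie_algebra.jacobi[OF pregraded_lie_algebra_axioms
      term_der_degree term_eval_degree, of m s n t "ev u"]
    by (simp add: parity[simplified])
  have 2: "lie (ev s) (lie (der t) (ev u)) = lie (lie (ev s) (der t)) (ev u)
      \<oplus>\<^bsub>H\<^esub> sgnv H (?MN + ?P) (lie (der t) (lie (ev s) (ev u)))"
    using jacobi pregraded_lie_algebra.jacobi[OF pregraded_lie_algebra_axioms
      term_eval_degree term_der_degree, of m s n t "ev u"]
    by (simp add: parity[simplified])
  have 3: "lie (ev s) (lie (ev t) (der u)) = lie (lie (ev s) (ev t)) (der u)
      \<oplus>\<^bsub>H\<^esub> sgnv H ?MN (lie (ev t) (lie (ev s) (der u)))"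
    using jacobi pregraded_lie_algebra.jacobi[OF pregraded_lie_algebra_axioms
      term_eval_degree term_eval_degree, of m s n t "der u"] by simp
  let ?A = "lie (lie (der s) (ev t)) (ev u)" and ?B = "lie (ev t) (lie (der s) (ev u))"
    and ?C = "lie (lie (ev s) (der t)) (ev u)" and ?D = "lie (der t) (lie (ev s) (ev u))"
    and ?E = "lie (lie (ev s) (ev t)) (der u)" and ?F = "lie (ev t) (lie (ev s) (der u))"
  have "der (TBr s (TBr t u)) = (?A \<oplus>\<^bsub>H\<^esub> sgnv H (?MN + ?Q) ?B) \<oplus>\<^bsub>H\<^esub>
      sgnv H ?P ((?C \<oplus>\<^bsub>H\<^esub> sgnv H (?MN + ?P) ?D) \<oplus>\<^bsub>H\<^esub> sgnv H ?Q (?E \<oplus>\<^bsub>H\<^esub> sgnv H ?MN ?F))"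
    using jacobi
    by (simp add: term_eval_twisted lie_sgnv_left lie_sgnv_right lie_add_right sgnv_add sgnv_sgnv
        add.commute[of ?P] flip: 1 2 3)
  moreover have "der (TAdd (TBr (TBr s t) u) (sgnt K (m * n) (TBr t (TBr s u)))) =
      ((?A \<oplus>\<^bsub>H\<^esub> sgnv H ?P ?C) \<oplus>\<^bsub>H\<^esub> sgnv H ?P (sgnv H ?Q ?E)) \<oplus>\<^bsub>H\<^esub>
      sgnv H ?MN (?D \<oplus>\<^bsub>H\<^esub> sgnv H ?Q (?B \<oplus>\<^bsub>H\<^esub> sgnv H ?P ?F))"
    using jacobi
    by (simp add: term_der_sgnt term_eval_twisted lie_sgnv_left lie_sgnv_right
        lie_add_left lie_add_right sgnv_add sgnv_sgnv add.commute add.left_commute)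
  ultimately show ?case
    using jacobi by (simp add: sgnv_jacobi_expansion del: term_der.simps)
next
  \<comment> \<open>Replacing a factor affects its derivative and its evaluation, so the invariance
    of both evaluations is needed besides the induction hypothesis.\<close>
  case (cong_br s s' t t')
  then show ?case
    using term_eval_cong[of t t'] twisted.term_eval_cong[of s s'] by simp
next
  case (br_add_left s t u)
  then show ?case by (simp add: lie_add_left) (simp add: M.a_ac)
next
  case (br_add_right s t u)
  then show ?case by (simp add: lie_add_right) (simp add: M.a_ac)
next
  case (trans s t u)
  then show ?case by simp
qed (simp_all add: M.a_ac M.l_neg M.r_neg smult_l_distr smult_r_distr smult_assoc1 smult_l_minus
      lie_smult_left lie_smult_right linear_map_add[OF e_linear] linear_map_smult[OF e_linear])

end

text \<open>Both sides of the Jacobi identity are additive in the third argument, so the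
  decomposition into homogeneous parts frees that argument from its degree.\<close>

lemma (in graded_lie_algebra) pregraded_lie_algebra: "pregraded_lie_algebra K V gr lie"
proof (intro pregraded_lie_algebra.intro pregraded_lie_algebra_axioms.intro)
  show "module K V" ..
  show "submodule (gr n) K V" for n by (rule gr_submodule)
  show "bilinear_op K V lie" by (rule lie_bilinear)
  show "lie x y \<in> gr (i + j)" if "x \<in> gr i" "y \<in> gr j" for x y i j
    using that by (rule lie_degree)
  have carr: "x \<in> carrier V" if "x \<in> gr n" for x n
    using that submoduleE(1)[OF gr_submodule] by blast
  show "lie x y = sgnv V (i * j + 1) (lie y x)" if "x \<in> gr i" "y \<in> gr j" for x y i j
    using that lie_antisym[OF that] by (simp add: bilinear_closed[OF lie_bilinear] carr minus_sgnv)
  show "lie x (lie y z) = lie (lie x y) z \<oplus>\<^bsub>V\<^esub> sgnv V (i * j) (lie y (lie x z))"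
    if "x \<in> gr i" "y \<in> gr j" "z \<in> carrier V" for x y z i j
    using that(3)
  proof (induction rule: graded_induct)
    case (homogeneous k z)
    with that show ?case by (intro lie_jacobi)
  next
    case (add z w)
    note [simp] = bilinear_closed[OF lie_bilinear] carr[OF that(1)] carr[OF that(2)]
    from add show ?case
      by (simp add: bilinear_add_right[OF lie_bilinear] sgnv_add M.a_ac)
  qed
qed

section \<open>The free graded Lie algebra\<close>

text \<open>A representative is chosen, unlike in the operations on classes, which are unions,
  because the values lie in an arbitrary type. The choice is harmless once \<open>h\<close> respects
  the relation.\<close>

definition lift_class :: "('t \<Rightarrow> 'h) \<Rightarrow> 't set \<Rightarrow> 'h"
  where "lift_class h A = h (SOME t. t \<in> A)"

lemma (in abelian_group) add_pow_add:
  "x \<in> carrier G \<Longrightarrow> add_pow G (m + n :: nat) x = add_pow G m x \<oplus> add_pow G n x"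
  by (simp add: add.nat_pow_mult)

lemma (in abelian_group) add_pow_diff:
  assumes "x \<in> carrier G" "add_pow G m x = add_pow G (n::nat) x" "m < n"
  shows "add_pow G (n - m) x = \<zero>"
proof -
  have "add_pow G m x \<oplus> add_pow G (n - m) x = add_pow G m x"
    using assms add_pow_add[of x m "n - m"] by simp
  with assms show ?thesis by simp
qed

context char0_vector_space
begin

abbreviation "F \<equiv> free_lie K V"
abbreviation "terms \<equiv> lie_terms K V"
abbreviation "cls \<equiv> lie_class K V"
abbreviation "fbr \<equiv> free_bracket K V"
abbreviation "grF \<equiv> free_grading K V"
abbreviation "gen x \<equiv> cls (Gen x)"

lemma equiv_lie_rel: "equiv terms (lie_rel K V)"
  using lie_rel_lie_terms
  by (intro equivI refl_onI symI transI) (auto intro: lie_rel.refl lie_rel.sym lie_rel.trans)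

lemma lie_class_eq_iff: "s \<in> terms \<Longrightarrow> t \<in> terms \<Longrightarrow> cls s = cls t \<longleftrightarrow> (s, t) \<in> lie_rel K V"
  unfolding lie_class_def by (rule eq_equiv_class_iff[OF equiv_lie_rel])

lemma lie_class_eqI: "(s, t) \<in> lie_rel K V \<Longrightarrow> cls s = cls t"
  using lie_class_eq_iff lie_rel_lie_terms by blast

lemma lie_class_eqI': "(t, s) \<in> lie_rel K V \<Longrightarrow> cls s = cls t"
  by (rule lie_class_eqI[symmetric])

lemma lie_class_self: "t \<in> terms \<Longrightarrow> t \<in> cls t"
  by (simp add: lie_class_def lie_rel.refl)

lemma lie_class_memD: "s \<in> cls t \<Longrightarrow> (t, s) \<in> lie_rel K V"
  by (simp add: lie_class_def)

lemma carrier_free_lie: "carrier F = cls ` terms"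
  by (auto simp: free_lie_def quotient_def lie_class_def)

lemma lie_class_closed [simp, intro]: "t \<in> terms \<Longrightarrow> cls t \<in> carrier F"
  by (simp add: carrier_free_lie)

lemma UN_lie_class:
  assumes "t \<in> terms" "\<And>u. (t, u) \<in> lie_rel K V \<Longrightarrow> h u = h t"
  shows "(\<Union>u\<in>cls t. h u) = h t"
  using lie_class_self[OF assms(1)] assms(2) lie_class_memD by fast

lemma UN_lie_class2:
  assumes "s \<in> terms" "t \<in> terms"
    and "\<And>u v. (s, u) \<in> lie_rel K V \<Longrightarrow> (t, v) \<in> lie_rel K V \<Longrightarrow> h u v = h s t"
  shows "(\<Union>u\<in>cls s. \<Union>v\<in>cls t. h u v) = h s t"
  using lie_class_self[OF assms(1)] lie_class_self[OF assms(2)] assms(3) lie_class_memD by fast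

lemma add_lie_class: "s \<in> terms \<Longrightarrow> t \<in> terms \<Longrightarrow> cls s \<oplus>\<^bsub>F\<^esub> cls t = cls (TAdd s t)"
  unfolding free_lie_def
  by (simp, rule UN_lie_class2) (assumption | rule lie_class_eqI' lie_rel.cong_add lie_rel.refl)+

lemma smult_lie_class: "a \<in> carrier K \<Longrightarrow> t \<in> terms \<Longrightarrow> a \<odot>\<^bsub>F\<^esub> cls t = cls (TSmult a t)"
  unfolding free_lie_def
  by (simp, rule UN_lie_class) (assumption | rule lie_class_eqI' lie_rel.cong_smult lie_rel.refl)+

lemma free_bracket_lie_class: "s \<in> terms \<Longrightarrow> t \<in> terms \<Longrightarrow> fbr (cls s) (cls t) = cls (TBr s t)"
  unfolding free_bracket_def
  by (rule UN_lie_class2) (assumption | rule lie_class_eqI' lie_rel.cong_br lie_rel.refl)+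

lemma zero_free_lie: "\<zero>\<^bsub>F\<^esub> = cls TZero"
  by (simp add: free_lie_def)

lemma lift_class:
  assumes "t \<in> terms" "\<And>u v. (u, v) \<in> lie_rel K V \<Longrightarrow> h u = h v"
  shows "lift_class h (cls t) = h t"
proof -
  have "(SOME u. u \<in> cls t) \<in> cls t" by (rule someI[of "\<lambda>u. u \<in> cls t", OF lie_class_self[OF assms(1)]])
  then show ?thesis unfolding lift_class_def using lie_class_memD assms(2) by metis
qed

lemma module_free_lie: "module K F"
proof (rule moduleI)
  show "cring K" ..
  show "abelian_group F"
  proof (rule abelian_groupI)
    fix A assume "A \<in> carrier F"
    then obtain t where "t \<in> terms" "A = cls t" by (auto simp: carrier_free_lie)
    then show "\<exists>B\<in>carrier F. B \<oplus>\<^bsub>F\<^esub> A = \<zero>\<^bsub>F\<^esub>"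
      by (intro bexI[of _ "cls (TSmult (\<ominus>\<^bsub>K\<^esub> \<one>\<^bsub>K\<^esub>) t)"])
        (auto simp: add_lie_class zero_free_lie lie_class_eq_iff del: subset_antisym intro: lie_rel.add_neg)
  qed (auto simp: carrier_free_lie add_lie_class zero_free_lie lie_class_eq_iff
      del: subset_antisym intro: lie_rel.add_assoc lie_rel.add_comm lie_rel.add_zero)
qed (auto simp: carrier_free_lie add_lie_class smult_lie_class lie_class_eq_iff
      del: subset_antisym intro: lie_rel.smult_add_left lie_rel.smult_add_right lie_rel.smult_assoc lie_rel.smult_one)

lemma char0_free_lie: "char0_vector_space K F"
  using module_free_lie char0_vector_space_axioms
  by (simp add: char0_vector_space_def)

interpretation F: char0_vector_space K F by (rule char0_free_lie)

lemma bilinear_free_bracket: "bilinear_op K F fbr"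
  by (rule bilinear_opI)
    (auto simp: carrier_free_lie add_lie_class smult_lie_class free_bracket_lie_class lie_class_eq_iff
      del: subset_antisym intro: lie_rel.br_add_left lie_rel.br_add_right lie_rel.br_smult_left lie_rel.br_smult_right)

lemma linear_gen: "linear_map K V F (\<lambda>x. gen x)"
  by (rule linear_mapI) (auto simp: add_lie_class smult_lie_class lie_class_eq_iff
      del: subset_antisym intro: lie_rel.gen_add lie_rel.gen_smult)

lemma sgnt_lie_class: "t \<in> terms \<Longrightarrow> cls (sgnt K n t) = sgnv F (int n) (cls t)"
  by (simp only: sgnt_def F.power_minus_one_smult[symmetric] lie_class_closed)
    (simp add: smult_lie_class)

lemma submodule_free_part: "submodule (free_part K V n) K F"
proof (rule F.submoduleI)
  show "free_part K V n \<subseteq> carrier F" by (auto simp: free_part_def)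
  show zero: "\<zero>\<^bsub>F\<^esub> \<in> free_part K V n"
    by (auto simp: free_part_def zero_free_lie intro!: imageI has_length.intros)
  show smult: "a \<odot>\<^bsub>F\<^esub> A \<in> free_part K V n" if "a \<in> carrier K" "A \<in> free_part K V n" for a A
    using that by (auto simp: free_part_def smult_lie_class intro!: imageI has_length.intros)
  show "A \<oplus>\<^bsub>F\<^esub> B \<in> free_part K V n" if "A \<in> free_part K V n" "B \<in> free_part K V n" for A B
    using that by (auto simp: free_part_def add_lie_class intro!: imageI has_length.intros)
  show "\<ominus>\<^bsub>F\<^esub> A \<in> free_part K V n" if "A \<in> free_part K V n" for A
  proof -
    have "A \<in> carrier F" using that by (auto simp: free_part_def)
    then have "\<ominus>\<^bsub>F\<^esub> A = (\<ominus>\<^bsub>K\<^esub> \<one>\<^bsub>K\<^esub>) \<odot>\<^bsub>F\<^esub> A" by (simp add: F.smult_l_minus)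
    with smult that show ?thesis by simp
  qed
qed

lemma submodule_free_grading: "submodule (grF n) K F"
  using submodule_free_part F.submodule_zero_space by (simp add: free_grading_def)

lemma free_grading_cases:
  assumes "A \<in> grF i"
  obtains "A = \<zero>\<^bsub>F\<^esub>" | n t where "i = - int n" "A = cls t" "t \<in> terms" "has_length n t"
  using assms by (cases "i < 0") (auto simp: free_grading_def free_part_def intro: that(2)[of "nat (- i)"])

lemma lie_class_degree_pos:
  assumes "t \<in> terms" "has_length n t" "0 < n"
  shows "cls t \<in> grF (- int n)"
  using assms by (auto simp: free_grading_def free_part_def)

lemma gen_degree: "x \<in> carrier V \<Longrightarrow> gen x \<in> grF (-1)"
  using lie_class_degree_pos[of "Gen x" 1] has_length.intros(1)[of x] by simp

text \<open>Terms of length zero do exist, for example \<open>TZero\<close>.\<close>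

lemma free_part_0: "has_length n t \<Longrightarrow> n = 0 \<Longrightarrow> t \<in> terms \<Longrightarrow> cls t = \<zero>\<^bsub>F\<^esub>"
proof (induction rule: has_length.induct)
  case (2 n)
  then show ?case by (simp add: zero_free_lie)
next
  case (3 n s t)
  then show ?case by (simp flip: add_lie_class)
next
  case (4 n t a)
  then show ?case by (simp flip: smult_lie_class)
next
  case (5 m s n t)
  then show ?case using F.bilinear_zero_left[OF bilinear_free_bracket]
    by (simp flip: free_bracket_lie_class)
qed simp

lemma lie_class_degree:
  assumes "t \<in> terms" "has_length n t"
  shows "cls t \<in> grF (- int n)"
  using lie_class_degree_pos[OF assms] free_part_0[OF assms(2)] assms(1)
    F.submodule_zero[OF submodule_free_grading] by (cases "n = 0") auto

text \<open>The axioms are defining relations read through representatives with witnesses of their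
  length; the other alternative of \<open>free_grading_cases\<close> is the zero class, for which
  both sides vanish. The Jacobi relation puts no condition on the length of its third term, which
  matches the arbitrary third argument. The direct sum decomposition has to wait, because it rests
  on a derivation whose construction needs this structure.\<close>

lemma pregraded_free_lie: "pregraded_lie_algebra K F grF fbr"
proof (intro pregraded_lie_algebra.intro pregraded_lie_algebra_axioms.intro)
  show "module K F" by (rule module_free_lie)
  show "submodule (grF n) K F" for n by (rule submodule_free_grading)
  show "bilinear_op K F fbr" by (rule bilinear_free_bracket)
  note [simp] = F.bilinear_zero_left[OF bilinear_free_bracket]
    F.bilinear_zero_right[OF bilinear_free_bracket] F.bilinear_closed[OF bilinear_free_bracket]
    F.submodule_zero[OF submodule_free_grading]
  have carr: "A \<in> carrier F" if "A \<in> grF i" for A i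
    using that F.submoduleE(1)[OF submodule_free_grading] by blast
  show "fbr A B \<in> grF (i + j)" if "A \<in> grF i" "B \<in> grF j" for A B i j
    using that(1)
  proof (cases rule: free_grading_cases)
    case 1
    then show ?thesis using carr that(2) by simp
  next
    case (2 m s)
    from that(2) show ?thesis
    proof (cases rule: free_grading_cases)
      case (2 n t)
      with \<open>i = _\<close> \<open>A = _\<close> \<open>s \<in> _\<close> \<open>has_length m s\<close> show ?thesis
        using lie_class_degree[of "TBr s t" "m + n"]
        by (simp add: free_bracket_lie_class has_length.intros)
    qed (use carr that(1) in simp)
  qed
  show "fbr A B = sgnv F (i * j + 1) (fbr B A)" if "A \<in> grF i" "B \<in> grF j" for A B i j
    using that(1)
  proof (cases rule: free_grading_cases)
    case 1
    then show ?thesis using carr that(2) by simp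
  next
    case (2 m s)
    from that(2) show ?thesis
    proof (cases rule: free_grading_cases)
      case (2 n t)
      with \<open>i = _\<close> \<open>A = _\<close> \<open>s \<in> _\<close> \<open>has_length m s\<close> have "fbr A B = cls (sgnt K (m * n + 1) (TBr t s))"
        by (simp only: free_bracket_lie_class) (rule lie_class_eqI, rule lie_rel.antisym)
      then show ?thesis
        using 2 \<open>i = _\<close> \<open>A = _\<close> \<open>s \<in> _\<close>
        by (subst (asm) sgnt_lie_class) (simp_all add: free_bracket_lie_class add.commute)
    qed (use carr that(1) in simp)
  qed
  show "fbr A (fbr B C) = fbr (fbr A B) C \<oplus>\<^bsub>F\<^esub> sgnv F (i * j) (fbr B (fbr A C))"
    if "A \<in> grF i" "B \<in> grF j" and C: "C \<in> carrier F" for A B C i j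
    using that(1)
  proof (cases rule: free_grading_cases)
    case 1
    then show ?thesis using carr that by simp
  next
    case (2 m s)
    from that(2) show ?thesis
    proof (cases rule: free_grading_cases)
      case (2 n t)
      obtain u where "C = cls u" "u \<in> terms" using C by (auto simp: carrier_free_lie)
      with 2 \<open>i = _\<close> \<open>A = _\<close> \<open>s \<in> _\<close> \<open>has_length m s\<close>
      have "fbr A (fbr B C) = cls (TAdd (TBr (TBr s t) u) (sgnt K (m * n) (TBr t (TBr s u))))"
        by (simp add: free_bracket_lie_class) (rule lie_class_eqI, rule lie_rel.jacobi)
      moreover have "sgnt K (m * n) (TBr t (TBr s u)) \<in> terms"
        using 2 \<open>u \<in> _\<close> \<open>s \<in> _\<close> by (simp add: sgnt_def)
      ultimately show ?thesis
        using 2 \<open>i = _\<close> \<open>A = _\<close> \<open>s \<in> _\<close> \<open>C = _\<close> \<open>u \<in> _\<close>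
        by (simp add: free_bracket_lie_class sgnt_lie_class flip: add_lie_class)
    qed (use carr that in simp)
  qed
qed

interpretation PF: pregraded_lie_algebra K F grF fbr by (rule pregraded_free_lie)

lemma lie_evaluation_gen: "lie_evaluation K F grF fbr V (\<lambda>x. gen x)"
  by (intro lie_evaluation.intro lie_evaluation_axioms.intro pregraded_free_lie module_axioms
      linear_gen gen_degree)

interpretation G: lie_evaluation K F grF fbr V "\<lambda>x. gen x" by (rule lie_evaluation_gen)

lemma term_eval_gen: "t \<in> terms \<Longrightarrow> term_eval F fbr (\<lambda>x. gen x) t = cls t"
  by (induction t)
    (auto simp: zero_free_lie add_lie_class smult_lie_class free_bracket_lie_class)

subsection \<open>Right-normed brackets\<close>

text \<open>Sums suffice to generate a subspace here, since a scalar can be absorbed into the first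
  entry of a list.\<close>

inductive_set rn_span :: "('a, 'c) lie_term set set"
  where
    rn: "set xs \<subseteq> carrier V \<Longrightarrow> xs \<noteq> [] \<Longrightarrow> right_normed K V xs \<in> rn_span"
  | add: "A \<in> rn_span \<Longrightarrow> B \<in> rn_span \<Longrightarrow> A \<oplus>\<^bsub>F\<^esub> B \<in> rn_span"

lemma right_normed_Cons: "ys \<noteq> [] \<Longrightarrow> right_normed K V (x # ys) = fbr (gen x) (right_normed K V ys)"
  by (cases ys) auto

lemma right_normed_degree:
  "set xs \<subseteq> carrier V \<Longrightarrow> xs \<noteq> [] \<Longrightarrow> right_normed K V xs \<in> grF (- int (length xs))"
proof (induction xs rule: induct_list012)
  case (3 x y zs)
  then have "fbr (gen x) (right_normed K V (y # zs)) \<in> grF (-1 + - int (length (y # zs)))"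
    by (intro PF.degree gen_degree) auto
  moreover have "-1 + - int (length (y # zs)) = - int (length (x # y # zs))" by simp
  ultimately show ?case by (simp only: right_normed.simps)
qed (auto intro: gen_degree)

lemma right_normed_closed [simp, intro]: "set xs \<subseteq> carrier V \<Longrightarrow> right_normed K V xs \<in> carrier F"
  using right_normed_degree[of xs] G.homogeneous_closed by (cases "xs = []") auto

lemma rn_span_closed: "A \<in> rn_span \<Longrightarrow> A \<in> carrier F"
  by (induction rule: rn_span.induct) auto

lemma rn_span_smult:
  assumes "a \<in> carrier K"
  shows "A \<in> rn_span \<Longrightarrow> a \<odot>\<^bsub>F\<^esub> A \<in> rn_span"
proof (induction rule: rn_span.induct)
  case (rn xs)
  then obtain x ys where xs: "xs = x # ys" by (cases xs) auto
  then have x: "x \<in> carrier V" and ys: "set ys \<subseteq> carrier V" using rn by auto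
  have "a \<odot>\<^bsub>F\<^esub> right_normed K V xs = right_normed K V ((a \<odot>\<^bsub>V\<^esub> x) # ys)"
    using assms x ys xs linear_map_smult[OF linear_gen assms x]
    by (cases "ys = []") (simp_all add: right_normed_Cons G.lie_smult_left)
  then show ?case
    using rn_span.rn[of "(a \<odot>\<^bsub>V\<^esub> x) # ys"] assms x ys by simp
next
  case (add A B)
  then show ?case using assms rn_span_closed by (simp add: F.smult_r_distr rn_span.add)
qed

lemma rn_span_minus: "A \<in> rn_span \<Longrightarrow> \<ominus>\<^bsub>F\<^esub> A \<in> rn_span"
  using rn_span_smult[of "\<ominus>\<^bsub>K\<^esub> \<one>\<^bsub>K\<^esub>" A] rn_span_closed[of A] by (simp add: F.smult_l_minus)

lemma rn_span_gen_bracket: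
  assumes "x \<in> carrier V"
  shows "A \<in> rn_span \<Longrightarrow> fbr (gen x) A \<in> rn_span"
proof (induction rule: rn_span.induct)
  case (rn xs)
  then show ?case using rn_span.rn[of "x # xs"] assms by (simp add: right_normed_Cons)
next
  case (add A B)
  then show ?case using assms rn_span_closed by (simp add: G.lie_add_right rn_span.add)
qed

text \<open>By the Jacobi identity \<open>((x, R), B)\<close> is \<open>(x, (R, B))\<close> minus a
  signed \<open>(R, (x, B))\<close>, and \<open>R\<close> is shorter than \<open>(x, R)\<close>. The
  induction runs over the left factor for arbitrary \<open>B\<close>, as the second summand replaces
  \<open>B\<close> by \<open>(x, B)\<close>.\<close>

lemma rn_span_bracket:
  assumes B: "B \<in> rn_span"
  shows "A \<in> rn_span \<Longrightarrow> fbr A B \<in> rn_span"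
proof (induction rule: rn_span.induct)
  case (rn xs)
  then show ?case
    using B
  proof (induction xs arbitrary: B rule: induct_list012)
    case (2 x)
    then show ?case by (simp add: rn_span_gen_bracket)
  next
    case (3 x y zs)
    let ?R = "right_normed K V (y # zs)"
    let ?S = "sgnv F ((-1) * (- int (length (y # zs)))) (fbr ?R (fbr (gen x) B))"
    have x: "x \<in> carrier V" and yzs: "set (y # zs) \<subseteq> carrier V" using 3 by auto
    have R: "?R \<in> grF (- int (length (y # zs)))" using yzs by (intro right_normed_degree) auto
    have Rc: "?R \<in> carrier F" and Bc: "B \<in> carrier F" using yzs 3 rn_span_closed by auto
    have "fbr (gen x) (fbr ?R B) = fbr (fbr (gen x) ?R) B \<oplus>\<^bsub>F\<^esub> ?S"
      by (rule PF.jacobi[OF gen_degree[OF x] R Bc])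
    then have "fbr (fbr (gen x) ?R) B = fbr (gen x) (fbr ?R B) \<oplus>\<^bsub>F\<^esub> \<ominus>\<^bsub>F\<^esub> ?S"
      using x Rc Bc by (simp add: F.M.a_assoc F.M.r_neg del: right_normed.simps)
    moreover have "fbr (gen x) (fbr ?R B) \<in> rn_span"
      using 3 by (intro rn_span_gen_bracket) auto
    moreover have "fbr ?R (fbr (gen x) B) \<in> rn_span"
      using 3 by (intro "3.IH"(2)) (auto intro: rn_span_gen_bracket)
    then have "\<ominus>\<^bsub>F\<^esub> ?S \<in> rn_span" by (auto simp: sgnv_def intro: rn_span_minus)
    ultimately show ?case by (simp add: rn_span.add)
  qed simp
next
  case (add A A')
  then show ?case using B rn_span_closed by (simp add: G.lie_add_left rn_span.add)
qed

lemma rn_span_eq: "rn_span = carrier F"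
proof
  show "rn_span \<subseteq> carrier F" using rn_span_closed by blast
  have gen: "gen x \<in> rn_span" if "x \<in> carrier V" for x
    using that rn_span.rn[of "[x]"] by simp
  have "cls t \<in> rn_span" if "t \<in> terms" for t
    using that
  proof (induction rule: lie_terms.induct)
    case 2
    \<comment> \<open>The span has no clause for zero; it is reached as \<open>0\<close> times a
      generator.\<close>
    show ?case using rn_span_smult[OF _ gen[of "\<zero>\<^bsub>V\<^esub>"], of "\<zero>\<^bsub>K\<^esub>"] by (simp flip: zero_free_lie)
  qed (auto intro: gen rn_span.add rn_span_smult rn_span_bracket
      simp flip: add_lie_class smult_lie_class free_bracket_lie_class)
  then show "carrier F \<subseteq> rn_span" by (auto simp: carrier_free_lie)
qed

lemma free_lie_induct [consumes 1, case_names right_normed add]: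
  assumes "A \<in> carrier F"
    and "\<And>xs. set xs \<subseteq> carrier V \<Longrightarrow> xs \<noteq> [] \<Longrightarrow> P (right_normed K V xs)"
    and "\<And>A B. A \<in> carrier F \<Longrightarrow> B \<in> carrier F \<Longrightarrow> P A \<Longrightarrow> P B \<Longrightarrow> P (A \<oplus>\<^bsub>F\<^esub> B)"
  shows "P A"
  using assms(1)[folded rn_span_eq]
  by (induction rule: rn_span.induct) (auto intro: assms(2,3) rn_span_closed)

text \<open>A right-normed bracket is built by bracketing with generators on the left. The remaining
  factor may be taken homogeneous, which gives the sign rules a degree to refer to.\<close>

lemma free_lie_gen_induct [consumes 1, case_names gen bracket add]:
  assumes "A \<in> carrier F"
    and gen: "\<And>x. x \<in> carrier V \<Longrightarrow> P (gen x)"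
    and br: "\<And>n x A. x \<in> carrier V \<Longrightarrow> A \<in> grF n \<Longrightarrow> P A \<Longrightarrow> P (fbr (gen x) A)"
    and add: "\<And>A B. A \<in> carrier F \<Longrightarrow> B \<in> carrier F \<Longrightarrow> P A \<Longrightarrow> P B \<Longrightarrow> P (A \<oplus>\<^bsub>F\<^esub> B)"
  shows "P A"
  using assms(1)
proof (induction rule: free_lie_induct)
  case (right_normed xs)
  then show ?case
  proof (induction xs rule: induct_list012)
    case (3 x y zs)
    have "P (fbr (gen x) (right_normed K V (y # zs)))"
      using 3 by (intro br[OF _ right_normed_degree]) auto
    then show ?case by simp
  qed (auto intro: gen)
qed (rule add)

subsection \<open>The grading by bracket length\<close>

text \<open>The components of different length are independent because they are eigenspaces, with
  different eigenvalues in characteristic \<open>0\<close>, of the derivation that fixes the generators.\<close>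

interpretation E: lie_derivation K F grF fbr V "\<lambda>x. gen x" 0 "\<lambda>x. gen x" "\<lambda>x. gen x"
  by unfold_locales (auto simp: sgnv_def intro: linear_gen gen_degree)

definition euler :: "('a, 'c) lie_term set \<Rightarrow> ('a, 'c) lie_term set"
  where "euler = lift_class (term_der F fbr (\<lambda>x. gen x) (\<lambda>x. gen x) (\<lambda>x. gen x))"

lemma euler_lie_class:
  "t \<in> terms \<Longrightarrow> euler (cls t) = term_der F fbr (\<lambda>x. gen x) (\<lambda>x. gen x) (\<lambda>x. gen x) t"
  unfolding euler_def by (rule lift_class[OF _ E.term_der_cong])

lemma linear_euler: "linear_map K F F euler"
  by (rule linear_mapI) (auto simp: carrier_free_lie add_lie_class smult_lie_class euler_lie_class
      E.term_der_closed[unfolded carrier_free_lie])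

text \<open>The Leibniz rule adds the eigenvalues of the two factors of a bracket, and a generator
  has eigenvalue \<open>1\<close>: the derivation counts generators.\<close>

lemma euler_eigenvector:
  "has_length n t \<Longrightarrow> t \<in> terms \<Longrightarrow> euler (cls t) = add_pow K n \<one>\<^bsub>K\<^esub> \<odot>\<^bsub>F\<^esub> cls t"
proof (induction rule: has_length.induct)
  case (1 x)
  then show ?case by (simp add: euler_lie_class)
next
  case (2 n)
  have "euler (cls TZero) = \<zero>\<^bsub>F\<^esub>" by (simp add: euler_lie_class)
  then show ?case by (simp flip: zero_free_lie)
next
  case (3 n s t)
  then show ?case
    by (simp add: linear_map_add[OF linear_euler] F.smult_r_distr flip: add_lie_class)
next
  case (4 n t a)
  then show ?case
    by (simp add: linear_map_smult[OF linear_euler] m_comm flip: smult_lie_class F.smult_assoc1)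
next
  case (5 m s n t)
  then have "euler (cls (TBr s t)) = fbr (euler (cls s)) (cls t) \<oplus>\<^bsub>F\<^esub> fbr (cls s) (euler (cls t))"
    by (simp add: euler_lie_class term_eval_gen)
  moreover have "add_pow K (m + n) \<one>\<^bsub>K\<^esub> = add_pow K m \<one>\<^bsub>K\<^esub> \<oplus>\<^bsub>K\<^esub> add_pow K n \<one>\<^bsub>K\<^esub>"
    using abelian_group.add_pow_add[of K] by (simp add: is_abelian_group)
  ultimately show ?case using 5
    by (simp add: G.lie_smult_left G.lie_smult_right F.smult_l_distr
        flip: free_bracket_lie_class)
qed

text \<open>Characteristic \<open>0\<close> enters here: two different multiples that agree would
  make a positive multiple of \<open>1\<close> vanish.\<close>

lemma add_pow_one_inj:
  assumes "add_pow K m \<one>\<^bsub>K\<^esub> = add_pow K (n::nat) \<one>\<^bsub>K\<^esub>"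
  shows "m = n"
proof -
  have K: "abelian_group K" ..
  have "False" if "add_pow K m \<one>\<^bsub>K\<^esub> = add_pow K n \<one>\<^bsub>K\<^esub>" "m < n" for m n :: nat
    using abelian_group.add_pow_diff[OF K _ that] char0[of "n - m"] that by simp
  with assms show ?thesis by (metis linorder_neqE_nat)
qed

lemma decomposes_free_lie: "A \<in> carrier F \<Longrightarrow> F.decomposes grF A"
proof (induction rule: free_lie_induct)
  case (right_normed xs)
  then show ?case
    by (intro F.decomposes_homogeneous[where n = "- int (length xs)"] submodule_free_grading
        right_normed_degree)
qed (intro F.decomposes_add submodule_free_grading)

lemma free_lie_independent:
  assumes fin: "finite S" and c: "\<And>n. c n \<in> grF n" and sum: "finsum F c S = \<zero>\<^bsub>F\<^esub>" and n: "n \<in> S"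
  shows "c n = \<zero>\<^bsub>F\<^esub>"
proof -
  have carr: "c n \<in> carrier F" for n using c G.homogeneous_closed by blast
  have zero: "c n = \<zero>\<^bsub>F\<^esub>" if "\<not> n < 0" for n using that c[of n] by (simp add: free_grading_def)
  \<comment> \<open>For \<open>n\<close> not negative \<open>nat (- n)\<close> is always
    \<open>0\<close> and the eigenvalues would coincide, but there the components are zero by
    definition.\<close>
  let ?S = "{n \<in> S. n < 0}"
  have "finsum F c ?S = finsum F c S"
    using fin carr zero by (intro F.M.add.finprod_mono_neutral_cong_left) auto
  moreover have "euler (c n) = add_pow K (nat (- n)) \<one>\<^bsub>K\<^esub> \<odot>\<^bsub>F\<^esub> c n" if "n \<in> ?S" for n
    using that c[of n] euler_eigenvector by (auto simp: free_grading_def free_part_def)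
  moreover have "inj_on (\<lambda>n. add_pow K (nat (- n)) \<one>\<^bsub>K\<^esub>) ?S"
    by (auto intro!: inj_onI dest!: add_pow_one_inj)
  ultimately have "c n = \<zero>\<^bsub>F\<^esub>" if "n < 0"
    using F.eigenvectors_independent[OF linear_euler, of ?S c "\<lambda>n. add_pow K (nat (- n)) \<one>\<^bsub>K\<^esub>" n]
      fin carr sum n that by simp
  with zero show ?thesis by blast
qed

lemma graded_space_free_lie: "graded_space K F grF"
  by (rule F.graded_spaceI)
    (fact submodule_free_grading decomposes_free_lie free_lie_independent)+

lemma graded_lie_free_lie: "graded_lie_algebra K F grF fbr"
proof (intro graded_lie_algebra.intro graded_lie_algebra_axioms.intro graded_space_free_lie
    bilinear_free_bracket PF.degree)
  fix A B C :: "('a, 'c) lie_term set" and i j k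
  assume A: "A \<in> grF i" and B: "B \<in> grF j"
  then show "fbr A B = \<ominus>\<^bsub>F\<^esub> sgnv F (i * j) (fbr B A)"
    using PF.antisymmetry[OF A B] G.homogeneous_closed by (simp add: F.minus_sgnv)
  assume "C \<in> grF k"
  with A B show "fbr A (fbr B C) = fbr (fbr A B) C \<oplus>\<^bsub>F\<^esub> sgnv F (i * j) (fbr B (fbr A C))"
    using G.homogeneous_closed by (intro PF.jacobi)
qed

end

section \<open>The quotient Lie algebra and its action\<close>

context leibniz_algebra
begin

abbreviation "I \<equiv> leib_kernel K V br"
abbreviation "Q \<equiv> quot_lie K V br"
abbreviation "q \<equiv> quot_class K V br"
abbreviation "qbr \<equiv> quot_bracket K V br"
abbreviation "act \<equiv> free_act K V br"

lemmas br_closed [simp] = bilinear_closed[OF br_bilinear]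
lemmas br_add_left = bilinear_add_left[OF br_bilinear]
lemmas br_add_right = bilinear_add_right[OF br_bilinear]
lemmas br_smult_left = bilinear_smult_left[OF br_bilinear]
lemmas br_smult_right = bilinear_smult_right[OF br_bilinear]
lemmas br_minus_left = bilinear_minus_left[OF br_bilinear]
lemmas br_minus_right = bilinear_minus_right[OF br_bilinear]
lemmas br_zero_left [simp] = bilinear_zero_left[OF br_bilinear]
lemmas br_zero_right [simp] = bilinear_zero_right[OF br_bilinear]

section \<open>The Leibniz kernel\<close>

lemma symmetric_in_kernel: "x \<in> carrier V \<Longrightarrow> y \<in> carrier V \<Longrightarrow> br x y \<oplus>\<^bsub>V\<^esub> br y x \<in> I"
  unfolding leib_kernel_def by (rule hull_inc) blast

lemma kernel_minimal:
  assumes "submodule N K V"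
    and "\<And>x y. x \<in> carrier V \<Longrightarrow> y \<in> carrier V \<Longrightarrow> br x y \<oplus>\<^bsub>V\<^esub> br y x \<in> N"
  shows "I \<subseteq> N"
  unfolding leib_kernel_def using assms by (intro hull_minimal) auto

lemma submodule_kernel: "submodule I K V"
proof (rule submoduleI)
  show "I \<subseteq> carrier V" by (rule kernel_minimal[OF carrier_is_submodule]) simp
  show "\<zero>\<^bsub>V\<^esub> \<in> I" "\<And>a. a \<in> I \<Longrightarrow> \<ominus>\<^bsub>V\<^esub> a \<in> I" "\<And>a b. a \<in> I \<Longrightarrow> b \<in> I \<Longrightarrow> a \<oplus>\<^bsub>V\<^esub> b \<in> I"
    "\<And>a x. a \<in> carrier K \<Longrightarrow> x \<in> I \<Longrightarrow> a \<odot>\<^bsub>V\<^esub> x \<in> I"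
    unfolding leib_kernel_def hull_def using submodule_zero submoduleE(3,4,5) by auto
qed

lemmas kernel_zero = submodule_zero[OF submodule_kernel]
lemmas kernel_minus = submoduleE(3)[OF submodule_kernel]
lemmas kernel_smult = submoduleE(4)[OF submodule_kernel]
lemmas kernel_add = submoduleE(5)[OF submodule_kernel]

text \<open>The elements whose left multiplication is zero form a subspace. A symmetrised bracket
  belongs to it because the Leibniz identities for \<open>x, y\<close> and for \<open>y, x\<close>
  combine to \<open>[[x, y], z] + [[y, x], z] = 0\<close>.\<close>

lemma kernel_bracket:
  assumes "x \<in> I" "z \<in> carrier V"
  shows "br x z = \<zero>\<^bsub>V\<^esub>"
proof -
  let ?N = "{x \<in> carrier V. \<forall>z\<in>carrier V. br x z = \<zero>\<^bsub>V\<^esub>}"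
  have "I \<subseteq> ?N"
  proof (rule kernel_minimal)
    show "submodule ?N K V"
      by (rule submoduleI) (auto simp: br_add_left br_smult_left br_minus_left)
    fix x y assume xy: "x \<in> carrier V" "y \<in> carrier V"
    have "br (br x y \<oplus>\<^bsub>V\<^esub> br y x) z = \<zero>\<^bsub>V\<^esub>" if z: "z \<in> carrier V" for z
    proof -
      let ?a = "br (br x y) z" and ?b = "br (br y x) z" and ?c = "br x (br y z)"
      have "?c = ?a \<oplus>\<^bsub>V\<^esub> (?b \<oplus>\<^bsub>V\<^esub> ?c)"
        using leibniz[OF xy z] leibniz[OF xy(2,1) z] by simp
      then have "?c = (?a \<oplus>\<^bsub>V\<^esub> ?b) \<oplus>\<^bsub>V\<^esub> ?c" using xy z by (simp add: M.a_assoc)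
      then have "?a \<oplus>\<^bsub>V\<^esub> ?b = \<zero>\<^bsub>V\<^esub>"
        using xy z M.add.r_cancel_one'[of ?c "?a \<oplus>\<^bsub>V\<^esub> ?b"] by simp
      with xy z show ?thesis by (simp add: br_add_left)
    qed
    with xy show "br x y \<oplus>\<^bsub>V\<^esub> br y x \<in> ?N" by simp
  qed
  with assms show ?thesis by blast
qed

text \<open>Left multiplication by \<open>z\<close> is a derivation, hence it maps a symmetrised
  bracket to a sum of two symmetrised brackets.\<close>

lemma bracket_kernel:
  assumes "x \<in> I" "z \<in> carrier V"
  shows "br z x \<in> I"
proof -
  let ?N = "{x \<in> carrier V. \<forall>z\<in>carrier V. br z x \<in> I}"
  have "I \<subseteq> ?N"
  proof (rule kernel_minimal)
    show "submodule ?N K V"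
      by (rule submoduleI) (auto simp: br_add_right br_smult_right br_minus_right
          intro: kernel_zero kernel_add kernel_minus kernel_smult)
    fix x y assume xy: "x \<in> carrier V" "y \<in> carrier V"
    have "br z (br x y \<oplus>\<^bsub>V\<^esub> br y x) \<in> I" if z: "z \<in> carrier V" for z
    proof -
      have "br z (br x y \<oplus>\<^bsub>V\<^esub> br y x) =
          (br (br z x) y \<oplus>\<^bsub>V\<^esub> br y (br z x)) \<oplus>\<^bsub>V\<^esub> (br x (br z y) \<oplus>\<^bsub>V\<^esub> br (br z y) x)"
        using xy z leibniz[OF z xy] leibniz[OF z xy(2,1)] by (simp add: br_add_right M.a_ac)
      also have "\<dots> \<in> I" using xy z by (intro kernel_add symmetric_in_kernel) simp_all
      finally show ?thesis .
    qed
    with xy show "br x y \<oplus>\<^bsub>V\<^esub> br y x \<in> ?N" by simp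
  qed
  with assms show ?thesis by blast
qed

lemma abelian_subgroup_kernel: "abelian_subgroup I V"
  using submodule.axioms(1)[OF submodule_kernel]
  by (intro abelian_subgroupI3 additive_subgroupI M.abelian_group_axioms)

interpretation I: abelian_subgroup I V by (rule abelian_subgroup_kernel)

section \<open>The quotient by the Leibniz kernel\<close>

lemma mem_quot_class: "x \<in> carrier V \<Longrightarrow> y \<in> q x \<longleftrightarrow> y \<in> carrier V \<and> y \<oplus>\<^bsub>V\<^esub> \<ominus>\<^bsub>V\<^esub> x \<in> I"
  unfolding quot_class_def
  using I.a_rcos_module[of x y] I.a_elemrcos_carrier[of x y] by auto

lemma quot_class_self: "x \<in> carrier V \<Longrightarrow> x \<in> q x"
  by (simp add: mem_quot_class M.r_neg kernel_zero)

lemma quot_class_eq_iff: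
  assumes "x \<in> carrier V" "y \<in> carrier V"
  shows "q x = q y \<longleftrightarrow> x \<oplus>\<^bsub>V\<^esub> \<ominus>\<^bsub>V\<^esub> y \<in> I"
proof
  assume "q x = q y"
  with quot_class_self[OF assms(1)] show "x \<oplus>\<^bsub>V\<^esub> \<ominus>\<^bsub>V\<^esub> y \<in> I"
    using mem_quot_class[OF assms(2)] by simp
next
  assume "x \<oplus>\<^bsub>V\<^esub> \<ominus>\<^bsub>V\<^esub> y \<in> I"
  then have "x \<in> q y" using assms by (simp add: mem_quot_class)
  then show "q x = q y"
    using I.a_repr_independence'[of x y] assms unfolding quot_class_def by blast
qed

lemma UN_quot_class:
  assumes "x \<in> carrier V"
    and "\<And>y. y \<in> carrier V \<Longrightarrow> y \<oplus>\<^bsub>V\<^esub> \<ominus>\<^bsub>V\<^esub> x \<in> I \<Longrightarrow> h y = h x"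
  shows "(\<Union>y\<in>q x. h y) = h x"
  using assms(2) mem_quot_class[OF assms(1)]
  by (intro UN_constant_eq[OF quot_class_self[OF assms(1)]]) simp

lemma carrier_quot_lie: "carrier Q = q ` carrier V"
  by (simp add: quot_lie_def)

lemma quot_class_closed [simp, intro]: "x \<in> carrier V \<Longrightarrow> q x \<in> carrier Q"
  by (simp add: carrier_quot_lie)

lemma zero_quot_lie: "\<zero>\<^bsub>Q\<^esub> = q \<zero>\<^bsub>V\<^esub>"
  by (simp add: quot_lie_def)

lemma add_quot_class:
  assumes "x \<in> carrier V" "y \<in> carrier V"
  shows "q x \<oplus>\<^bsub>Q\<^esub> q y = q (x \<oplus>\<^bsub>V\<^esub> y)"
proof -
  have 1: "q (u \<oplus>\<^bsub>V\<^esub> v) = q (x' \<oplus>\<^bsub>V\<^esub> y')"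
    if "u \<oplus>\<^bsub>V\<^esub> \<ominus>\<^bsub>V\<^esub> x' \<in> I" "v \<oplus>\<^bsub>V\<^esub> \<ominus>\<^bsub>V\<^esub> y' \<in> I"
      "u \<in> carrier V" "v \<in> carrier V" "x' \<in> carrier V" "y' \<in> carrier V" for u v x' y'
    using that kernel_add[OF that(1,2)]
    by (simp add: quot_class_eq_iff M.minus_add M.a_ac)
  have "q x \<oplus>\<^bsub>Q\<^esub> q y = (\<Union>u\<in>q x. \<Union>v\<in>q y. q (u \<oplus>\<^bsub>V\<^esub> v))" by (simp add: quot_lie_def)
  also have "\<dots> = (\<Union>u\<in>q x. q (u \<oplus>\<^bsub>V\<^esub> y))"
    using assms
    by (intro SUP_cong refl UN_quot_class 1) (auto simp: mem_quot_class M.r_neg kernel_zero)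
  also have "\<dots> = q (x \<oplus>\<^bsub>V\<^esub> y)"
    using assms by (intro UN_quot_class 1) (auto simp: M.r_neg kernel_zero)
  finally show ?thesis .
qed

lemma smult_quot_class:
  assumes "a \<in> carrier K" "x \<in> carrier V"
  shows "a \<odot>\<^bsub>Q\<^esub> q x = q (a \<odot>\<^bsub>V\<^esub> x)"
proof -
  have "q (a \<odot>\<^bsub>V\<^esub> u) = q (a \<odot>\<^bsub>V\<^esub> x)" if "u \<in> carrier V" "u \<oplus>\<^bsub>V\<^esub> \<ominus>\<^bsub>V\<^esub> x \<in> I" for u
    using that assms kernel_smult[OF assms(1) that(2)]
    by (simp add: quot_class_eq_iff smult_r_distr smult_r_minus)
  with assms show ?thesis by (simp add: quot_lie_def UN_quot_class)
qed

text \<open>The representatives are changed one at a time. Changing the second moves the bracket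
  within \<open>I\<close>; changing the first does not move it at all, since
  \<open>[I, V] = 0\<close>.\<close>

lemma quot_bracket_class:
  assumes "x \<in> carrier V" "y \<in> carrier V"
  shows "qbr (q x) (q y) = q (br x y)"
proof -
  have 1: "q (br u v) = q (br u y')"
    if "v \<oplus>\<^bsub>V\<^esub> \<ominus>\<^bsub>V\<^esub> y' \<in> I" "u \<in> carrier V" "v \<in> carrier V" "y' \<in> carrier V" for u v y'
    using that bracket_kernel[OF that(1,2)]
    by (simp add: quot_class_eq_iff br_add_right br_minus_right)
  have 2: "q (br u y) = q (br x y)" if "u \<oplus>\<^bsub>V\<^esub> \<ominus>\<^bsub>V\<^esub> x \<in> I" "u \<in> carrier V" for u
    using that assms kernel_bracket[OF that(1) assms(2)]
    by (simp add: quot_class_eq_iff br_add_left br_minus_left kernel_zero)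
  have "qbr (q x) (q y) = (\<Union>u\<in>q x. \<Union>v\<in>q y. q (br u v))" by (simp add: quot_bracket_def)
  also have "\<dots> = (\<Union>u\<in>q x. q (br u y))"
    using assms by (intro SUP_cong refl UN_quot_class 1) (auto simp: mem_quot_class)
  also have "\<dots> = q (br x y)"
    using assms by (intro UN_quot_class 2)
  finally show ?thesis .
qed

lemma module_quot_lie: "module K Q"
proof (rule moduleI)
  show "cring K" ..
  show "abelian_group Q"
  proof (rule abelian_groupI)
    fix X assume "X \<in> carrier Q"
    then obtain x where "x \<in> carrier V" "X = q x" by (auto simp: carrier_quot_lie)
    then show "\<exists>Y\<in>carrier Q. Y \<oplus>\<^bsub>Q\<^esub> X = \<zero>\<^bsub>Q\<^esub>"
      by (intro bexI[of _ "q (\<ominus>\<^bsub>V\<^esub> x)"]) (simp_all add: add_quot_class zero_quot_lie M.l_neg)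
  qed (auto simp: carrier_quot_lie add_quot_class zero_quot_lie M.a_ac)
qed (auto simp: carrier_quot_lie add_quot_class smult_quot_class smult_l_distr smult_r_distr
      smult_assoc1)

interpretation Q: module K Q by (rule module_quot_lie)

lemma bilinear_quot_bracket: "bilinear_op K Q qbr"
  by (rule bilinear_opI) (auto simp: carrier_quot_lie quot_bracket_class add_quot_class
      smult_quot_class br_add_left br_add_right br_smult_left br_smult_right)

lemma quot_bracket_antisym:
  assumes "X \<in> carrier Q" "Y \<in> carrier Q"
  shows "qbr X Y = \<ominus>\<^bsub>Q\<^esub> qbr Y X"
proof -
  obtain x y where xy: "x \<in> carrier V" "X = q x" "y \<in> carrier V" "Y = q y"
    using assms by (auto simp: carrier_quot_lie)
  have "q (br x y \<oplus>\<^bsub>V\<^esub> br y x) = \<zero>\<^bsub>Q\<^esub>"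
    using xy symmetric_in_kernel[of x y] by (simp add: zero_quot_lie quot_class_eq_iff)
  with xy have "qbr X Y \<oplus>\<^bsub>Q\<^esub> qbr Y X = \<zero>\<^bsub>Q\<^esub>"
    by (simp add: quot_bracket_class add_quot_class)
  with xy show ?thesis by (simp add: quot_bracket_class Q.M.minus_equality)
qed

lemma quot_bracket_jacobi:
  "X \<in> carrier Q \<Longrightarrow> Y \<in> carrier Q \<Longrightarrow> Z \<in> carrier Q \<Longrightarrow>
   qbr X (qbr Y Z) = qbr (qbr X Y) Z \<oplus>\<^bsub>Q\<^esub> qbr Y (qbr X Z)"
  by (auto simp: carrier_quot_lie quot_bracket_class add_quot_class leibniz[symmetric])

interpretation F: char0_vector_space K F by (rule char0_free_lie)
interpretation PF: pregraded_lie_algebra K F grF fbr by (rule pregraded_free_lie)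
interpretation G: lie_evaluation K F grF fbr V "\<lambda>x. gen x" by (rule lie_evaluation_gen)

section \<open>The action on the free Lie algebra\<close>

lemma term_act_lie_terms: "t \<in> terms \<Longrightarrow> x \<in> carrier V \<Longrightarrow> term_act br x t \<in> terms"
  by (induction t) auto

lemma has_length_term_act: "has_length n t \<Longrightarrow> has_length n (term_act br x t)"
  by (induction rule: has_length.induct)
    (auto intro: has_length.intros has_length.intros(1)[simplified])

lemma linear_br_right: "x \<in> carrier V \<Longrightarrow> linear_map K V V (br x)"
  by (rule linear_mapI) (auto simp: br_add_right br_smult_right)

text \<open>In degree \<open>0\<close> the twist is trivial, so both evaluations send a term to its
  class.\<close>

lemma lie_derivation_act:
  assumes "x \<in> carrier V"
  shows "lie_derivation K F grF fbr V (\<lambda>x. gen x) 0 (\<lambda>x. gen x) (\<lambda>y. gen (br x y))"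
  using assms linear_map_compose[OF linear_br_right linear_gen]
  by unfold_locales (auto simp: sgnv_def intro: gen_degree)

text \<open>\<open>term_act\<close> produces terms, whereas \<open>term_der\<close> produces
  elements of \<open>F\<close>. They agree on classes, and \<open>term_act\<close> thereby inherits
  the compatibility with the relations.\<close>

lemma term_act_term_der:
  assumes "x \<in> carrier V"
  shows "t \<in> terms \<Longrightarrow> cls (term_act br x t)
    = term_der F fbr (\<lambda>x. gen x) (\<lambda>x. gen x) (\<lambda>y. gen (br x y)) t"
  by (induction t) (auto simp: zero_free_lie term_act_lie_terms assms term_eval_gen
      simp flip: add_lie_class smult_lie_class free_bracket_lie_class)

lemma term_act_cong:
  assumes "x \<in> carrier V" "(s, t) \<in> lie_rel K V"
  shows "cls (term_act br x s) = cls (term_act br x t)"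
  using lie_derivation.term_der_cong[OF lie_derivation_act[OF assms(1)] assms(2)]
    lie_rel_lie_terms[OF assms(2)] term_act_term_der[OF assms(1)] by simp

text \<open>Already the terms coincide, not only their classes: \<open>y - x\<close> in
  \<open>I\<close> forces \<open>[y, z] = [x, z]\<close> for each generator
  \<open>z\<close>.\<close>

lemma term_act_kernel:
  assumes "x \<in> carrier V" "y \<in> carrier V" "y \<oplus>\<^bsub>V\<^esub> \<ominus>\<^bsub>V\<^esub> x \<in> I"
  shows "t \<in> terms \<Longrightarrow> term_act br y t = term_act br x t"
proof (induction t)
  case (Gen z)
  then have z: "z \<in> carrier V" by simp
  have "br y z \<oplus>\<^bsub>V\<^esub> \<ominus>\<^bsub>V\<^esub> br x z = \<zero>\<^bsub>V\<^esub>"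
    using kernel_bracket[OF assms(3) z] assms z by (simp add: br_add_left br_minus_left)
  then show ?case using M.eq_if_diff_zero[of "br y z" "br x z"] assms z by (simp add: a_minus_def)
qed auto

lemma free_act_class:
  assumes "x \<in> carrier V" "t \<in> terms"
  shows "act (q x) (cls t) = cls (term_act br x t)"
proof -
  have "act (q x) (cls t) = (\<Union>y\<in>q x. \<Union>u\<in>cls t. cls (term_act br y u))"
    by (simp add: free_act_def)
  also have "\<dots> = (\<Union>y\<in>q x. cls (term_act br y t))"
    using assms by (intro SUP_cong refl UN_lie_class term_act_cong[symmetric])
      (auto simp: mem_quot_class intro: lie_rel.sym)
  also have "\<dots> = cls (term_act br x t)"
    using assms term_act_kernel by (intro UN_quot_class) auto
  finally show ?thesis .
qed

lemma free_act_closed [simp]: "X \<in> carrier Q \<Longrightarrow> A \<in> carrier F \<Longrightarrow> act X A \<in> carrier F"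
  by (auto simp: carrier_quot_lie carrier_free_lie free_act_class term_act_lie_terms)

lemma free_act_degree:
  assumes "X \<in> carrier Q" "A \<in> grF n"
  shows "act X A \<in> grF n"
  using assms(2)
proof (cases rule: free_grading_cases)
  case 1
  obtain x where "x \<in> carrier V" "X = q x" using assms by (auto simp: carrier_quot_lie)
  with 1 have "act X A = \<zero>\<^bsub>F\<^esub>" by (simp add: zero_free_lie free_act_class)
  then show ?thesis using F.submodule_zero[OF submodule_free_grading] by simp
next
  case (2 m t)
  obtain x where "x \<in> carrier V" "X = q x" using assms by (auto simp: carrier_quot_lie)
  with 2 show ?thesis
    by (auto simp: free_act_class intro!: lie_class_degree term_act_lie_terms has_length_term_act)
qed

lemma linear_free_act: "X \<in> carrier Q \<Longrightarrow> linear_map K F F (act X)"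
  by (rule linear_mapI) (auto simp: carrier_quot_lie carrier_free_lie free_act_class
      add_lie_class smult_lie_class term_act_lie_terms)

lemma free_act_gen: "x \<in> carrier V \<Longrightarrow> y \<in> carrier V \<Longrightarrow> act (q x) (gen y) = gen (br x y)"
  by (simp add: free_act_class)

lemma free_act_bracket:
  "X \<in> carrier Q \<Longrightarrow> A \<in> carrier F \<Longrightarrow> B \<in> carrier F \<Longrightarrow>
   act X (fbr A B) = fbr (act X A) B \<oplus>\<^bsub>F\<^esub> fbr A (act X B)"
  by (auto simp: carrier_quot_lie carrier_free_lie free_act_class free_bracket_lie_class
      add_lie_class term_act_lie_terms)

lemmas free_act_add = linear_map_add[OF linear_free_act]

text \<open>In \<open>A\<close> both sides are derivations of \<open>F\<close>, so generators
  decide, where the claim is additivity of the Leibniz bracket in its first argument.\<close>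

lemma free_act_add_left:
  assumes "X \<in> carrier Q" "Y \<in> carrier Q" "A \<in> carrier F"
  shows "act (X \<oplus>\<^bsub>Q\<^esub> Y) A = act X A \<oplus>\<^bsub>F\<^esub> act Y A"
proof -
  obtain x y where xy: "x \<in> carrier V" "X = q x" "y \<in> carrier V" "Y = q y"
    using assms by (auto simp: carrier_quot_lie)
  have Q: "X \<oplus>\<^bsub>Q\<^esub> Y \<in> carrier Q" using assms by simp
  from assms(3) show ?thesis
  proof (induction rule: free_lie_gen_induct)
    case (gen z)
    with xy show ?case
      by (simp add: add_quot_class free_act_gen br_add_left linear_map_add[OF linear_gen])
  next
    case (bracket n z A)
    then have "A \<in> carrier F" using G.homogeneous_closed by blast
    with bracket xy(1,3) assms(1,2) Q show ?case
      by (simp add: free_act_bracket G.lie_add_left G.lie_add_right F.M.a_ac xy(2,4)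
          add_quot_class free_act_gen br_add_left linear_map_add[OF linear_gen])
  next
    case (add A B)
    with assms(1,2) Q show ?case by (simp add: free_act_add F.M.a_ac)
  qed
qed

lemma free_act_smult_left:
  assumes "a \<in> carrier K" "X \<in> carrier Q" "A \<in> carrier F"
  shows "act (a \<odot>\<^bsub>Q\<^esub> X) A = a \<odot>\<^bsub>F\<^esub> act X A"
proof -
  obtain x where x: "x \<in> carrier V" "X = q x" using assms by (auto simp: carrier_quot_lie)
  have Q: "a \<odot>\<^bsub>Q\<^esub> X \<in> carrier Q" using assms by simp
  from assms(3) show ?thesis
  proof (induction rule: free_lie_gen_induct)
    case (gen z)
    with x assms(1) show ?case
      by (simp add: smult_quot_class free_act_gen br_smult_left linear_map_smult[OF linear_gen])
  next
    case (bracket n z A)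
    then have "A \<in> carrier F" using G.homogeneous_closed by blast
    with bracket x(1) assms(1,2) Q show ?case
      by (simp add: free_act_bracket G.lie_smult_left G.lie_smult_right F.smult_r_distr x(2)
          smult_quot_class free_act_gen br_smult_left linear_map_smult[OF linear_gen])
  next
    case (add A B)
    with assms(1,2) Q show ?case by (simp add: free_act_add F.smult_r_distr)
  qed
qed

text \<open>A commutator of derivations is a derivation, and on generators the claim is the Leibniz
  identity.\<close>

lemma free_act_commutator:
  assumes "X \<in> carrier Q" "Y \<in> carrier Q" "A \<in> carrier F"
  shows "act X (act Y A) = act (qbr X Y) A \<oplus>\<^bsub>F\<^esub> act Y (act X A)"
proof -
  obtain x y where xy: "x \<in> carrier V" "X = q x" "y \<in> carrier V" "Y = q y"
    using assms by (auto simp: carrier_quot_lie)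
  have Q: "qbr X Y \<in> carrier Q" using xy by (simp add: quot_bracket_class)
  from assms(3) show ?thesis
  proof (induction rule: free_lie_gen_induct)
    case (gen z)
    with xy show ?case
      by (simp add: quot_bracket_class free_act_gen leibniz[of x y z]
          linear_map_add[OF linear_gen])
  next
    case (bracket n z A)
    then have A: "A \<in> carrier F" and z: "gen z \<in> carrier F" using G.homogeneous_closed by auto
    have "act X (act Y (gen z)) = act (qbr X Y) (gen z) \<oplus>\<^bsub>F\<^esub> act Y (act X (gen z))"
      using bracket(1) xy by (simp add: quot_bracket_class free_act_gen leibniz[of x y z]
          linear_map_add[OF linear_gen])
    with A z bracket(3) assms(1,2) Q show ?case
      by (simp add: free_act_bracket free_act_add G.lie_add_left G.lie_add_right F.M.a_ac)
  next
    case (add A B)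
    with assms(1,2) Q show ?case by (simp add: free_act_add F.M.a_ac)
  qed
qed

section \<open>The graded Lie algebra \<open>DR\<close>\<close>

abbreviation "R \<equiv> DR K V br"
abbreviation "grR \<equiv> DR_grading K V br"
abbreviation "rbr \<equiv> DR_bracket K V br"
abbreviation "emb \<equiv> emb_free K V br"

lemma carrier_DR: "carrier R = carrier Q \<times> carrier F"
  and zero_DR: "\<zero>\<^bsub>R\<^esub> = (\<zero>\<^bsub>Q\<^esub>, \<zero>\<^bsub>F\<^esub>)"
  and add_DR: "(X, A) \<oplus>\<^bsub>R\<^esub> (Y, B) = (X \<oplus>\<^bsub>Q\<^esub> Y, A \<oplus>\<^bsub>F\<^esub> B)"
  and smult_DR: "a \<odot>\<^bsub>R\<^esub> (X, A) = (a \<odot>\<^bsub>Q\<^esub> X, a \<odot>\<^bsub>F\<^esub> A)"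
  by (simp_all add: DR_def)

lemma module_DR: "module K R"
proof (rule moduleI)
  show "cring K" ..
  show "abelian_group R"
  proof (rule abelian_groupI)
    fix Z assume "Z \<in> carrier R"
    then obtain X A where "Z = (X, A)" "X \<in> carrier Q" "A \<in> carrier F" by (auto simp: carrier_DR)
    then show "\<exists>W\<in>carrier R. W \<oplus>\<^bsub>R\<^esub> Z = \<zero>\<^bsub>R\<^esub>"
      by (intro bexI[of _ "(\<ominus>\<^bsub>Q\<^esub> X, \<ominus>\<^bsub>F\<^esub> A)"])
        (simp_all add: carrier_DR add_DR zero_DR Q.M.l_neg F.M.l_neg)
  qed (auto simp: carrier_DR add_DR zero_DR Q.M.a_ac F.M.a_ac)
qed (auto simp: carrier_DR add_DR smult_DR Q.smult_l_distr F.smult_l_distr Q.smult_r_distr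
      F.smult_r_distr Q.smult_assoc1 F.smult_assoc1)

lemma char0_DR: "char0_vector_space K R"
  using module_DR char0_vector_space_axioms by (simp add: char0_vector_space_def)

interpretation R: char0_vector_space K R by (rule char0_DR)

lemma minus_DR: "X \<in> carrier Q \<Longrightarrow> A \<in> carrier F \<Longrightarrow> \<ominus>\<^bsub>R\<^esub> (X, A) = (\<ominus>\<^bsub>Q\<^esub> X, \<ominus>\<^bsub>F\<^esub> A)"
  by (rule R.M.minus_equality) (simp_all add: carrier_DR add_DR zero_DR Q.M.l_neg F.M.l_neg)

lemma linear_fst: "linear_map K R Q fst" and linear_snd: "linear_map K R F snd"
  by (auto simp: linear_map_def carrier_DR add_DR smult_DR)

lemma linear_emb: "linear_map K F R emb"
  by (auto simp: linear_map_def emb_free_def carrier_DR add_DR smult_DR)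

lemma emb_inject: "emb A = emb B \<longleftrightarrow> A = B"
  by (simp add: emb_free_def)

text \<open>The free part has only negative degrees and the quotient only degree \<open>0\<close>,
  so no homogeneous element has nonzero components in both. Identities for homogeneous arguments
  thus split into pure cases.\<close>

lemma DR_grading_cases [consumes 1, case_names quot free]:
  assumes "Z \<in> grR n"
  obtains X where "n = 0" "X \<in> carrier Q" "Z = (X, \<zero>\<^bsub>F\<^esub>)"
  | A where "A \<in> grF n" "A \<in> carrier F" "Z = emb A"
proof (cases "n = 0")
  case True
  with assms that(1) show thesis by (auto simp: DR_grading_def free_grading_def)
next
  case False
  with assms that(2) show thesis
    by (auto simp: DR_grading_def emb_free_def intro: G.homogeneous_closed)
qed

lemma DR_grading_quot: "X \<in> carrier Q \<Longrightarrow> (X, \<zero>\<^bsub>F\<^esub>) \<in> grR 0"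
  by (simp add: DR_grading_def free_grading_def)

lemma DR_grading_emb: "emb A \<in> grR n \<longleftrightarrow> A \<in> grF n"
  by (auto simp: DR_grading_def emb_free_def)

lemma submodule_DR_grading: "submodule (grR n) K R"
proof (rule R.submoduleI)
  note F = F.submoduleE[OF submodule_free_grading[of n]]
    F.submodule_zero[OF submodule_free_grading[of n]]
  show "grR n \<subseteq> carrier R" using F by (auto simp: DR_grading_def carrier_DR)
  show "\<zero>\<^bsub>R\<^esub> \<in> grR n" using F by (auto simp: DR_grading_def zero_DR)
  show "\<ominus>\<^bsub>R\<^esub> Z \<in> grR n" if "Z \<in> grR n" for Z
    using that F by (auto simp: DR_grading_def minus_DR subset_iff split: if_splits)
  show "Z \<oplus>\<^bsub>R\<^esub> W \<in> grR n" if "Z \<in> grR n" "W \<in> grR n" for Z W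
    using that F by (auto simp: DR_grading_def add_DR split: if_splits)
  show "a \<odot>\<^bsub>R\<^esub> Z \<in> grR n" if "a \<in> carrier K" "Z \<in> grR n" for a Z
    using that F by (auto simp: DR_grading_def smult_DR split: if_splits)
qed

section \<open>The direct sum decomposition of \<open>DR\<close>\<close>

interpretation GF: graded_space K F grF by (rule graded_space_free_lie)

lemma graded_space_DR: "graded_space K R grR"
proof (rule R.graded_spaceI)
  show "submodule (grR n) K R" for n by (rule submodule_DR_grading)
  show "R.decomposes grR Z" if R: "Z \<in> carrier R" for Z
  proof -
    obtain X A where Z: "Z = (X, A)" "X \<in> carrier Q" "A \<in> carrier F"
      using R by (auto simp: carrier_DR)
    have "R.decomposes grR (emb A)"
      using Z(3)
    proof (induction rule: GF.graded_induct)
      case (homogeneous n A)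
      then show ?case
        by (intro R.decomposes_homogeneous[OF submodule_DR_grading, where n = n])
          (simp add: DR_grading_emb)
    next
      case (add A B)
      then show ?case
        using R.decomposes_add[OF submodule_DR_grading] by (simp add: linear_map_add[OF linear_emb])
    qed
    moreover have "R.decomposes grR (X, \<zero>\<^bsub>F\<^esub>)"
      using Z by (intro R.decomposes_homogeneous[OF submodule_DR_grading, where n = 0] DR_grading_quot)
    moreover have "Z = (X, \<zero>\<^bsub>F\<^esub>) \<oplus>\<^bsub>R\<^esub> emb A" using Z by (simp add: emb_free_def add_DR)
    ultimately show ?thesis using R.decomposes_add[OF submodule_DR_grading] by simp
  qed
  fix c S and n :: int
  assume fin: "finite S" and c: "\<And>n. c n \<in> grR n" and sum: "finsum R c S = \<zero>\<^bsub>R\<^esub>" and n: "n \<in> S"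
  interpret RF: two_modules K R F ..
  interpret RQ: two_modules K R Q ..
  have carr: "c n \<in> carrier R" for n using c R.submoduleE(1)[OF submodule_DR_grading] by blast
  then have carr': "fst (c n) \<in> carrier Q" "snd (c n) \<in> carrier F" for n
    by (metis carrier_DR mem_Times_iff)+
  have gr: "snd (c n) \<in> grF n" "n \<noteq> 0 \<Longrightarrow> fst (c n) = \<zero>\<^bsub>Q\<^esub>" for n
    using c[of n] by (auto simp: DR_grading_def)
  have "finsum F (\<lambda>n. snd (c n)) S = \<zero>\<^bsub>F\<^esub>"
    using RF.linear_finsum[OF linear_snd fin, of c] sum carr by (simp add: zero_DR)
  then have "snd (c n) = \<zero>\<^bsub>F\<^esub>"
    using free_lie_independent[OF fin gr(1)] n by blast
  moreover have "fst (c n) = \<zero>\<^bsub>Q\<^esub>"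
  proof (cases "n = 0")
    case True
    have "finsum Q (\<lambda>n. fst (c n)) S = finsum Q (\<lambda>n. fst (c n)) {0}"
      using fin n True carr' gr(2)
      by (intro Q.M.add.finprod_mono_neutral_cong_left[symmetric]) auto
    then show ?thesis
      using RQ.linear_finsum[OF linear_fst fin, of c] sum carr carr' True by (simp add: zero_DR)
  qed (rule gr(2))
  ultimately show "c n = \<zero>\<^bsub>R\<^esub>" by (simp add: zero_DR prod_eq_iff)
qed

interpretation FR: two_modules K F R ..
interpretation RR: two_modules K R R ..
interpretation FF: two_modules K F F ..

lemma free_act_zero [simp]: "X \<in> carrier Q \<Longrightarrow> act X \<zero>\<^bsub>F\<^esub> = \<zero>\<^bsub>F\<^esub>"
  by (rule FF.linear_zero[OF linear_free_act])

lemma free_act_minus: "X \<in> carrier Q \<Longrightarrow> A \<in> carrier F \<Longrightarrow> act X (\<ominus>\<^bsub>F\<^esub> A) = \<ominus>\<^bsub>F\<^esub> act X A"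
  by (rule FF.linear_minus[OF linear_free_act])

lemma free_act_smult:
  "X \<in> carrier Q \<Longrightarrow> a \<in> carrier K \<Longrightarrow> A \<in> carrier F \<Longrightarrow> act X (a \<odot>\<^bsub>F\<^esub> A) = a \<odot>\<^bsub>F\<^esub> act X A"
  by (rule linear_map_smult[OF linear_free_act])

lemma free_act_zero_left [simp]: "A \<in> carrier F \<Longrightarrow> act \<zero>\<^bsub>Q\<^esub> A = \<zero>\<^bsub>F\<^esub>"
  using free_act_smult_left[of "\<zero>\<^bsub>K\<^esub>" "\<zero>\<^bsub>Q\<^esub>" A] by simp

lemmas qbr_closed [simp] = Q.bilinear_closed[OF bilinear_quot_bracket]
lemmas qbr_zero_left [simp] = Q.bilinear_zero_left[OF bilinear_quot_bracket]
lemmas qbr_zero_right [simp] = Q.bilinear_zero_right[OF bilinear_quot_bracket]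

lemma emb_closed [simp]: "A \<in> carrier F \<Longrightarrow> emb A \<in> carrier R"
  by (rule linear_map_closed[OF linear_emb])

lemma DR_bracket_pair: "rbr (X, A) (Y, B) =
    (qbr X Y, (act X B \<ominus>\<^bsub>F\<^esub> act Y A) \<oplus>\<^bsub>F\<^esub> fbr A B)"
  by (simp add: DR_bracket_def)

lemma
  assumes "A \<in> carrier F"
  shows DR_bracket_emb_emb: "B \<in> carrier F \<Longrightarrow> rbr (emb A) (emb B) = emb (fbr A B)"
    and DR_bracket_quot_emb: "X \<in> carrier Q \<Longrightarrow> rbr (X, \<zero>\<^bsub>F\<^esub>) (emb A) = emb (act X A)"
    and DR_bracket_emb_quot: "X \<in> carrier Q \<Longrightarrow> rbr (emb A) (X, \<zero>\<^bsub>F\<^esub>) = emb (\<ominus>\<^bsub>F\<^esub> act X A)"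
  using assms by (simp_all add: DR_bracket_pair emb_free_def a_minus_def)

lemma DR_bracket_quot_quot:
  "X \<in> carrier Q \<Longrightarrow> Y \<in> carrier Q \<Longrightarrow> rbr (X, \<zero>\<^bsub>F\<^esub>) (Y, \<zero>\<^bsub>F\<^esub>) = (qbr X Y, \<zero>\<^bsub>F\<^esub>)"
  by (simp add: DR_bracket_pair a_minus_def)

lemma bilinear_DR_bracket: "bilinear_op K R rbr"
  by (rule bilinear_opI)
    (auto simp: carrier_DR add_DR smult_DR DR_bracket_pair a_minus_def
      Q.bilinear_add_left[OF bilinear_quot_bracket] Q.bilinear_add_right[OF bilinear_quot_bracket]
      Q.bilinear_smult_left[OF bilinear_quot_bracket] Q.bilinear_smult_right[OF bilinear_quot_bracket]
      free_act_add free_act_add_left free_act_smult free_act_smult_left G.lie_add_left G.lie_add_right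
      G.lie_smult_left G.lie_smult_right F.smult_r_distr F.smult_r_minus F.M.minus_add F.M.a_ac)

lemmas rbr_closed [simp] = R.bilinear_closed[OF bilinear_DR_bracket]
lemmas rbr_zero_left [simp] = R.bilinear_zero_left[OF bilinear_DR_bracket]
lemmas rbr_zero_right [simp] = R.bilinear_zero_right[OF bilinear_DR_bracket]
lemmas rbr_add_right = R.bilinear_add_right[OF bilinear_DR_bracket]

lemma minus_emb: "A \<in> carrier F \<Longrightarrow> \<ominus>\<^bsub>R\<^esub> emb A = emb (\<ominus>\<^bsub>F\<^esub> A)"
  by (rule FR.linear_minus[OF linear_emb, symmetric])

lemma add_emb: "A \<in> carrier F \<Longrightarrow> B \<in> carrier F \<Longrightarrow> emb A \<oplus>\<^bsub>R\<^esub> emb B = emb (A \<oplus>\<^bsub>F\<^esub> B)"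
  by (rule linear_map_add[OF linear_emb, symmetric])

lemma sgnv_emb: "A \<in> carrier F \<Longrightarrow> sgnv R n (emb A) = emb (sgnv F n A)"
  by (rule FR.linear_sgnv[OF linear_emb, symmetric])

text \<open>Each argument may be taken in the quotient \<open>Q\<close> or in \<open>F\<close>. With
  three arguments in the same summand the Jacobi identity is that of the summand; with two in
  \<open>Q\<close> it says that the action is a representation, with one in \<open>Q\<close> that it
  is by derivations.\<close>

lemma graded_lie_DR: "graded_lie_algebra K R grR rbr"
proof (intro graded_lie_algebra.intro graded_lie_algebra_axioms.intro graded_space_DR
    bilinear_DR_bracket)
  note br_simps = DR_bracket_emb_emb DR_bracket_quot_emb DR_bracket_emb_quot DR_bracket_quot_quot
  have minus_zero: "\<ominus>\<^bsub>F\<^esub> \<zero>\<^bsub>F\<^esub> = \<zero>\<^bsub>F\<^esub>" by (rule F.M.minus_equality) simp_all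
  fix Z W i j
  assume Z: "Z \<in> grR i" and W: "W \<in> grR j"
  show "rbr Z W \<in> grR (i + j)"
    using Z
  proof (cases rule: DR_grading_cases)
    case Zq: (quot X)
    from W show ?thesis
    proof (cases rule: DR_grading_cases)
      case (quot Y)
      with Zq show ?thesis by (simp add: br_simps DR_grading_quot)
    next
      case (free B)
      with Zq show ?thesis by (simp add: br_simps DR_grading_emb free_act_degree)
    qed
  next
    case Zf: (free A)
    from W show ?thesis
    proof (cases rule: DR_grading_cases)
      case (quot Y)
      with Zf show ?thesis
        by (simp add: br_simps DR_grading_emb free_act_degree F.submoduleE(3)[OF submodule_free_grading])
    next
      case (free B)
      with Zf show ?thesis by (simp add: br_simps DR_grading_emb PF.degree)
    qed
  qed
  show "rbr Z W = \<ominus>\<^bsub>R\<^esub> sgnv R (i * j) (rbr W Z)"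
    using Z
  proof (cases rule: DR_grading_cases)
    case Zq: (quot X)
    from W show ?thesis
    proof (cases rule: DR_grading_cases)
      case (quot Y)
      with Zq quot_bracket_antisym[of X Y] show ?thesis
        by (simp add: br_simps sgnv_0 minus_DR minus_zero)
    next
      case (free B)
      with Zq show ?thesis by (simp add: br_simps sgnv_0 minus_emb)
    qed
  next
    case Zf: (free A)
    from W show ?thesis
    proof (cases rule: DR_grading_cases)
      case (quot Y)
      with Zf show ?thesis by (simp add: br_simps sgnv_0 minus_emb)
    next
      case (free B)
      have "fbr A B = \<ominus>\<^bsub>F\<^esub> sgnv F (i * j) (fbr B A)"
        using PF.antisymmetry[OF Zf(1) free(1)] Zf free by (simp add: F.minus_sgnv)
      with Zf free show ?thesis by (simp add: br_simps minus_emb sgnv_emb)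
    qed
  qed
  fix U k
  assume U: "U \<in> grR k"
  show "rbr Z (rbr W U) = rbr (rbr Z W) U \<oplus>\<^bsub>R\<^esub> sgnv R (i * j) (rbr W (rbr Z U))"
    using Z
  proof (cases rule: DR_grading_cases)
    case Zq: (quot X)
    from W show ?thesis
    proof (cases rule: DR_grading_cases)
      case Wq: (quot Y)
      from U show ?thesis
      proof (cases rule: DR_grading_cases)
        case (quot T)
        with Zq Wq show ?thesis
          by (simp add: br_simps sgnv_0 add_DR quot_bracket_jacobi[of X Y])
      next
        case (free C)
        with Zq Wq show ?thesis
          by (simp add: br_simps sgnv_0 add_emb free_act_commutator[of X Y])
      qed
    next
      case Wf: (free B)
      from U show ?thesis
      proof (cases rule: DR_grading_cases)
        case (quot T)
        have "act X (act T B) = act (qbr X T) B \<oplus>\<^bsub>F\<^esub> act T (act X B)"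
          using Zq quot Wf by (intro free_act_commutator)
        with Zq Wf quot show ?thesis
          by (simp add: br_simps sgnv_0 add_emb free_act_minus F.M.minus_add F.M.a_ac)
      next
        case (free C)
        with Zq Wf show ?thesis
          by (simp add: br_simps sgnv_0 add_emb free_act_bracket)
      qed
    qed
  next
    case Zf: (free A)
    from W show ?thesis
    proof (cases rule: DR_grading_cases)
      case Wq: (quot Y)
      from U show ?thesis
      proof (cases rule: DR_grading_cases)
        case (quot T)
        have "act Y (act T A) = act (qbr Y T) A \<oplus>\<^bsub>F\<^esub> act T (act Y A)"
          using Wq quot Zf by (intro free_act_commutator)
        with Zf Wq quot show ?thesis
          by (simp add: br_simps sgnv_0 add_emb free_act_minus F.M.minus_add F.M.a_ac
              F.M.r_neg1 F.M.r_neg2)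
      next
        case (free C)
        with Zf Wq show ?thesis
          by (simp add: br_simps sgnv_0 add_emb free_act_bracket F.M.a_ac
              F.bilinear_minus_left[OF bilinear_free_bracket] F.M.r_neg)
      qed
    next
      case Wf: (free B)
      from U show ?thesis
      proof (cases rule: DR_grading_cases)
        case (quot T)
        \<comment> \<open>The derivation rule produces the bracket of \<open>act T A\<close> with
          \<open>B\<close>, the Jacobi identity that of \<open>B\<close> with
          \<open>act T A\<close>. The action preserves degrees, so the sign is the one for
          \<open>A\<close> and \<open>B\<close>.\<close>
        have "fbr (act T A) B = \<ominus>\<^bsub>F\<^esub> sgnv F (i * j) (fbr B (act T A))"
          using PF.antisymmetry[OF free_act_degree[OF quot(2) Zf(1)] Wf(1)] Zf Wf quot
          by (simp add: F.minus_sgnv)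
        with Zf Wf quot show ?thesis
          by (simp add: br_simps add_emb sgnv_emb free_act_bracket F.M.minus_add F.M.a_ac
              F.bilinear_minus_right[OF bilinear_free_bracket] F.sgnv_minus F.M.r_neg)
      next
        case (free C)
        with Zf Wf PF.jacobi[OF Zf(1) Wf(1) free(2)] show ?thesis
          by (simp add: br_simps add_emb sgnv_emb)
      qed
    qed
  qed
qed

section \<open>The differential\<close>

interpretation L: graded_lie_algebra K R grR rbr by (rule graded_lie_DR)
interpretation PR: pregraded_lie_algebra K R grR rbr by (rule L.pregraded_lie_algebra)

abbreviation "term_d \<equiv> term_der R rbr (\<lambda>x. emb (gen x)) (\<lambda>x. sgnv R 1 (emb (gen x))) (\<lambda>x. (q x, \<zero>\<^bsub>F\<^esub>))"

lemma lie_derivation_d: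
  "lie_derivation K R grR rbr V (\<lambda>x. emb (gen x)) 1 (\<lambda>x. sgnv R 1 (emb (gen x))) (\<lambda>x. (q x, \<zero>\<^bsub>F\<^esub>))"
proof (intro lie_derivation.intro lie_derivation_axioms.intro lie_evaluation.intro
    lie_evaluation_axioms.intro L.pregraded_lie_algebra module_axioms)
  show "linear_map K V R (\<lambda>x. emb (gen x))" by (rule linear_map_compose[OF linear_gen linear_emb])
  show "linear_map K V R (\<lambda>x. (q x, \<zero>\<^bsub>F\<^esub>))"
    by (rule linear_mapI) (auto simp: carrier_DR add_DR smult_DR add_quot_class smult_quot_class)
qed (simp_all add: DR_grading_emb gen_degree DR_grading_quot)

interpretation d: lie_derivation K R grR rbr V "\<lambda>x. emb (gen x)" 1
  "\<lambda>x. sgnv R 1 (emb (gen x))" "\<lambda>x. (q x, \<zero>\<^bsub>F\<^esub>)" by (rule lie_derivation_d)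

section \<open>The derivation on the free Lie algebra\<close>

lemma term_eval_emb: "t \<in> terms \<Longrightarrow> term_eval R rbr (\<lambda>x. emb (gen x)) t = emb (cls t)"
  by (induction t) (auto simp: zero_free_lie add_emb DR_bracket_emb_emb
      FR.linear_zero[OF linear_emb, symmetric] linear_map_smult[OF linear_emb, symmetric]
      simp flip: add_lie_class smult_lie_class free_bracket_lie_class)

definition "dF = lift_class term_d"

lemma dF_class: "t \<in> terms \<Longrightarrow> dF (cls t) = term_d t"
  unfolding dF_def by (rule lift_class[OF _ d.term_der_cong])

lemma linear_dF: "linear_map K F R dF"
  by (rule linear_mapI) (auto simp: carrier_free_lie add_lie_class smult_lie_class dF_class)

lemmas dF_closed [simp] = linear_map_closed[OF linear_dF]
lemmas dF_zero [simp] = FR.linear_zero[OF linear_dF]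

lemma dF_gen: "x \<in> carrier V \<Longrightarrow> dF (gen x) = (q x, \<zero>\<^bsub>F\<^esub>)"
  by (simp add: dF_class)

lemma dF_degree:
  assumes "A \<in> grF n"
  shows "dF A \<in> grR (n + 1)"
  using assms
proof (cases rule: free_grading_cases)
  case 1
  then show ?thesis using R.submodule_zero[OF submodule_DR_grading] by simp
next
  case (2 m t)
  then show ?thesis using d.term_der_degree[of m t] by (simp add: dF_class)
qed

text \<open>The rule in \<open>term_der\<close> covers all terms; homogeneity of the left factor
  turns its twisted evaluation into the sign \<open>(-1)^n\<close>.\<close>

lemma dF_bracket:
  assumes "A \<in> grF n" "B \<in> carrier F"
  shows "dF (fbr A B) = rbr (dF A) (emb B) \<oplus>\<^bsub>R\<^esub> sgnv R n (rbr (emb A) (dF B))"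
  using assms(1)
proof (cases rule: free_grading_cases)
  case 1
  then show ?thesis using assms(2) by (simp add: FR.linear_zero[OF linear_emb])
next
  case (2 m t)
  obtain u where u: "u \<in> terms" "B = cls u" using assms(2) by (auto simp: carrier_free_lie)
  have "dF (fbr A B) = rbr (term_d t) (emb B) \<oplus>\<^bsub>R\<^esub> rbr (sgnv R (int m) (emb A)) (term_d u)"
    using 2 u by (simp add: free_bracket_lie_class dF_class d.term_eval_twisted term_eval_emb)
  also have "sgnv R (int m) (emb A) = sgnv R n (emb A)"
    using 2 by (intro R.sgnv_cong_parity) simp
  finally show ?thesis using 2 u by (simp add: d.lie_sgnv_left dF_class)
qed

text \<open>\<open>X\<close> has degree \<open>0\<close> and will have differential zero, so this is
  the derivation rule for the bracket of \<open>X\<close> with \<open>A\<close>. On generators both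
  sides are the class of a Leibniz bracket; the Jacobi identity of \<open>DR\<close> carries the
  claim to longer brackets.\<close>

lemma dF_act:
  assumes X: "X \<in> carrier Q" and "A \<in> carrier F"
  shows "dF (act X A) = rbr (X, \<zero>\<^bsub>F\<^esub>) (dF A)"
  using assms(2)
proof (induction rule: free_lie_gen_induct)
  case (gen y)
  obtain x where "x \<in> carrier V" "X = q x" using X by (auto simp: carrier_quot_lie)
  with gen show ?case
    by (simp add: free_act_gen dF_gen DR_bracket_quot_quot quot_bracket_class)
next
  case (add A B)
  moreover have "(X, \<zero>\<^bsub>F\<^esub>) \<in> carrier R" using X by (simp add: carrier_DR)
  ultimately show ?case
    using X by (simp add: free_act_add linear_map_add[OF linear_dF] rbr_add_right)
next
  case (bracket n z A)
  let ?X = "(X, \<zero>\<^bsub>F\<^esub>)" and ?z = "gen z"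
  have A: "A \<in> carrier F" and z: "?z \<in> carrier F" and gz: "?z \<in> grF (-1)"
    using bracket G.homogeneous_closed gen_degree by auto
  have X0: "?X \<in> grR 0" using X by (rule DR_grading_quot)
  have Xc: "?X \<in> carrier R" using X by (simp add: carrier_DR)
  obtain x where "x \<in> carrier V" "X = q x" using X by (auto simp: carrier_quot_lie)
  then have dz: "dF (act X ?z) = rbr ?X (dF ?z)"
    using bracket(1) by (simp add: free_act_gen dF_gen DR_bracket_quot_quot quot_bracket_class)
  have "dF (act X (fbr ?z A)) =
      (rbr (rbr ?X (dF ?z)) (emb A) \<oplus>\<^bsub>R\<^esub> \<ominus>\<^bsub>R\<^esub> rbr (rbr ?X (emb ?z)) (dF A)) \<oplus>\<^bsub>R\<^esub>
      (rbr (dF ?z) (rbr ?X (emb A)) \<oplus>\<^bsub>R\<^esub> \<ominus>\<^bsub>R\<^esub> rbr (emb ?z) (rbr ?X (dF A)))"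
    using X A z gz by (simp add: free_act_bracket linear_map_add[OF linear_dF]
        dF_bracket[OF free_act_degree[OF X gz]] dF_bracket[OF gz] dz bracket(3) sgnv_def
        DR_bracket_quot_emb)
  moreover have "rbr ?X (rbr (dF ?z) (emb A)) =
      rbr (rbr ?X (dF ?z)) (emb A) \<oplus>\<^bsub>R\<^esub> rbr (dF ?z) (rbr ?X (emb A))"
    using PR.jacobi[OF X0 dF_degree[OF gz], of "emb A"] A by (simp add: sgnv_def)
  moreover have "rbr ?X (rbr (emb ?z) (dF A)) =
      rbr (rbr ?X (emb ?z)) (dF A) \<oplus>\<^bsub>R\<^esub> rbr (emb ?z) (rbr ?X (dF A))"
    using PR.jacobi[OF X0, of "emb ?z" "-1" "dF A"] A gz by (simp add: sgnv_def DR_grading_emb)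
  moreover have "dF (fbr ?z A) = rbr (dF ?z) (emb A) \<oplus>\<^bsub>R\<^esub> \<ominus>\<^bsub>R\<^esub> rbr (emb ?z) (dF A)"
    using dF_bracket[OF gz A] by (simp add: sgnv_def)
  ultimately show ?case
    using A z Xc by (simp add: rbr_add_right R.bilinear_minus_right[OF bilinear_DR_bracket]
        R.M.minus_add R.M.a_ac)
qed

section \<open>The differential on \<open>DR\<close>\<close>

definition "dR = (\<lambda>Z\<in>carrier R. dF (snd Z))"

lemma dR_emb: "A \<in> carrier F \<Longrightarrow> dR (emb A) = dF A"
  using emb_closed[of A] by (simp add: dR_def emb_free_def)

lemma dR_quot: "X \<in> carrier Q \<Longrightarrow> dR (X, \<zero>\<^bsub>F\<^esub>) = \<zero>\<^bsub>R\<^esub>"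
  by (simp add: dR_def carrier_DR)

lemma linear_dR: "linear_map K R R dR"
  using linear_map_cong[OF linear_map_compose[OF linear_snd linear_dF] module_DR, of dR]
  by (simp add: dR_def)

lemmas dR_closed [simp] = linear_map_closed[OF linear_dR]

lemma dR_degree:
  assumes "Z \<in> grR n"
  shows "dR Z \<in> grR (n + 1)"
  using assms R.submodule_zero[OF submodule_DR_grading]
  by (cases rule: DR_grading_cases) (auto simp: dR_quot dR_emb dF_degree)

text \<open>Two arguments in \<open>Q\<close> give zero on both sides. The mixed cases are
  \<open>dF_act\<close>, in one order through antisymmetry, and two arguments in \<open>F\<close>
  are the Leibniz rule of \<open>dF\<close>.\<close>

lemma dR_derivation:
  assumes Z: "Z \<in> grR i" and W: "W \<in> grR j"
  shows "dR (rbr Z W) = rbr (dR Z) W \<oplus>\<^bsub>R\<^esub> sgnv R i (rbr Z (dR W))"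
  using Z
proof (cases rule: DR_grading_cases)
  case Zq: (quot X)
  then have Zc: "(X, \<zero>\<^bsub>F\<^esub>) \<in> carrier R" by (simp add: carrier_DR)
  from W show ?thesis
  proof (cases rule: DR_grading_cases)
    case (quot Y)
    then have "(Y, \<zero>\<^bsub>F\<^esub>) \<in> carrier R" by (simp add: carrier_DR)
    with Zq Zc quot show ?thesis by (simp add: DR_bracket_quot_quot dR_quot)
  next
    case (free B)
    with Zq Zc show ?thesis
      by (simp add: DR_bracket_quot_emb dR_quot dR_emb dF_act sgnv_0)
  qed
next
  case Zf: (free A)
  from W show ?thesis
  proof (cases rule: DR_grading_cases)
    case (quot Y)
    then have Yc: "(Y, \<zero>\<^bsub>F\<^esub>) \<in> carrier R" by (simp add: carrier_DR)
    have "rbr (dF A) (Y, \<zero>\<^bsub>F\<^esub>) = \<ominus>\<^bsub>R\<^esub> rbr (Y, \<zero>\<^bsub>F\<^esub>) (dF A)"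
      using PR.antisymmetry[OF dF_degree[OF Zf(1)] DR_grading_quot[OF quot(2)]] by (simp add: sgnv_def)
    with Zf quot Yc show ?thesis
      by (simp add: DR_bracket_emb_quot dR_quot dR_emb FR.linear_minus[OF linear_dF] dF_act)
  next
    case (free B)
    with Zf show ?thesis by (simp add: DR_bracket_emb_emb dR_emb dF_bracket)
  qed
qed

text \<open>The two terms of \<open>d (x, A)\<close> have opposite signs because \<open>x\<close> is
  odd, and each has differential \<open>(d x, d A)\<close>, since one of its factors is already a
  differential and is killed by the next.\<close>

lemma dR_square:
  assumes "Z \<in> carrier R"
  shows "dR (dR Z) = \<zero>\<^bsub>R\<^esub>"
proof -
  have "dR (dF A) = \<zero>\<^bsub>R\<^esub>" if "A \<in> carrier F" for A
    using that
  proof (induction rule: free_lie_gen_induct)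
    case (gen x)
    then show ?case by (simp add: dF_gen dR_quot)
  next
    case (add A B)
    then show ?case by (simp add: linear_map_add[OF linear_dF] linear_map_add[OF linear_dR])
  next
    case (bracket n x A)
    let ?x = "gen x"
    have A: "A \<in> carrier F" and x: "?x \<in> carrier F" and gx: "?x \<in> grF (-1)"
      using bracket G.homogeneous_closed gen_degree by auto
    have ex: "emb ?x \<in> grR (-1)" and eA: "emb A \<in> grR n"
      using gx bracket(2) by (simp_all add: DR_grading_emb)
    have dx: "dF ?x \<in> grR 0" using dF_degree[OF gx] by simp
    have qx: "(q x, \<zero>\<^bsub>F\<^esub>) \<in> carrier R" using bracket(1) by (simp add: carrier_DR)
    have "dR (rbr (dF ?x) (emb A)) = rbr (dF ?x) (dF A)"
      using dR_derivation[OF dx eA] bracket(1) A x qx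
      by (simp add: dF_gen dR_quot dR_emb sgnv_0)
    moreover have "dR (rbr (emb ?x) (dF A)) = rbr (dF ?x) (dF A)"
      using dR_derivation[OF ex dF_degree[OF bracket(2)]] bracket(3) A x
      by (simp add: dR_emb)
    ultimately show ?case
      using A x dF_bracket[OF gx A]
      by (simp add: sgnv_def linear_map_add[OF linear_dR] RR.linear_minus[OF linear_dR] R.M.r_neg)
  qed
  with assms show ?thesis by (auto simp: dR_def carrier_DR mem_Times_iff)
qed

lemma dg_lie_dR: "dg_lie_algebra K R grR rbr dR"
  by (intro dg_lie_algebra.intro dg_lie_algebra_axioms.intro graded_lie_DR linear_dR dR_degree
      dR_derivation dR_square)

subsection \<open>The differential on right-normed brackets\<close>

lemma right_normed_update_closed:
  "set xs \<subseteq> carrier V \<Longrightarrow> x \<in> carrier V \<Longrightarrow> right_normed K V (xs[j := x]) \<in> carrier F"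
  using set_update_subset_insert[of xs j x] by (intro right_normed_closed) auto

lemma bracket_into_Cons_0:
  "bracket_into br (x # ys) 0 (Suc j) = ys[j := br x (ys ! j)]"
  by (simp add: bracket_into_def)

lemma bracket_into_Cons_Suc:
  "bracket_into br (x # ys) (Suc i) (Suc j) = x # bracket_into br ys i j"
  by (simp add: bracket_into_def Let_def)

lemma bracket_into_closed:
  assumes "set xs \<subseteq> carrier V" "i < length xs" "j < length xs"
  shows "set (bracket_into br xs i j) \<subseteq> carrier V"
proof -
  have "br (xs ! i) (xs ! j) \<in> carrier V" using assms by (simp add: subset_iff)
  then have "set (xs[j := br (xs ! i) (xs ! j)]) \<subseteq> carrier V"
    using set_update_subset_insert[of xs j] assms(1) by fastforce
  then show ?thesis
    unfolding bracket_into_def Let_def set_append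
    using set_take_subset set_drop_subset by fast
qed

text \<open>These are the summands with \<open>i = 0\<close> in the formula for the differential of
  \<open>{x, ys}\<close>: a derivation contributes one summand per entry.\<close>

lemma free_act_right_normed:
  assumes "x \<in> carrier V"
  shows "set ys \<subseteq> carrier V \<Longrightarrow> ys \<noteq> [] \<Longrightarrow>
    act (q x) (right_normed K V ys) =
    finsum F (\<lambda>j. right_normed K V (ys[j := br x (ys ! j)])) {..<length ys}"
proof (induction ys)
  case (Cons y ys)
  have y: "y \<in> carrier V" and ys: "set ys \<subseteq> carrier V" using Cons.prems by auto
  show ?case
  proof (cases "ys = []")
    case True
    with y assms show ?thesis by (simp add: free_act_gen lessThan_Suc)
  next
    case False
    let ?f = "\<lambda>j. right_normed K V ((y # ys)[j := br x ((y # ys) ! j)])"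
    let ?h = "\<lambda>j. right_normed K V (ys[j := br x (ys ! j)])"
    have h: "?h \<in> {..<length ys} \<rightarrow> carrier F"
      using ys assms by (intro Pi_I right_normed_update_closed br_closed) (auto simp: subset_iff)
    have hc: "?h j \<in> carrier F" if "j < length ys" for j using h that by blast
    have f: "?f (Suc j) = fbr (gen y) (?h j)" for j
      using False by (simp add: right_normed_Cons)
    have f0: "?f 0 = fbr (gen (br x y)) (right_normed K V ys)"
      using False by (simp add: right_normed_Cons)
    have "act (q x) (right_normed K V (y # ys)) =
        fbr (gen (br x y)) (right_normed K V ys) \<oplus>\<^bsub>F\<^esub> fbr (gen y) (finsum F ?h {..<length ys})"
      using Cons.IH False assms y ys by (simp add: right_normed_Cons free_act_bracket free_act_gen)
    also have "fbr (gen y) (finsum F ?h {..<length ys}) = finsum F (\<lambda>j. fbr (gen y) (?h j)) {..<length ys}"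
      using y h bilinear_free_bracket by (intro FF.linear_finsum) (auto simp: bilinear_op_def)
    also have "\<dots> = finsum F (\<lambda>j. ?f (Suc j)) {..<length ys}" by (simp only: f)
    also have "\<dots> = finsum F ?f (Suc ` {..<length ys})"
      using hc y f by (intro F.M.finsum_reindex[symmetric]) (auto simp del: list_update.simps)
    also have "fbr (gen (br x y)) (right_normed K V ys) = ?f 0" by (simp only: f0)
    also have "?f 0 \<oplus>\<^bsub>F\<^esub> finsum F ?f (Suc ` {..<length ys}) = finsum F ?f (insert 0 (Suc ` {..<length ys}))"
    proof (rule F.M.finsum_insert[symmetric])
      show "?f 0 \<in> carrier F" using y ys assms by (simp only: f0) simp
      show "?f \<in> Suc ` {..<length ys} \<rightarrow> carrier F" using hc y f by (auto simp del: list_update.simps)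
    qed auto
    also have "insert 0 (Suc ` {..<length ys}) = {..<length (y # ys)}"
      by (simp add: lessThan_Suc_eq_insert_0)
    finally show ?thesis .
  qed
qed simp

text \<open>The rule \<open>d (x, R) = (d x, R) - (x, d R)\<close> for the explicit formula. Pairs
  with \<open>i = 0\<close> make up the action; any other pair is a pair of the tail shifted by one
  position, which flips its sign, and the last summand shifts likewise. For a tail with one entry
  \<open>d R\<close> would lie outside \<open>F\<close>, whence the bound on the length.\<close>

lemma diff_right_normed_Cons:
  assumes x: "x \<in> carrier V" and ys: "set ys \<subseteq> carrier V" and len: "2 \<le> length ys"
  shows "diff_right_normed K V br (x # ys) =
    act (q x) (right_normed K V ys) \<oplus>\<^bsub>F\<^esub> \<ominus>\<^bsub>F\<^esub> fbr (gen x) (diff_right_normed K V br ys)"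
proof -
  define n where "n = length ys - 1"
  have n: "length ys = Suc n" "0 < n" using len by (auto simp: n_def)
  let ?xs = "x # ys"
  let ?f = "\<lambda>(i, j). sgnv F (int i) (right_normed K V (bracket_into br ?xs i j))"
  let ?h = "\<lambda>(i, j). sgnv F (int i) (right_normed K V (bracket_into br ys i j))"
  let ?S = "{(i, j). i < j \<and> j \<le> n}" and ?A = "(\<lambda>j. (0::nat, Suc j)) ` {..<length ys}"
  let ?B = "(\<lambda>(i, j). (Suc i, Suc j)) ` ?S"
  let ?l = "right_normed K V (take (n - 1) ys @ [br (ys ! n) (ys ! (n - 1))])"
  have S: "{(i, j). i < j \<and> j \<le> Suc n} = ?A \<union> ?B"
  proof (rule Set.set_eqI)
    show "p \<in> {(i, j). i < j \<and> j \<le> Suc n} \<longleftrightarrow> p \<in> ?A \<union> ?B" for p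
      using n by (cases p; cases "fst p"; cases "snd p") (auto simp: image_iff)
  qed
  have finS: "finite ?S" by (rule finite_subset[of _ "{..n} \<times> {..n}"]) auto
  have lc: "?l \<in> carrier F"
    using ys n set_take_subset[of "n - 1" ys] by (intro right_normed_closed) (auto simp: subset_iff)
  have h: "?h \<in> ?S \<rightarrow> carrier F"
    using ys n by (auto intro!: F.sgnv_closed right_normed_closed dest!: bracket_into_closed[THEN subsetD, rotated 3])
  have ne: "bracket_into br ys i j \<noteq> []" for i j
    using n by (auto simp: bracket_into_def Let_def)
  have fB: "?f (Suc i, Suc j) = \<ominus>\<^bsub>F\<^esub> fbr (gen x) (?h (i, j))" if "(i, j) \<in> ?S" for i j
  proof -
    have "right_normed K V (bracket_into br ys i j) \<in> carrier F"
      using that ys n by (intro right_normed_closed bracket_into_closed) auto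
    then show ?thesis
      using x ne by (simp add: bracket_into_Cons_Suc right_normed_Cons G.lie_sgnv_right F.minus_sgnv add.commute)
  qed
  have lin: "linear_map K F F (\<lambda>A. \<ominus>\<^bsub>F\<^esub> fbr (gen x) A)"
    using x by (intro linear_mapI) (auto simp: G.lie_add_right G.lie_smult_right F.M.minus_add F.smult_r_minus F.M.a_ac)
  have fA: "?f \<in> ?A \<rightarrow> carrier F"
    using x ys by (auto simp: bracket_into_Cons_0 sgnv_0 subset_iff intro!: right_normed_update_closed)
  have fB': "?f \<in> ?B \<rightarrow> carrier F"
    using fB h x by (auto simp: Pi_iff)
  have "finsum F ?f (?A \<union> ?B) = finsum F ?f ?A \<oplus>\<^bsub>F\<^esub> finsum F ?f ?B"
    using fA fB' finS by (intro F.M.finsum_Un_disjoint) auto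
  also have "finsum F ?f ?A = finsum F (\<lambda>j. ?f (0, Suc j)) {..<length ys}"
    using fA by (intro F.M.finsum_reindex) (auto simp: inj_on_def)
  also have "\<dots> = act (q x) (right_normed K V ys)"
    using x ys n by (subst free_act_right_normed) (auto simp: bracket_into_Cons_0 sgnv_0)
  also have "finsum F ?f ?B = finsum F (\<lambda>p. ?f (case p of (i, j) \<Rightarrow> (Suc i, Suc j))) ?S"
    using fB' by (intro F.M.finsum_reindex) (auto simp: inj_on_def)
  also have "\<dots> = finsum F (\<lambda>p. \<ominus>\<^bsub>F\<^esub> fbr (gen x) (?h p)) ?S"
    using h x fB by (intro F.M.finsum_cong') (auto simp: Pi_iff)
  also have "\<dots> = \<ominus>\<^bsub>F\<^esub> fbr (gen x) (finsum F ?h ?S)"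
    by (rule FF.linear_finsum[OF lin finS h, symmetric])
  finally have sum: "finsum F ?f {(i, j). i < j \<and> j \<le> Suc n} =
      act (q x) (right_normed K V ys) \<oplus>\<^bsub>F\<^esub> \<ominus>\<^bsub>F\<^esub> fbr (gen x) (finsum F ?h ?S)"
    by (simp only: S)
  obtain m where m: "n = Suc m" using n by (cases n) auto
  have last: "sgnv F (int n) (right_normed K V (take n ?xs @ [br (?xs ! Suc n) (?xs ! n)])) =
      \<ominus>\<^bsub>F\<^esub> fbr (gen x) (sgnv F (int m) ?l)"
    using x lc by (simp add: m right_normed_Cons G.lie_sgnv_right F.minus_sgnv add.commute)
  have len: "length ?xs - 1 = Suc n" "length ys - 1 = n" "Suc n - 1 = n" "n - 1 = m"
    using n m by simp_all
  have 1: "diff_right_normed K V br ?xs =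
      (act (q x) (right_normed K V ys) \<oplus>\<^bsub>F\<^esub> \<ominus>\<^bsub>F\<^esub> fbr (gen x) (finsum F ?h ?S)) \<oplus>\<^bsub>F\<^esub>
      \<ominus>\<^bsub>F\<^esub> fbr (gen x) (sgnv F (int m) ?l)"
    by (simp only: diff_right_normed_def Let_def len(1,3) sum last)
  have 2: "diff_right_normed K V br ys = finsum F ?h ?S \<oplus>\<^bsub>F\<^esub> sgnv F (int m) ?l"
    by (simp only: diff_right_normed_def Let_def len(2,4))
  have "act (q x) (right_normed K V ys) \<in> carrier F" "finsum F ?h ?S \<in> carrier F"
    "sgnv F (int m) ?l \<in> carrier F"
    using x ys lc h by (auto intro: F.M.finsum_closed)
  with x show ?thesis
    unfolding 1 2 by (simp add: G.lie_add_right F.M.minus_add F.M.a_assoc)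
qed

text \<open>The end of the recursion: in \<open>d {x, y} = (d x, y) - (x, d y)\<close> antisymmetry
  with the class of \<open>y\<close> turns the second term into \<open>[y, x]\<close>. This is the
  origin of the reversed bracket in the last summand of the formula.\<close>

lemma diff_right_normed_pair:
  assumes "x \<in> carrier V" "y \<in> carrier V"
  shows "diff_right_normed K V br [x, y] = gen (br x y) \<oplus>\<^bsub>F\<^esub> gen (br y x)"
proof -
  have "{(i, j). i < j \<and> j \<le> Suc 0} = {(0, 1)}" by auto
  with assms show ?thesis by (simp add: diff_right_normed_def bracket_into_def sgnv_0)
qed

lemma diff_right_normed_closed:
  assumes "set xs \<subseteq> carrier V" "2 \<le> length xs"
  shows "diff_right_normed K V br xs \<in> carrier F"
  using assms
proof (induction xs)
  case (Cons x ys)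
  show ?case
  proof (cases "2 \<le> length ys")
    case True
    with Cons show ?thesis by (simp add: diff_right_normed_Cons)
  next
    case False
    with Cons.prems obtain y where "ys = [y]" by (cases ys; cases "tl ys") auto
    with Cons.prems show ?thesis by (simp add: diff_right_normed_pair)
  qed
qed simp

lemma dR_right_normed:
  "set xs \<subseteq> carrier V \<Longrightarrow> 2 \<le> length xs \<Longrightarrow>
   dR (emb (right_normed K V xs)) = emb (diff_right_normed K V br xs)"
proof (induction xs)
  case (Cons x ys)
  have x: "x \<in> carrier V" and ys: "set ys \<subseteq> carrier V" using Cons.prems by auto
  have ne: "ys \<noteq> []" using Cons.prems by auto
  have rn: "right_normed K V ys \<in> carrier F" using ys by simp
  have d: "dR (emb (right_normed K V (x # ys))) =
      emb (act (q x) (right_normed K V ys)) \<oplus>\<^bsub>R\<^esub> \<ominus>\<^bsub>R\<^esub> rbr (emb (gen x)) (dR (emb (right_normed K V ys)))"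
    using x rn ne dF_bracket[OF gen_degree[OF x] rn]
    by (simp add: right_normed_Cons dR_emb dF_gen DR_bracket_quot_emb sgnv_def)
  show ?case
  proof (cases "length ys = 1")
    case True
    then obtain y where y: "ys = [y]" by (auto simp: length_Suc_conv)
    with d show ?thesis
      using x ys y by (simp add: dR_emb dF_gen DR_bracket_emb_quot minus_emb add_emb free_act_gen
          diff_right_normed_pair)
  next
    case False
    then have len: "2 \<le> length ys" using ne by (cases ys; cases "tl ys") auto
    with Cons.IH[OF ys] d show ?thesis
      using x ys rn by (simp add: diff_right_normed_Cons DR_bracket_emb_emb
          diff_right_normed_closed minus_emb add_emb)
  qed
qed simp

lemma dR_is_differential: "is_DR_differential K V br dR"
  unfolding is_DR_differential_def
  using linear_dR dR_quot dR_emb dF_gen dR_right_normed by (auto simp: dR_def)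

text \<open>Right-normed brackets generate \<open>F\<close> additively, and the values on all of
  them and on the quotient are prescribed.\<close>

lemma DR_differential_unique:
  assumes "is_DR_differential K V br e"
  shows "e = dR"
proof (rule extensionalityI)
  show "e \<in> extensional (carrier R)" using assms by (simp add: is_DR_differential_def)
  show "dR \<in> extensional (carrier R)" by (simp add: dR_def)
  have lin: "linear_map K R R e"
    and quot: "\<And>X. X \<in> carrier Q \<Longrightarrow> e (X, \<zero>\<^bsub>F\<^esub>) = \<zero>\<^bsub>R\<^esub>"
    and gen: "\<And>x. x \<in> carrier V \<Longrightarrow> e (emb (gen x)) = (q x, \<zero>\<^bsub>F\<^esub>)"
    and rn: "\<And>xs. set xs \<subseteq> carrier V \<Longrightarrow> 2 \<le> length xs \<Longrightarrow>
      e (emb (right_normed K V xs)) = emb (diff_right_normed K V br xs)"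
    using assms by (auto simp: is_DR_differential_def)
  have emb: "e (emb A) = dR (emb A)" if "A \<in> carrier F" for A
    using that
  proof (induction rule: free_lie_induct)
    case (right_normed xs)
    show ?case
    proof (cases "2 \<le> length xs")
      case True
      with right_normed show ?thesis by (simp add: rn dR_right_normed)
    next
      case False
      with right_normed(2) obtain x where "xs = [x]"
        by (cases xs; cases "tl xs") (auto simp: Suc_le_eq)
      with right_normed show ?thesis by (simp add: gen dR_emb dF_gen)
    qed
  next
    case (add A B)
    then show ?case
      by (simp add: linear_map_add[OF lin] linear_map_add[OF linear_dR] flip: add_emb)
  qed
  fix Z assume "Z \<in> carrier R"
  then obtain X A where Z: "X \<in> carrier Q" "A \<in> carrier F" "Z = (X, \<zero>\<^bsub>F\<^esub>) \<oplus>\<^bsub>R\<^esub> emb A"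
    by (auto simp: carrier_DR emb_free_def add_DR)
  moreover have "(X, \<zero>\<^bsub>F\<^esub>) \<in> carrier R" using Z by (simp add: carrier_DR)
  ultimately show "e Z = dR Z"
    by (simp add: linear_map_add[OF lin] linear_map_add[OF linear_dR] quot dR_quot emb)
qed

lemma DR_diff_eq: "DR_diff K V br = dR"
  unfolding DR_diff_def
  using dR_is_differential DR_differential_unique by (rule the_equality)

end

section \<open>Derived brackets\<close>

context dg_lie_algebra
begin

interpretation W: pregraded_lie_algebra K V gr lie by (rule pregraded_lie_algebra)

lemma gr_closed: "x \<in> gr n \<Longrightarrow> x \<in> carrier V"
  using submoduleE(1)[OF gr_submodule] by blast

lemma D_closed [simp]: "x \<in> carrier V \<Longrightarrow> D x \<in> carrier V"
  by (rule linear_map_closed[OF D_linear])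

lemmas lie_closed [simp] = bilinear_closed[OF lie_bilinear]
lemmas lie_zero_left [simp] = bilinear_zero_left[OF lie_bilinear]
lemmas lie_zero_right [simp] = bilinear_zero_right[OF lie_bilinear]
lemmas lie_add_left = bilinear_add_left[OF lie_bilinear]
lemmas lie_add_right = bilinear_add_right[OF lie_bilinear]

text \<open>As \<open>D (D x)\<close> vanishes, one term of the derivation rule is left.\<close>

lemma D_derived:
  assumes x: "x \<in> gr i" and y: "y \<in> gr j"
  shows "D (lie (D x) y) = sgnv V (i + 1) (lie (D x) (D y))"
  using D_derivation[OF D_degree[OF x] y] x y gr_closed by (simp add: D_square)

text \<open>Up to the sign \<open>(-1)^(i + 1)\<close>, which cancels, \<open>D\<close> maps the
  derived bracket of \<open>x\<close> and \<open>y\<close> to \<open>(D x, D y)\<close>. The odd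
  Leibniz identity is thus the Jacobi identity for \<open>D x\<close>, \<open>D y\<close> and
  \<open>z\<close>.\<close>

lemma derived_leibniz:
  assumes x: "x \<in> gr i" and y: "y \<in> gr j" and z: "z \<in> carrier V"
  shows "lie (D x) (lie (D y) z) =
    sgnv V (i + 1) (lie (D (lie (D x) y)) z) \<oplus>\<^bsub>V\<^esub> sgnv V ((i + 1) * (j + 1)) (lie (D y) (lie (D x) z))"
proof -
  have c: "x \<in> carrier V" "y \<in> carrier V" using x y gr_closed by auto
  then have "sgnv V (i + 1) (lie (D (lie (D x) y)) z) = lie (lie (D x) (D y)) z"
    using z by (simp add: D_derived[OF x y] bilinear_sgnv_left[OF lie_bilinear] sgnv_sgnv)
      (simp add: sgnv_def)
  then show ?thesis using W.jacobi[OF D_degree[OF x] D_degree[OF y] z] by simp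
qed

text \<open>This is the derivation rule for \<open>D (x, y)\<close>: antisymmetry turns
  \<open>(D y, x)\<close> into \<open>(x, D y)\<close>, and the exponents, with the outer minus
  included, add up to \<open>i\<close> modulo 2.\<close>

lemma lie_derived:
  assumes x: "x \<in> gr i" and y: "y \<in> gr j" and z: "z \<in> carrier V"
  shows "lie (D (lie x y)) z = lie (lie (D x) y \<ominus>\<^bsub>V\<^esub> sgnv V (i * j) (lie (D y) x)) z"
proof -
  have c: "x \<in> carrier V" "y \<in> carrier V" using x y gr_closed by auto
  have "lie (D y) x = sgnv V ((j + 1) * i + 1) (lie x (D y))"
    by (rule W.antisymmetry[OF D_degree[OF y] x])
  then have "\<ominus>\<^bsub>V\<^esub> sgnv V (i * j) (lie (D y) x) = sgnv V (i * j + ((j + 1) * i + 1) + 1) (lie x (D y))"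
    using c by (simp add: sgnv_sgnv minus_sgnv)
  also have "\<dots> = sgnv V i (lie x (D y))" by (rule sgnv_cong_parity) (auto simp: algebra_simps)
  finally show ?thesis by (simp add: D_derivation[OF x y] a_minus_def)
qed

end

section \<open>The odd Leibniz bracket of the free Lie algebra\<close>

context leibniz_algebra
begin

interpretation Q: module K Q by (rule module_quot_lie)
interpretation F: char0_vector_space K F by (rule char0_free_lie)
interpretation GL: graded_lie_algebra K F grF fbr by (rule graded_lie_free_lie)
interpretation R: dg_lie_algebra K R grR rbr dR by (rule dg_lie_dR)
interpretation FR: two_modules K F R ..

text \<open>The derived bracket brought back to \<open>F\<close>. Outside the carrier it takes the
  value prescribed by \<open>is_free_leibniz_bracket\<close>, so that uniqueness is equality of
  functions.\<close>

definition "leibF A B =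
  (if A \<in> carrier F \<and> B \<in> carrier F then snd (rbr (dF A) (emb B)) else undefined)"

text \<open>\<open>snd\<close> loses nothing: the quotient component of the right-hand side is a
  bracket with zero.\<close>

lemma emb_leibF:
  assumes "A \<in> carrier F" "B \<in> carrier F"
  shows "emb (leibF A B) = rbr (dF A) (emb B)"
proof -
  obtain X C where "dF A = (X, C)" "X \<in> carrier Q"
    using linear_map_closed[OF linear_dF assms(1)] by (auto simp: carrier_DR)
  with assms show ?thesis
    by (simp add: leibF_def emb_free_def DR_bracket_pair Q.bilinear_zero_right[OF bilinear_quot_bracket])
qed

lemma leibF_closed [simp]:
  assumes "A \<in> carrier F" "B \<in> carrier F"
  shows "leibF A B \<in> carrier F"
proof -
  have "rbr (dF A) (emb B) \<in> carrier R" using assms by simp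
  with assms show ?thesis by (auto simp: leibF_def carrier_DR)
qed

lemmas emb_add = linear_map_add[OF linear_emb]
lemmas emb_smult = linear_map_smult[OF linear_emb]
lemmas emb_sgnv = FR.linear_sgnv[OF linear_emb]
lemmas emb_minus = FR.linear_minus[OF linear_emb]
lemmas fbr_closed [simp] = F.bilinear_closed[OF bilinear_free_bracket]

lemma dF_leibF: "A \<in> carrier F \<Longrightarrow> B \<in> carrier F \<Longrightarrow> dF (leibF A B) = dR (rbr (dF A) (emb B))"
  using dR_emb[of "leibF A B"] by (simp add: emb_leibF)

text \<open>Injectivity of \<open>emb\<close> moves each identity to \<open>DR\<close>, where it is
  a property of derived brackets or, for \<open>leib_lie\<close>, the Jacobi identity with first
  argument \<open>dF A\<close> of degree \<open>i + 1\<close>.\<close>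

lemma lie_leibniz_leibF: "lie_leibniz_algebra K F grF fbr leibF"
proof (intro lie_leibniz_algebra.intro lie_leibniz_algebra_axioms.intro graded_lie_free_lie
    odd_leibniz_algebra.intro odd_leibniz_algebra_axioms.intro graded_space_free_lie)
  have carr: "A \<in> carrier F" if "A \<in> grF n" for A n
    using that F.submoduleE(1)[OF submodule_free_grading] by blast
  show "bilinear_op K F leibF"
  proof (rule bilinear_opI)
    fix A B C assume [simp]: "A \<in> carrier F" "B \<in> carrier F" "C \<in> carrier F"
    show "leibF (A \<oplus>\<^bsub>F\<^esub> B) C = leibF A C \<oplus>\<^bsub>F\<^esub> leibF B C"
      by (rule emb_inject[THEN iffD1])
        (simp add: emb_add emb_leibF linear_map_add[OF linear_dF] R.lie_add_left)
    show "leibF A (B \<oplus>\<^bsub>F\<^esub> C) = leibF A B \<oplus>\<^bsub>F\<^esub> leibF A C"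
      by (rule emb_inject[THEN iffD1])
        (simp add: emb_add emb_leibF linear_map_add[OF linear_dF] R.lie_add_right)
  next
    fix a A B assume [simp]: "a \<in> carrier K" "A \<in> carrier F" "B \<in> carrier F"
    show "leibF (a \<odot>\<^bsub>F\<^esub> A) B = a \<odot>\<^bsub>F\<^esub> leibF A B"
      by (rule emb_inject[THEN iffD1])
        (simp add: emb_smult emb_leibF linear_map_smult[OF linear_dF] R.bilinear_smult_left[OF R.lie_bilinear])
    show "leibF A (a \<odot>\<^bsub>F\<^esub> B) = a \<odot>\<^bsub>F\<^esub> leibF A B"
      by (rule emb_inject[THEN iffD1])
        (simp add: emb_smult emb_leibF R.bilinear_smult_right[OF R.lie_bilinear])
  qed simp
  fix A B i j assume AB: "A \<in> grF i" "B \<in> grF j"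
  note [simp] = AB[THEN carr]
  have gr: "emb A \<in> grR i" "emb B \<in> grR j" using AB by (simp_all add: DR_grading_emb)
  have "emb (leibF A B) \<in> grR (i + 1 + j)"
    unfolding emb_leibF[OF AB[THEN carr]] by (rule R.lie_degree[OF dF_degree[OF AB(1)] gr(2)])
  then show "leibF A B \<in> grF (i + j + 1)" by (simp add: DR_grading_emb algebra_simps)
  fix C k assume C: "C \<in> grF k"
  note [simp] = C[THEN carr]
  show "leibF A (leibF B C) =
      sgnv F (i + 1) (leibF (leibF A B) C) \<oplus>\<^bsub>F\<^esub> sgnv F ((i + 1) * (j + 1)) (leibF B (leibF A C))"
    using R.derived_leibniz[OF gr, of "emb C"]
    by (intro emb_inject[THEN iffD1]) (simp add: emb_add emb_sgnv emb_leibF dF_leibF dR_emb)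
  have "rbr (dF A) (rbr (emb B) (emb C)) =
      rbr (rbr (dF A) (emb B)) (emb C) \<oplus>\<^bsub>R\<^esub> sgnv R ((i + 1) * j) (rbr (emb B) (rbr (dF A) (emb C)))"
    using C by (intro R.lie_jacobi[OF dF_degree[OF AB(1)] gr(2)]) (simp add: DR_grading_emb)
  then show "leibF A (fbr B C) = fbr (leibF A B) C \<oplus>\<^bsub>F\<^esub> sgnv F ((i + 1) * j) (fbr B (leibF A C))"
    by (intro emb_inject[THEN iffD1])
      (simp add: emb_add emb_sgnv emb_leibF flip: DR_bracket_emb_emb)
  show "leibF (fbr A B) C = fbr (leibF A B \<ominus>\<^bsub>F\<^esub> sgnv F (i * j) (leibF B A)) C"
    using R.lie_derived[OF gr, of "emb C"]
    by (intro emb_inject[THEN iffD1])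
      (simp add: emb_add emb_sgnv emb_minus emb_leibF dR_emb a_minus_def DR_bracket_emb_emb
        flip: DR_bracket_emb_emb[of "_ \<oplus>\<^bsub>F\<^esub> _"])
qed

lemma leibF_is_free_leibniz_bracket: "is_free_leibniz_bracket K V br leibF"
  unfolding is_free_leibniz_bracket_def
proof (intro conjI lie_leibniz_leibF ballI)
  fix x y assume xy: "x \<in> carrier V" "y \<in> carrier V"
  then show "leibF (gen x) (gen y) = gen (br x y)"
    by (intro emb_inject[THEN iffD1]) (simp add: emb_leibF dF_gen DR_bracket_quot_emb free_act_gen)
qed (auto simp: leibF_def)

text \<open>With a generator on the left, \<open>leib_lie\<close> determines the bracket by
  recursion over the right argument; \<open>lie_leib\<close> then allows recursion over the left
  one. Both rules concern homogeneous elements, and additivity covers the rest.\<close>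

lemma free_leibniz_bracket_unique:
  assumes "is_free_leibniz_bracket K V br l" "is_free_leibniz_bracket K V br m"
  shows "l = m"
proof -
  interpret l: lie_leibniz_algebra K F grF fbr l
    using assms(1) by (simp add: is_free_leibniz_bracket_def)
  interpret m: lie_leibniz_algebra K F grF fbr m
    using assms(2) by (simp add: is_free_leibniz_bracket_def)
  have gens: "l (gen x) (gen y) = m (gen x) (gen y)" if "x \<in> carrier V" "y \<in> carrier V" for x y
    using assms that by (simp add: is_free_leibniz_bracket_def)
  note add_simps = F.bilinear_add_left[OF l.leib_bilinear] F.bilinear_add_left[OF m.leib_bilinear]
    F.bilinear_add_right[OF l.leib_bilinear] F.bilinear_add_right[OF m.leib_bilinear]
  have gen: "l (gen x) B = m (gen x) B" if x: "x \<in> carrier V" and "B \<in> carrier F" for x B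
    using that(2)
  proof (induction rule: free_lie_gen_induct)
    case (gen y)
    with x show ?case by (rule gens)
  next
    case (bracket n y B)
    then show ?case
      using l.leib_lie[OF gen_degree[OF x] gen_degree[OF bracket(1)] bracket(2)]
        m.leib_lie[OF gen_degree[OF x] gen_degree[OF bracket(1)] bracket(2)] x
      by (simp add: gens)
  next
    case (add A B)
    with x show ?case by (simp add: add_simps)
  qed
  \<comment> \<open>All \<open>B\<close> at once: for the left argument \<open>(x, A)\<close> the
    rule \<open>lie_leib\<close> refers back to the bracket of \<open>A\<close> with the generator
    \<open>x\<close>, not with \<open>B\<close>.\<close>
  have "\<forall>B\<in>carrier F. l A B = m A B" if "A \<in> carrier F" for A
    using that
  proof (induction rule: free_lie_gen_induct)
    case (gen x)
    then show ?case using \<open>\<And>x B. x \<in> carrier V \<Longrightarrow> B \<in> carrier F \<Longrightarrow> l (gen x) B = m (gen x) B\<close> by blast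
  next
    case (bracket n x A)
    have A: "A \<in> carrier F" using bracket F.submoduleE(1)[OF submodule_free_grading] by blast
    have "l (fbr (gen x) A) B = m (fbr (gen x) A) B" if "B \<in> carrier F" for B
      using that
    proof (induction rule: GL.graded_induct)
      case (homogeneous k B)
      then show ?case
        using l.lie_leib[OF gen_degree[OF bracket(1)] bracket(2) homogeneous]
          m.lie_leib[OF gen_degree[OF bracket(1)] bracket(2) homogeneous] bracket A gen
        by simp
    next
      case (add B C)
      with bracket A show ?case by (simp add: add_simps)
    qed
    then show ?case by blast
  next
    case (add A B)
    then show ?case by (simp add: add_simps)
  qed
  moreover have "l A B = m A B" if "\<not> (A \<in> carrier F \<and> B \<in> carrier F)" for A B
    using assms[unfolded is_free_leibniz_bracket_def, THEN conjunct1] that by simp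
  ultimately have "l A B = m A B" for A B by (cases "A \<in> carrier F \<and> B \<in> carrier F") auto
  then show ?thesis by (intro ext)
qed

lemma free_leibniz_bracket_eq: "free_leibniz_bracket K V br = leibF"
  unfolding free_leibniz_bracket_def
proof (rule the_equality)
  show "is_free_leibniz_bracket K V br leibF" by (rule leibF_is_free_leibniz_bracket)
  show "l = leibF" if "is_free_leibniz_bracket K V br l" for l
    using that leibF_is_free_leibniz_bracket by (rule free_leibniz_bracket_unique)
qed

end

section \<open>Universality\<close>

lemma dg_lie_homs_compose:
  assumes "dg_lie_algebra K V grV lieV DV" "dg_lie_algebra K W grW lieW DW"
    and h: "h \<in> dg_lie_homs K V grV lieV DV W grW lieW DW"
    and k: "k \<in> dg_lie_homs K W grW lieW DW U grU lieU DU"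
  shows "compose (carrier V) k h \<in> dg_lie_homs K V grV lieV DV U grU lieU DU"
proof -
  interpret V: dg_lie_algebra K V grV lieV DV by fact
  have lin: "linear_map K V W h" "linear_map K W U k"
    using h k by (auto simp: dg_lie_homs_def)
  have "linear_map K V U (compose (carrier V) k h)"
    using linear_map_cong[OF linear_map_compose[OF lin] V.module_axioms] by (simp add: compose_eq)
  with h k linear_map_closed[OF lin(1)] V.gr_closed show ?thesis
    by (simp add: dg_lie_homs_def compose_eq)
qed

context leibniz_algebra
begin

lemma derived_bracket_reps_compose:
  assumes "dg_lie_algebra K W grW lieW DW"
    and h: "h \<in> derived_bracket_reps K V br W grW lieW DW"
    and k: "k \<in> dg_lie_homs K W grW lieW DW U grU lieU DU"
  shows "compose (carrier V) k h \<in> derived_bracket_reps K V br U grU lieU DU"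
proof -
  interpret W: dg_lie_algebra K W grW lieW DW by fact
  have lin: "linear_map K V W h" "linear_map K W U k"
    using h k by (auto simp: derived_bracket_reps_def odd_leibniz_homs_def dg_lie_homs_def)
  have "linear_map K V U (compose (carrier V) k h)"
    using linear_map_cong[OF linear_map_compose[OF lin] module_axioms] by (simp add: compose_eq)
  moreover have "x \<in> carrier V" if "x \<in> shift_grading V n" for x n
    using that by (auto simp: shift_grading_def split: if_splits)
  ultimately show ?thesis
    using h k linear_map_closed[OF lin(1)]
    by (simp add: derived_bracket_reps_def odd_leibniz_homs_def dg_lie_homs_def derived_bracket_def
        compose_eq)
qed

lemma DR_incl_closed: "DR_incl K V br \<in> carrier V \<rightarrow> carrier R"
  using linear_map_closed[OF linear_emb] by (simp add: DR_incl_def)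

text \<open>The derived bracket of the generators \<open>x\<close> and \<open>y\<close> is the
  action of the class of \<open>x\<close> on \<open>y\<close>, which is \<open>[x, y]\<close> by
  construction.\<close>

lemma DR_incl_rep: "DR_incl K V br \<in> derived_bracket_reps K V br R grR rbr dR"
  unfolding derived_bracket_reps_def odd_leibniz_homs_def
proof (intro CollectI conjI allI ballI)
  interpret VR: two_modules K V R by (intro two_modules.intro module_axioms module_DR)
  show "DR_incl K V br \<in> extensional (carrier V)" by (simp add: DR_incl_def)
  show lin: "linear_map K V R (DR_incl K V br)"
    using linear_map_cong[OF linear_map_compose[OF linear_gen linear_emb] module_axioms]
    by (simp add: DR_incl_def)
  show "DR_incl K V br x \<in> grR n" if "x \<in> shift_grading V n" for x n
  proof (cases "n = -1")
    case True
    with that show ?thesis by (simp add: shift_grading_def DR_incl_def DR_grading_emb gen_degree)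
  next
    case False
    with that show ?thesis
      using VR.linear_zero[OF lin] VR.W.submodule_zero[OF submodule_DR_grading]
      by (simp add: shift_grading_def)
  qed
  show "DR_incl K V br (br x y) = derived_bracket rbr dR (DR_incl K V br x) (DR_incl K V br y)"
    if "x \<in> carrier V" "y \<in> carrier V" for x y
    using that by (simp add: DR_incl_def derived_bracket_def dR_emb dF_gen DR_bracket_quot_emb
        free_act_gen)
qed

end

locale derived_representation = leibniz_algebra K V br + H: dg_lie_algebra K H gr lie D
  for K (structure) and V (structure) and br and H (structure) and gr and lie and D +
  fixes f
  assumes f_rep: "f \<in> derived_bracket_reps K V br H gr lie D"
begin

interpretation F: char0_vector_space K F by (rule char0_free_lie)
interpretation Q: module K Q by (rule module_quot_lie)
interpretation GL: graded_lie_algebra K F grF fbr by (rule graded_lie_free_lie)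
interpretation R: dg_lie_algebra K R grR rbr dR by (rule dg_lie_dR)
interpretation VH: two_modules K V H ..
interpretation FH: two_modules K F H ..

lemma f_linear: "linear_map K V H f"
  and f_degree: "x \<in> carrier V \<Longrightarrow> f x \<in> gr (-1)"
  and f_bracket: "x \<in> carrier V \<Longrightarrow> y \<in> carrier V \<Longrightarrow> f (br x y) = lie (D (f x)) (f y)"
  and f_extensional: "f \<in> extensional (carrier V)"
  using f_rep by (auto simp: derived_bracket_reps_def odd_leibniz_homs_def shift_grading_def
      derived_bracket_def)

lemma f_closed [simp]: "x \<in> carrier V \<Longrightarrow> f x \<in> carrier H"
  by (rule linear_map_closed[OF f_linear])

lemma Df_degree: "x \<in> carrier V \<Longrightarrow> D (f x) \<in> gr 0"
  using H.D_degree[OF f_degree] by simp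

lemma f_evaluation: "lie_evaluation K H gr lie V f"
  by (intro lie_evaluation.intro lie_evaluation_axioms.intro H.pregraded_lie_algebra
      module_axioms f_linear f_degree)

interpretation f: lie_evaluation K H gr lie V f by (rule f_evaluation)

section \<open>The induced morphism on the free Lie algebra\<close>

definition "freeH = lift_class (term_eval H lie f)"

lemma freeH_class: "t \<in> terms \<Longrightarrow> freeH (cls t) = term_eval H lie f t"
  unfolding freeH_def by (rule lift_class[OF _ f.term_eval_cong])

lemma linear_freeH: "linear_map K F H freeH"
  by (rule linear_mapI) (auto simp: carrier_free_lie add_lie_class smult_lie_class freeH_class)

lemmas freeH_closed [simp] = linear_map_closed[OF linear_freeH]
lemmas freeH_zero [simp] = FH.linear_zero[OF linear_freeH]

lemma freeH_gen: "x \<in> carrier V \<Longrightarrow> freeH (gen x) = f x"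
  by (simp add: freeH_class)

lemma freeH_bracket:
  "A \<in> carrier F \<Longrightarrow> B \<in> carrier F \<Longrightarrow> freeH (fbr A B) = lie (freeH A) (freeH B)"
  by (auto simp: carrier_free_lie free_bracket_lie_class freeH_class)

lemma freeH_degree:
  assumes "A \<in> grF n"
  shows "freeH A \<in> gr n"
  using assms
proof (cases rule: free_grading_cases)
  case 1
  then show ?thesis using H.submodule_zero[OF H.gr_submodule] by simp
next
  case (2 m t)
  then show ?thesis using f.term_eval_degree by (simp add: freeH_class)
qed

section \<open>The induced map on the quotient\<close>

lemma D_f_kernel:
  assumes "x \<in> I"
  shows "D (f x) = \<zero>\<^bsub>H\<^esub>"
proof -
  have lin: "linear_map K V H (\<lambda>x. D (f x))" by (rule linear_map_compose[OF f_linear H.D_linear])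
  let ?N = "{x \<in> carrier V. D (f x) = \<zero>\<^bsub>H\<^esub>}"
  have "I \<subseteq> ?N"
  proof (rule kernel_minimal)
    show "submodule ?N K V"
      by (rule submoduleI) (auto simp: VH.linear_zero[OF lin] VH.linear_minus[OF lin]
          linear_map_add[OF lin] linear_map_smult[OF lin])
    fix x y assume xy: "x \<in> carrier V" "y \<in> carrier V"
    \<comment> \<open>\<open>f x\<close> has degree \<open>-1\<close>, so the sign
      \<open>(-1)^(i + 1)\<close> of \<open>D_derived\<close> is trivial.\<close>
    have "D (lie (D (f x)) (f y)) = lie (D (f x)) (D (f y))" if "x \<in> carrier V" "y \<in> carrier V" for x y
      using H.D_derived[OF f_degree f_degree, OF that] by (simp add: sgnv_0)
    moreover have "lie (D (f x)) (D (f y)) = \<ominus>\<^bsub>H\<^esub> lie (D (f y)) (D (f x))"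
      using H.lie_antisym[OF Df_degree Df_degree, OF xy] by (simp add: sgnv_0)
    ultimately show "br x y \<oplus>\<^bsub>V\<^esub> br y x \<in> ?N"
      using xy by (simp add: linear_map_add[OF lin] f_bracket H.M.l_neg)
  qed
  with assms show ?thesis by blast
qed

definition "quotH X = D (f (SOME x. x \<in> X))"

lemma quotH_class:
  assumes "x \<in> carrier V"
  shows "quotH (q x) = D (f x)"
proof -
  have lin: "linear_map K V H (\<lambda>x. D (f x))" by (rule linear_map_compose[OF f_linear H.D_linear])
  define y where "y = (SOME y. y \<in> q x)"
  have "y \<in> q x" unfolding y_def using quot_class_self[OF assms] by (rule someI)
  then have y: "y \<in> carrier V" "y \<oplus>\<^bsub>V\<^esub> \<ominus>\<^bsub>V\<^esub> x \<in> I" using assms by (auto simp: mem_quot_class)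
  have "D (f y) \<oplus>\<^bsub>H\<^esub> \<ominus>\<^bsub>H\<^esub> D (f x) = \<zero>\<^bsub>H\<^esub>"
    using D_f_kernel[OF y(2)] y(1) assms by (simp add: linear_map_add[OF lin] VH.linear_minus[OF lin])
  then show ?thesis
    unfolding quotH_def y_def[symmetric]
    using H.M.eq_if_diff_zero[of "D (f y)" "D (f x)"] y(1) assms by (simp add: a_minus_def)
qed

lemma linear_quotH: "linear_map K Q H quotH"
  by (rule linear_mapI) (auto simp: carrier_quot_lie add_quot_class smult_quot_class quotH_class
      linear_map_add[OF f_linear] linear_map_add[OF H.D_linear]
      linear_map_smult[OF f_linear] linear_map_smult[OF H.D_linear])

interpretation QH: two_modules K Q H ..

lemmas quotH_closed [simp] = linear_map_closed[OF linear_quotH]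
lemmas quotH_zero [simp] = QH.linear_zero[OF linear_quotH]

lemma quotH_degree: "X \<in> carrier Q \<Longrightarrow> quotH X \<in> gr 0"
  by (auto simp: carrier_quot_lie quotH_class Df_degree)

text \<open>\<open>D (f [x, y]) = D (D (f x), f y) = (D (f x), D (f y))\<close>, because
  \<open>D\<close> squares to zero.\<close>

lemma quotH_bracket:
  assumes "X \<in> carrier Q" "Y \<in> carrier Q"
  shows "quotH (qbr X Y) = lie (quotH X) (quotH Y)"
proof -
  obtain x y where xy: "x \<in> carrier V" "X = q x" "y \<in> carrier V" "Y = q y"
    using assms by (auto simp: carrier_quot_lie)
  then show ?thesis
    using H.D_derived[OF f_degree f_degree, OF xy(1,3)]
    by (simp add: quot_bracket_class quotH_class f_bracket sgnv_0)
qed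

lemma D_quotH: "X \<in> carrier Q \<Longrightarrow> D (quotH X) = \<zero>\<^bsub>H\<^esub>"
  by (auto simp: carrier_quot_lie quotH_class H.D_square)

text \<open>In \<open>A\<close> both sides are derivations along \<open>freeH\<close>, and on
  generators the claim is the defining property of a derived bracket representation.\<close>

lemma freeH_act:
  assumes X: "X \<in> carrier Q" and "A \<in> carrier F"
  shows "freeH (act X A) = lie (quotH X) (freeH A)"
  using assms(2)
proof (induction rule: free_lie_gen_induct)
  case (gen y)
  obtain x where "x \<in> carrier V" "X = q x" using X by (auto simp: carrier_quot_lie)
  with gen show ?case by (simp add: free_act_gen freeH_gen f_bracket quotH_class)
next
  case (bracket n y A)
  have A: "A \<in> carrier F" using bracket F.submoduleE(1)[OF submodule_free_grading] by blast
  have y: "freeH (act X (gen y)) = lie (quotH X) (f y)"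
  proof -
    obtain x where "x \<in> carrier V" "X = q x" using X by (auto simp: carrier_quot_lie)
    with bracket show ?thesis by (simp add: free_act_gen freeH_gen f_bracket quotH_class)
  qed
  have "lie (quotH X) (lie (f y) (freeH A)) =
      lie (lie (quotH X) (f y)) (freeH A) \<oplus>\<^bsub>H\<^esub> lie (f y) (lie (quotH X) (freeH A))"
    using H.lie_jacobi[OF quotH_degree[OF X] f_degree[OF bracket(1)] freeH_degree[OF bracket(2)]]
    by (simp add: sgnv_0)
  with bracket X A y show ?case
    by (simp add: free_act_bracket linear_map_add[OF linear_freeH] freeH_bracket freeH_gen)
next
  case (add A B)
  with X show ?case by (simp add: free_act_add linear_map_add[OF linear_freeH] H.lie_add_right)
qed

text \<open>\<open>quotH X\<close> has degree \<open>0\<close>, so the sign of antisymmetry does not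
  depend on the degree of the other argument and the identity extends to sums.\<close>

lemma lie_freeH_quotH:
  assumes X: "X \<in> carrier Q" and "A \<in> carrier F"
  shows "lie (freeH A) (quotH X) = \<ominus>\<^bsub>H\<^esub> lie (quotH X) (freeH A)"
  using assms(2)
proof (induction rule: GL.graded_induct)
  case (homogeneous n A)
  then show ?case
    using H.lie_antisym[OF freeH_degree quotH_degree[OF X]] by (simp add: sgnv_0)
next
  case (add A B)
  with X show ?case
    by (simp add: linear_map_add[OF linear_freeH] H.lie_add_left H.lie_add_right H.M.minus_add)
qed

section \<open>The extension to \<open>DR\<close>\<close>

definition "extension = (\<lambda>Z\<in>carrier R. quotH (fst Z) \<oplus>\<^bsub>H\<^esub> freeH (snd Z))"

lemma linear_extension: "linear_map K R H extension"
proof -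
  interpret two_modules K R H ..
  have "linear_map K R H (\<lambda>Z. quotH (fst Z) \<oplus>\<^bsub>H\<^esub> freeH (snd Z))"
    by (intro linear_map_sum linear_map_compose[OF linear_fst linear_quotH]
        linear_map_compose[OF linear_snd linear_freeH])
  then show ?thesis by (rule linear_map_cong) (auto simp: extension_def module_DR)
qed

lemma extension_pair:
  "X \<in> carrier Q \<Longrightarrow> A \<in> carrier F \<Longrightarrow> extension (X, A) = quotH X \<oplus>\<^bsub>H\<^esub> freeH A"
  by (simp add: extension_def carrier_DR)

lemma extension_emb: "A \<in> carrier F \<Longrightarrow> extension (emb A) = freeH A"
  by (simp add: emb_free_def extension_pair)

lemma extension_bracket:
  assumes "Z \<in> carrier R" "W \<in> carrier R"
  shows "extension (rbr Z W) = lie (extension Z) (extension W)"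
proof -
  obtain X A Y B where Z: "Z = (X, A)" "W = (Y, B)"
    and [simp]: "X \<in> carrier Q" "A \<in> carrier F" "Y \<in> carrier Q" "B \<in> carrier F"
    using assms by (auto simp: carrier_DR)
  have [simp]: "qbr X Y \<in> carrier Q" by (rule Q.bilinear_closed[OF bilinear_quot_bracket]) simp_all
  show ?thesis
    unfolding Z
    by (simp add: DR_bracket_pair extension_pair a_minus_def quotH_bracket freeH_act freeH_bracket
        linear_map_add[OF linear_freeH] FH.linear_minus[OF linear_freeH] H.lie_add_left
        H.lie_add_right lie_freeH_quotH H.M.a_ac)
qed

text \<open>Both sides are derivations of degree \<open>1\<close> along \<open>freeH\<close> with
  the value \<open>D (f x)\<close> on generators.\<close>

lemma extension_dF:
  assumes "A \<in> carrier F"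
  shows "extension (dF A) = D (freeH A)"
  using assms
proof (induction rule: free_lie_gen_induct)
  case (gen x)
  then show ?case by (simp add: dF_gen extension_pair quotH_class freeH_gen)
next
  case (bracket n x A)
  interpret RH: two_modules K R H ..
  have A: "A \<in> carrier F" using bracket F.submoduleE(1)[OF submodule_free_grading] by blast
  have dx: "extension (dF (gen x)) = D (f x)"
    using bracket(1) by (simp add: dF_gen extension_pair quotH_class)
  have "D (lie (f x) (freeH A)) = lie (D (f x)) (freeH A) \<oplus>\<^bsub>H\<^esub> \<ominus>\<^bsub>H\<^esub> lie (f x) (D (freeH A))"
    using H.D_derivation[OF f_degree[OF bracket(1)] freeH_degree[OF bracket(2)]]
    by (simp add: sgnv_def)
  then show ?case
    using bracket A dF_bracket[OF gen_degree[OF bracket(1)] A] dx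
    by (simp add: sgnv_def linear_map_add[OF linear_extension] RH.linear_minus[OF linear_extension]
        extension_bracket extension_emb freeH_bracket freeH_gen)
next
  case (add A B)
  then show ?case
    by (simp add: linear_map_add[OF linear_dF] linear_map_add[OF linear_extension]
        linear_map_add[OF linear_freeH] linear_map_add[OF H.D_linear])
qed

lemma extension_dg_lie_hom: "extension \<in> dg_lie_homs K R grR rbr dR H gr lie D"
  unfolding dg_lie_homs_def
proof (intro CollectI conjI allI ballI linear_extension extension_bracket)
  show "extension \<in> extensional (carrier R)" by (simp add: extension_def)
  show "extension Z \<in> gr n" if "Z \<in> grR n" for Z n
    using that
    by (cases rule: DR_grading_cases) (auto simp: extension_pair extension_emb freeH_degree quotH_degree)
  show "extension (dR Z) = D (extension Z)" if Z: "Z \<in> carrier R" for Z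
  proof -
    obtain X A where "Z = (X, A)" "X \<in> carrier Q" "A \<in> carrier F"
      using Z by (auto simp: carrier_DR)
    with Z show ?thesis
      by (simp add: dR_def extension_dF extension_pair linear_map_add[OF H.D_linear] D_quotH)
  qed
qed

lemma extension_incl: "f = compose (carrier V) extension (DR_incl K V br)"
proof (rule extensionalityI[OF f_extensional compose_extensional])
  show "f x = compose (carrier V) extension (DR_incl K V br) x" if "x \<in> carrier V" for x
    using that by (simp add: compose_eq DR_incl_def extension_emb freeH_gen)
qed

lemma extension_unique:
  assumes "\<psi> \<in> dg_lie_homs K R grR rbr dR H gr lie D"
    and "f = compose (carrier V) \<psi> (DR_incl K V br)"
  shows "\<psi> = extension"
proof (rule extensionalityI)
  show "\<psi> \<in> extensional (carrier R)" "extension \<in> extensional (carrier R)"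
    using assms(1) by (auto simp: dg_lie_homs_def extension_def)
  have lin: "linear_map K R H \<psi>"
    and br: "\<And>Z W. Z \<in> carrier R \<Longrightarrow> W \<in> carrier R \<Longrightarrow> \<psi> (rbr Z W) = lie (\<psi> Z) (\<psi> W)"
    and d: "\<And>Z. Z \<in> carrier R \<Longrightarrow> \<psi> (dR Z) = D (\<psi> Z)"
    using assms(1) by (auto simp: dg_lie_homs_def)
  have gen: "\<psi> (emb (gen x)) = f x" if "x \<in> carrier V" for x
    using that by (subst assms(2)) (simp add: compose_eq DR_incl_def)
  have quot: "\<psi> (X, \<zero>\<^bsub>F\<^esub>) = quotH X" if X: "X \<in> carrier Q" for X
  proof -
    obtain x where x: "x \<in> carrier V" "X = q x" using X by (auto simp: carrier_quot_lie)
    then have "\<psi> (dR (emb (gen x))) = D (f x)" by (simp add: d gen)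
    with x show ?thesis by (simp add: dR_emb dF_gen quotH_class)
  qed
  have emb: "\<psi> (emb A) = freeH A" if "A \<in> carrier F" for A
    using that
  proof (induction rule: free_lie_gen_induct)
    case (gen x)
    then show ?case using \<open>\<And>x. x \<in> carrier V \<Longrightarrow> \<psi> (emb (gen x)) = f x\<close> by (simp add: freeH_gen)
  next
    case (bracket n x A)
    have A: "A \<in> carrier F" using bracket F.submoduleE(1)[OF submodule_free_grading] by blast
    with bracket show ?case
      using br[of "emb (gen x)" "emb A"] gen by (simp add: DR_bracket_emb_emb freeH_bracket freeH_gen)
  next
    case (add A B)
    then show ?case
      by (simp add: linear_map_add[OF linear_emb] linear_map_add[OF lin] linear_map_add[OF linear_freeH])
  qed
  fix Z assume "Z \<in> carrier R"
  then obtain X A where Z: "X \<in> carrier Q" "A \<in> carrier F" "Z = (X, A)" by (auto simp: carrier_DR)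
  then have "Z = (X, \<zero>\<^bsub>F\<^esub>) \<oplus>\<^bsub>R\<^esub> emb A" by (simp add: emb_free_def add_DR)
  moreover have "(X, \<zero>\<^bsub>F\<^esub>) \<in> carrier R" using Z by (simp add: carrier_DR)
  ultimately have "\<psi> Z = quotH X \<oplus>\<^bsub>H\<^esub> freeH A"
    using Z(1,2) by (simp add: linear_map_add[OF lin] quot emb)
  also have "\<dots> = extension Z" using Z by (simp add: extension_pair)
  finally show "\<psi> Z = extension Z" .
qed

end

context leibniz_algebra
begin

context
  fixes H :: "('a, 'h, 'e) module_scheme" and gr lie D
  assumes dg: "dg_lie_algebra K H gr lie D"
begin

lemma DR_universal:
  assumes "f \<in> derived_bracket_reps K V br H gr lie D"
  shows "\<exists>!\<psi>. \<psi> \<in> dg_lie_homs K R grR rbr dR H gr lie D \<and> f = compose (carrier V) \<psi> (DR_incl K V br)"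
proof -
  interpret derived_representation K V br H gr lie D f
    using assms dg leibniz_algebra_axioms
    by (intro derived_representation.intro derived_representation_axioms.intro)
  show ?thesis
    using extension_dg_lie_hom extension_incl extension_unique by (intro ex1I[of _ extension]) blast+
qed

lemma DR_restriction_bij:
  "bij_betw (\<lambda>\<psi>. compose (carrier V) \<psi> (DR_incl K V br))
    (dg_lie_homs K R grR rbr dR H gr lie D) (derived_bracket_reps K V br H gr lie D)"
proof (rule bij_betwI')
  let ?r = "\<lambda>\<psi>. compose (carrier V) \<psi> (DR_incl K V br)"
  show rep: "?r \<psi> \<in> derived_bracket_reps K V br H gr lie D"
    if "\<psi> \<in> dg_lie_homs K R grR rbr dR H gr lie D" for \<psi>
    by (rule derived_bracket_reps_compose[OF dg_lie_dR DR_incl_rep that])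
  show "?r \<psi> = ?r \<chi> \<longleftrightarrow> \<psi> = \<chi>"
    if "\<psi> \<in> dg_lie_homs K R grR rbr dR H gr lie D" "\<chi> \<in> dg_lie_homs K R grR rbr dR H gr lie D" for \<psi> \<chi>
    using that DR_universal[OF rep[OF that(1)]] by metis
  show "\<exists>\<psi>\<in>dg_lie_homs K R grR rbr dR H gr lie D. f = ?r \<psi>"
    if "f \<in> derived_bracket_reps K V br H gr lie D" for f
    using DR_universal[OF that] by blast
qed

end

end

theorem theorem3p4:
  fixes K :: "('k, 'a) ring_scheme"
    and g :: "('k, 'g, 'b) module_scheme"
    and br :: "'g \<Rightarrow> 'g \<Rightarrow> 'g"
  assumes "leibniz_algebra K g br"
  shows
    "(\<exists>!d. is_DR_differential K g br d) \<and>
     (\<exists>!leib. is_free_leibniz_bracket K g br leib) \<and>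
     dg_lie_algebra K (DR K g br) (DR_grading K g br) (DR_bracket K g br) (DR_diff K g br) \<and>
     (\<forall>\<alpha>\<in>carrier (free_lie K g). \<forall>\<beta>\<in>carrier (free_lie K g).
        emb_free K g br (free_leibniz_bracket K g br \<alpha> \<beta>) =
        derived_bracket (DR_bracket K g br) (DR_diff K g br)
          (emb_free K g br \<alpha>) (emb_free K g br \<beta>)) \<and>
     DR_incl K g br \<in> derived_bracket_reps K g br
        (DR K g br) (DR_grading K g br) (DR_bracket K g br) (DR_diff K g br) \<and>
     (\<forall>(H :: ('k, 'h, 'c) module_scheme) grH lieH DH.
        dg_lie_algebra K H grH lieH DH \<longrightarrow>
        (\<forall>f\<in>derived_bracket_reps K g br H grH lieH DH.
           \<exists>!\<psi>. \<psi> \<in> dg_lie_homs K (DR K g br) (DR_grading K g br) (DR_bracket K g br) (DR_diff K g br)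
                       H grH lieH DH \<and>
                f = compose (carrier g) \<psi> (DR_incl K g br)) \<and>
        bij_betw (\<lambda>\<psi>. compose (carrier g) \<psi> (DR_incl K g br))
          (dg_lie_homs K (DR K g br) (DR_grading K g br) (DR_bracket K g br) (DR_diff K g br)
             H grH lieH DH)
          (derived_bracket_reps K g br H grH lieH DH)) \<and>
     (\<forall>(H :: ('k, 'h, 'c) module_scheme) grH lieH DH
       (H' :: ('k, 'h2, 'e) module_scheme) grH' lieH' DH'.
        dg_lie_algebra K H grH lieH DH \<and> dg_lie_algebra K H' grH' lieH' DH' \<longrightarrow>
        (\<forall>\<chi>\<in>dg_lie_homs K H grH lieH DH H' grH' lieH' DH'.
           (\<forall>f\<in>derived_bracket_reps K g br H grH lieH DH.
              compose (carrier g) \<chi> f \<in> derived_bracket_reps K g br H' grH' lieH' DH') \<and>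
           (\<forall>\<psi>\<in>dg_lie_homs K (DR K g br) (DR_grading K g br) (DR_bracket K g br) (DR_diff K g br)
                     H grH lieH DH.
              compose (carrier (DR K g br)) \<chi> \<psi> \<in>
                dg_lie_homs K (DR K g br) (DR_grading K g br) (DR_bracket K g br) (DR_diff K g br)
                  H' grH' lieH' DH' \<and>
              compose (carrier g) (compose (carrier (DR K g br)) \<chi> \<psi>) (DR_incl K g br) =
                compose (carrier g) \<chi> (compose (carrier g) \<psi> (DR_incl K g br)))))"
proof -
  interpret leibniz_algebra K g br by fact
  show ?thesis
    \<comment> \<open>The two definite descriptions give way to the explicit \<open>dR\<close> and
      \<open>leibF\<close>.\<close>
    unfolding DR_diff_eq free_leibniz_bracket_eq
  proof (intro conjI allI impI ballI; (elim conjE)?)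
    show "\<exists>!d. is_DR_differential K g br d"
      by (rule ex1I[of _ dR]) (rule dR_is_differential DR_differential_unique, assumption?)+
    show "\<exists>!leib. is_free_leibniz_bracket K g br leib"
      by (rule ex1I[of _ leibF])
        (rule leibF_is_free_leibniz_bracket,
          rule free_leibniz_bracket_unique[OF _ leibF_is_free_leibniz_bracket])
    show "dg_lie_algebra K R grR rbr dR" by (rule dg_lie_dR)
    show "DR_incl K g br \<in> derived_bracket_reps K g br R grR rbr dR" by (rule DR_incl_rep)
    show "emb (leibF \<alpha> \<beta>) = derived_bracket rbr dR (emb \<alpha>) (emb \<beta>)"
      if "\<alpha> \<in> carrier F" "\<beta> \<in> carrier F" for \<alpha> \<beta>
      using that by (simp add: derived_bracket_def dR_emb emb_leibF)
  next
    fix H :: "('k, 'h, 'c) module_scheme" and grH lieH DH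
    assume H: "dg_lie_algebra K H grH lieH DH"
    show "bij_betw (\<lambda>\<psi>. compose (carrier g) \<psi> (DR_incl K g br))
        (dg_lie_homs K R grR rbr dR H grH lieH DH) (derived_bracket_reps K g br H grH lieH DH)"
      by (rule DR_restriction_bij[OF H])
    show "\<exists>!\<psi>. \<psi> \<in> dg_lie_homs K R grR rbr dR H grH lieH DH \<and>
        f = compose (carrier g) \<psi> (DR_incl K g br)"
      if "f \<in> derived_bracket_reps K g br H grH lieH DH" for f
      by (rule DR_universal[OF H that])
  next
    fix H :: "('k, 'h, 'c) module_scheme" and grH lieH DH
      and H' :: "('k, 'h2, 'e) module_scheme" and grH' lieH' DH' \<chi>
    assume H: "dg_lie_algebra K H grH lieH DH" "dg_lie_algebra K H' grH' lieH' DH'"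
      and \<chi>: "\<chi> \<in> dg_lie_homs K H grH lieH DH H' grH' lieH' DH'"
    show "compose (carrier g) \<chi> f \<in> derived_bracket_reps K g br H' grH' lieH' DH'"
      if "f \<in> derived_bracket_reps K g br H grH lieH DH" for f
      by (rule derived_bracket_reps_compose[OF H(1) that \<chi>])
    fix \<psi> assume \<psi>: "\<psi> \<in> dg_lie_homs K R grR rbr dR H grH lieH DH"
    show "compose (carrier R) \<chi> \<psi> \<in> dg_lie_homs K R grR rbr dR H' grH' lieH' DH'"
      by (rule dg_lie_homs_compose[OF dg_lie_dR H(1) \<psi> \<chi>])
    show "compose (carrier g) (compose (carrier R) \<chi> \<psi>) (DR_incl K g br) =
        compose (carrier g) \<chi> (compose (carrier g) \<psi> (DR_incl K g br))"
      \<comment> \<open>Naturality is associativity of extensional composition, for which the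
        inclusion has to take its values in the carrier of \<open>DR\<close>.\<close>
      by (rule compose_assoc[OF DR_incl_closed, symmetric])
  qed
qed

end
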